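(* Let $f\in\mathbb{Z}[x,y]$ be an irreducible binary form, and let $W:\mathbb{R}\to\mathbb{R}$ be a fixed smooth nonnegative function with compact support in $[0,1]$, with $\hat W(0)=\int_{\mathbb{R}}W(t)\,dt$. Let $N\geq 1$ and let $\alpha_m$ be complex numbers with $|\alpha_m|\leq 1$, supported on prime values of $m$. For a positive integer $d$ define $$A_d(N,\alpha)=\sum_{\substack{(m,n)\in(0,N]\times\mathbb{Z}\\ f(m,n)\equiv 0\pmod d}}\alpha_m W\!\left(\frac{n}{N}\right),\qquad M_d(N,\alpha)=\frac{N\nu(d)\hat W(0)}{d}\sum_{m\leq N}\alpha_m,$$ where $\nu(d)$ is the number of $n\bmod d$ with $f(1,n)\equiv 0\pmod d$. Suppose $\delta_1>0$ and $1\leq D\leq N^{4/3-\delta_1}$. Then there exists $\delta_2>0$ depending only on $\delta_1$ such that $$\sum_{D\leq d<2D}|A_d(N,\alpha)-M_d(N,\alpha)|\ll_{\delta_1}N^{2-\delta_2},$$ where the implied constant depends only on $\delta_1$, $f$ and $W$.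
   Formalization: The binary form f is assumed to have degree at least 2; for linear forms the claim fails, e.g. f = x + y with α the indicator of primes and D = N^{1.1}, where all A_d vanish but the M_d sum to order N^2/log N. *)

theory Defs
  imports
    "HOL-Analysis.Analysis"
    "HOL-Computational_Algebra.Computational_Algebra"
    "HOL-Number_Theory.Cong"
begin

text \<open>
  The ring \<open>\<int>[x,y]\<close> is represented as \<open>\<int>[x][y]\<close>, that is, by the type \<^typ>\<open>int poly poly\<close>:
  the outer variable is \<open>y\<close>, and \<open>coeff (coeff f j) i\<close> is the coefficient of \<open>x^i * y^j\<close>.
  Irreducibility is thus the library's \<^const>\<open>irreducible\<close> in this ring.
\<close>

definition form_eval :: "int poly poly \<Rightarrow> int \<Rightarrow> int \<Rightarrow> int" where
  "form_eval f a b = poly (poly f [:b:]) a"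

definition binary_form :: "nat \<Rightarrow> int poly poly \<Rightarrow> bool" where
  "binary_form k f \<longleftrightarrow> f \<noteq> 0 \<and> (\<forall>i j. coeff (coeff f j) i \<noteq> 0 \<longrightarrow> i + j = k)"

definition smooth :: "(real \<Rightarrow> real) \<Rightarrow> bool" where
  "smooth W \<longleftrightarrow> (\<forall>k x. (deriv ^^ k) W differentiable (at x))"

definition hat_zero :: "(real \<Rightarrow> real) \<Rightarrow> real" where
  "hat_zero W = (LBINT t. W t)"

definition root_count :: "int poly poly \<Rightarrow> nat \<Rightarrow> nat" where
  "root_count f d = card {n \<in> {0..<int d}. [form_eval f 1 n = 0] (mod int d)}"

text \<open>
  For \<open>W\<close> of bounded support only finitely many terms of the following sum over
  \<open>(0,N] \<times> \<int>\<close> are nonzero.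
\<close>

definition A_sum ::
  "int poly poly \<Rightarrow> (real \<Rightarrow> real) \<Rightarrow> nat \<Rightarrow> real \<Rightarrow> (nat \<Rightarrow> complex) \<Rightarrow> complex" where
  "A_sum f W d N \<alpha> =
     (\<Sum>\<^sub>\<infinity>(m, n) \<in> {(m :: nat, n :: int). 0 < m \<and> real m \<le> N \<and>
                          [form_eval f (int m) n = 0] (mod int d)}.
        \<alpha> m * complex_of_real (W (real_of_int n / N)))"

definition M_sum ::
  "int poly poly \<Rightarrow> (real \<Rightarrow> real) \<Rightarrow> nat \<Rightarrow> real \<Rightarrow> (nat \<Rightarrow> complex) \<Rightarrow> complex" where
  "M_sum f W d N \<alpha> =
     complex_of_real (N * real (root_count f d) * hat_zero W / real d) *
     (\<Sum>m | 0 < m \<and> real m \<le> N. \<alpha> m)"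

end

theory Submission
  imports Defs "HOL-Number_Theory.Totient" "HOL-Analysis.Kronecker_Approximation_Theorem"
begin

text \<open>
  For a prime \<open>m\<close> not dividing \<open>d\<close>, the condition \<open>d | f(m,n)\<close> says \<open>n \<equiv> m v (mod d)\<close> for a root \<open>v\<close> of
  \<open>f(1,v)\<close> modulo \<open>d\<close>. Detecting this congruence by additive characters modulo \<open>d\<close>, the frequency \<open>0\<close>
  gives \<open>M_d\<close>, the frequencies beyond \<open>H = D N^(\<epsilon> - 1)\<close> are negligible by repeated summation by parts,
  and Abel summation in the frequency removes the weight from the remaining ones. This leaves
  \<open>\<Sum> |\<Sum> \<alpha>_m e(h m v / d)|\<close>, with outer sum over the pairs \<open>(d, v)\<close> and inner sum over \<open>h \<le> H\<close>, \<open>m \<le> N\<close>,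
  that is, an exponential sum of length about \<open>D\<close> at the points \<open>v / d\<close>. By a
  lattice argument, Dirichlet approximation and the divisor bound for values of \<open>f\<close>, an interval of
  length \<open>1 / D\<close> contains at most \<open>D^(1/2 + \<epsilon>)\<close> of these points, so a large sieve inequality bounds
  the sum by \<open>D^(7/4 + \<epsilon>)\<close>. The total error is \<open>N D^(3/4) N^\<epsilon>\<close>, which is admissible for \<open>D\<close> up to
  \<open>N^(4/3 - \<delta>)\<close>.
\<close>

section \<open>Divisors and values of irreducible binary forms\<close>

text \<open>The coefficients \<alpha> are arbitrary apart from size and support, so cancellation can
  come only from the smooth variable n and from the distribution of the points v / d. In higher
  degree no good spacing of these points is at hand; the crowding bound replaces it. About D points,
  D^(1/2) of them per interval of length 1 / D, and total kernel size D over the intervals give a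
  double kernel sum D^(5/2); against coefficients of square norm about D, Cauchy-Schwarz makes this
  D^(7/4). Weight N and division by d turn it into N D^(3/4), which reaches the trivial size N^2
  exactly at D = N^(4/3). Every count of roots or of exceptional primes rests on one device: inject
  the objects into triples (a, b, d) with d dividing f(a, b) and (a, b) in a controlled set, and use
  that f(a, b) is nonzero and so has few divisors. Irreducibility and degree at least 2 enter
  through this nonvanishing. The support on primes makes each relevant m either coprime to d or a
  divisor of d.\<close>

lemma card_divisors_prime_power_mult:
  fixes p a m :: nat
  assumes "prime p" "\<not> p dvd m" "m > 0"
  shows "card {d. d dvd p ^ a * m} \<le> (a + 1) * card {d. d dvd m}"
proof -
  have fin: "finite {d. d dvd m}" using assms by simp
  have "{d. d dvd p ^ a * m} \<subseteq> (\<lambda>(i, e). p ^ i * e) ` ({0..a} \<times> {d. d dvd m})"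
  proof
    fix d assume "d \<in> {d. d dvd p ^ a * m}"
    then have "d dvd p ^ a * m" by simp
    then obtain b c where bc: "d = b * c" "b dvd p ^ a" "c dvd m"
      using division_decomp by blast
    then obtain i where "i \<le> a" "b = p ^ i"
      using assms(1) divides_primepow_nat by blast
    with bc show "d \<in> (\<lambda>(i, e). p ^ i * e) ` ({0..a} \<times> {d. d dvd m})"
      by force
  qed
  then have "card {d. d dvd p ^ a * m} \<le> card ({0..a} \<times> {d. d dvd m})"
    using fin by (intro surj_card_le) auto
  then show ?thesis by (simp add: card_cartesian_product)
qed

text \<open>A prime power p^a contributes the factor a + 1. When p^\<epsilon> \<ge> 2 this is at
  most 2^a \<le> p^(\<epsilon> a) and costs nothing; the finitely many smaller primes cost a
  constant factor \<open>c\<close> each. Induction strips off one full prime power at a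
  time.\<close>

lemma divisor_bound:
  fixes \<epsilon> :: real
  assumes "\<epsilon> > 0"
  shows "\<exists>C \<ge> 1. \<forall>n > 0. real (card {d :: nat. d dvd n}) \<le> C * real n powr \<epsilon>"
proof -
  \<comment> \<open>Besides c \<ge> 1, what matters is c \<epsilon> ln 2 \<ge> 1: then a + 1 \<le> c
    (1 + a \<epsilon> ln 2) \<le> c 2^(\<epsilon> a).\<close>
  define c where "c = max 1 (1 / (\<epsilon> * ln 2))"
  define B where "B = {p :: nat. prime p \<and> real p powr \<epsilon> < 2}"
  have c1: "c \<ge> 1" by (simp add: c_def)
  have "B \<subseteq> {..nat \<lceil>2 powr (1 / \<epsilon>)\<rceil>}"
  proof
    fix p assume "p \<in> B"
    then have "(real p powr \<epsilon>) powr (1 / \<epsilon>) \<le> 2 powr (1 / \<epsilon>)"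
      using assms by (intro powr_mono2) (auto simp: B_def)
    then have "real p \<le> 2 powr (1 / \<epsilon>)" using assms by (simp add: powr_powr)
    then show "p \<in> {..nat \<lceil>2 powr (1 / \<epsilon>)\<rceil>}" by simp linarith
  qed
  then have finB: "finite B" by (rule finite_subset) simp
  have small: "real (a + 1) \<le> c * (real p powr \<epsilon>) ^ a" if "prime p" for p a :: nat
  proof -
    have "1 + real a * (\<epsilon> * ln 2) \<le> exp (real a * (\<epsilon> * ln 2))" by (rule exp_ge_add_one_self)
    also have "\<dots> = (2 powr \<epsilon>) ^ a"
      by (simp add: powr_def exp_of_nat_mult)
    also have "\<dots> \<le> (real p powr \<epsilon>) ^ a"
      using assms prime_ge_2_nat[OF that] by (intro power_mono powr_mono2) auto
    finally have *: "1 + real a * (\<epsilon> * ln 2) \<le> (real p powr \<epsilon>) ^ a" .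
    have "real (a + 1) \<le> c * (1 + real a * (\<epsilon> * ln 2))"
    proof -
      have "1 = (1 / (\<epsilon> * ln 2)) * (\<epsilon> * ln 2)" using assms by simp
      also have "\<dots> \<le> c * (\<epsilon> * ln 2)"
        using assms by (intro mult_right_mono) (auto simp: c_def)
      finally have "real a * 1 \<le> real a * (c * (\<epsilon> * ln 2))" by (intro mult_left_mono) auto
      then show ?thesis using c1 by (simp add: algebra_simps)
    qed
    also have "\<dots> \<le> c * (real p powr \<epsilon>) ^ a" using * c1 by (intro mult_left_mono) auto
    finally show ?thesis .
  qed
  have large: "real (a + 1) \<le> (real p powr \<epsilon>) ^ a" if "real p powr \<epsilon> \<ge> 2" for p a :: nat
  proof -
    have "real (a + 1) \<le> 2 ^ a"
    proof (induction a)
      case (Suc a)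
      then show ?case by simp
    qed simp
    also have "\<dots> \<le> (real p powr \<epsilon>) ^ a" using that by (intro power_mono) auto
    finally show ?thesis .
  qed
  \<comment> \<open>The exponent counts the small primes dividing \<open>n\<close> rather than all
    of \<open>B\<close>, which leaves room for one more factor \<open>c\<close> when a small prime
    is restored in the induction.\<close>
  have main: "real (card {d. d dvd n}) \<le> c ^ card {p \<in> B. p dvd n} * real n powr \<epsilon>" if "n > 0" for n :: nat
    using that
  proof (induction n rule: less_induct)
    case (less n)
    show ?case
    proof (cases "n = 1")
      case True
      then show ?thesis using c1 by simp
    next
      case False
      then obtain p where p: "prime p" "p dvd n" using prime_factor_nat by blast
      define a where "a = multiplicity p n"
      obtain m where m: "n = p ^ a * m" "\<not> p dvd m"
        using multiplicity_decompose'[of n p] less.prems p a_def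
        by (metis not_prime_unit not_gr_zero)
      have m0: "m > 0" using m less.prems by (cases m) auto
      have a0: "a > 0" using p less.prems by (simp add: a_def prime_multiplicity_gt_zero_iff)
      have "p ^ a > 1" using prime_gt_1_nat[OF p(1)] a0 by (rule one_less_power)
      then have "m < n" using m m0 by simp
      then have IH: "real (card {d. d dvd m}) \<le> c ^ card {p \<in> B. p dvd m} * real m powr \<epsilon>"
        using less.IH m0 by blast
      have step: "real (a + 1) * c ^ card {p \<in> B. p dvd m} \<le> c ^ card {p \<in> B. p dvd n} * (real p powr \<epsilon>) ^ a"
      proof (cases "p \<in> B")
        case True
        have "card (insert p {p \<in> B. p dvd m}) \<le> card {p \<in> B. p dvd n}"
          using finB p True m(1) by (intro card_mono) auto
        moreover have "card (insert p {p \<in> B. p dvd m}) = Suc (card {p \<in> B. p dvd m})"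
          using finB m by (intro card_insert_disjoint) auto
        ultimately have le: "Suc (card {p \<in> B. p dvd m}) \<le> card {p \<in> B. p dvd n}" by simp
        have "real (a + 1) * c ^ card {p \<in> B. p dvd m} \<le> (c * (real p powr \<epsilon>) ^ a) * c ^ card {p \<in> B. p dvd m}"
          using small[OF p(1), of a] c1 by (intro mult_right_mono) auto
        also have "\<dots> = c ^ Suc (card {p \<in> B. p dvd m}) * (real p powr \<epsilon>) ^ a" by simp
        also have "\<dots> \<le> c ^ card {p \<in> B. p dvd n} * (real p powr \<epsilon>) ^ a"
          using le c1 by (intro mult_right_mono power_increasing) auto
        finally show ?thesis .
      next
        case False
        then have "real p powr \<epsilon> \<ge> 2" using p by (auto simp: B_def)
        then have "real (a + 1) * c ^ card {p \<in> B. p dvd m} \<le> (real p powr \<epsilon>) ^ a * c ^ card {p \<in> B. p dvd m}"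
          using large[of p a] c1 by (intro mult_right_mono) auto
        also have "\<dots> \<le> (real p powr \<epsilon>) ^ a * c ^ card {p \<in> B. p dvd n}"
          using c1 finB m(1) by (intro mult_left_mono power_increasing card_mono) auto
        finally show ?thesis by (simp add: mult.commute)
      qed
      have "real (card {d. d dvd n}) \<le> real (a + 1) * real (card {d. d dvd m})"
        using card_divisors_prime_power_mult[OF p(1) m(2) m0, of a] m(1)
        by (metis of_nat_le_iff of_nat_mult)
      also have "\<dots> \<le> real (a + 1) * (c ^ card {p \<in> B. p dvd m} * real m powr \<epsilon>)"
        using IH by (intro mult_left_mono) auto
      also have "\<dots> \<le> (c ^ card {p \<in> B. p dvd n} * (real p powr \<epsilon>) ^ a) * real m powr \<epsilon>"
        using mult_right_mono[OF step, of "real m powr \<epsilon>"] by (simp add: mult_ac)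
      also have "\<dots> = c ^ card {p \<in> B. p dvd n} * real n powr \<epsilon>"
      proof -
        have "(real p powr \<epsilon>) ^ a = (real p ^ a) powr \<epsilon>"
          using p by (simp add: powr_realpow[symmetric] prime_gt_0_nat powr_powr mult.commute)
        then show ?thesis by (simp add: m(1) powr_mult)
      qed
      finally show ?thesis .
    qed
  qed
  show ?thesis
  proof (intro exI[of _ "c ^ card B"] conjI allI impI)
    show "c ^ card B \<ge> 1" using c1 by (rule one_le_power)
    fix n :: nat assume "n > 0"
    have "c ^ card {p \<in> B. p dvd n} \<le> c ^ card B"
      using c1 finB by (intro power_increasing card_mono) auto
    then show "real (card {d. d dvd n}) \<le> c ^ card B * real n powr \<epsilon>"
      using main[OF \<open>n > 0\<close>] by (meson mult_right_mono order_trans powr_ge_zero)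
  qed
qed

section \<open>Evaluation of binary forms: homogeneity and absence of nontrivial zeros\<close>

lemma form_eval_binary_form:
  assumes "binary_form k f"
  shows "form_eval f a b = (\<Sum>j\<le>k. coeff (coeff f j) (k - j) * a ^ (k - j) * b ^ j)"
proof -
  have z: "coeff (coeff f j) i = 0" if "i + j \<noteq> k" for i j
    using assms that by (auto simp: binary_form_def)
  have mon: "coeff f j = (if j \<le> k then monom (coeff (coeff f j) (k - j)) (k - j) else 0)" for j
  proof (intro poly_eqI)
    fix i
    show "coeff (coeff f j) i = coeff (if j \<le> k then monom (coeff (coeff f j) (k - j)) (k - j) else 0) i"
      using z[of i j] by (cases "i + j = k") (auto simp: coeff_monom)
  qed
  have deg: "degree f \<le> k"
  proof (rule degree_le, intro allI impI)
    fix i assume "k < i"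
    then show "coeff f i = 0" using mon[of i] by simp
  qed
  have "poly f [:b:] = (\<Sum>j\<le>k. coeff f j * [:b:] ^ j)"
    unfolding poly_altdef using deg
    by (intro sum.mono_neutral_left) (auto simp: coeff_eq_0)
  then have "form_eval f a b = (\<Sum>j\<le>k. poly (coeff f j) a * b ^ j)"
    by (simp add: form_eval_def poly_sum poly_power)
  also have "\<dots> = (\<Sum>j\<le>k. coeff (coeff f j) (k - j) * a ^ (k - j) * b ^ j)"
  proof (intro sum.cong refl)
    fix j assume "j \<in> {..k}"
    then have "poly (coeff f j) a = coeff (coeff f j) (k - j) * a ^ (k - j)"
      by (subst mon) (simp add: poly_monom)
    then show "poly (coeff f j) a * b ^ j = coeff (coeff f j) (k - j) * a ^ (k - j) * b ^ j" by simp
  qed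
  finally show ?thesis .
qed

lemma form_eval_mult: "form_eval (f * g) a b = form_eval f a b * form_eval g a b"
  by (simp add: form_eval_def)

lemma form_eval_scale:
  assumes "binary_form k f"
  shows "form_eval f (t * a) (t * b) = t ^ k * form_eval f a b"
proof -
  have "t ^ (k - j) * t ^ j = t ^ k" if "j \<le> k" for j
    using that by (simp flip: power_add)
  then show ?thesis
    unfolding form_eval_binary_form[OF assms] sum_distrib_left
    by (intro sum.cong refl) (simp add: power_mult_distrib algebra_simps)
qed

lemma form_eval_cong:
  assumes "binary_form k f" "[a = a'] (mod d)" "[b = b'] (mod d)"
  shows "[form_eval f a b = form_eval f a' b'] (mod d)"
  unfolding form_eval_binary_form[OF assms(1)]
  by (intro cong_sum cong_mult cong_pow assms cong_refl)

text \<open>By unique factorisation f is prime, so it divides \<open>L\<close> or \<open>H\<close>.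
  If L = f K, scaling the argument by t gives t L(a, b) = t^k (...) with k \<ge> 2, so every t > 0
  divides L(a, b). If f divides \<open>H\<close>, cancelling it leaves c = L K, impossible at the
  origin, where \<open>L\<close> vanishes. The constant c stands for cleared denominators.\<close>

lemma irreducible_form_not_linear_multiple:
  assumes "binary_form k f" "k \<ge> 2" "irreducible f" "c \<noteq> 0"
    and "[:[:c:]:] * f = L * H"
    and L: "\<And>t a b. form_eval L (t * a) (t * b) = t * form_eval L a b"
  shows "form_eval L a b = 0"
proof -
  have L0: "form_eval L 0 0 = 0" using L[of 0 0 0] by simp
  have "prime_elem f" using assms(3) by (rule irreducible_imp_prime_elem)
  moreover have "f dvd L * H" using assms(5) by (metis dvd_triv_right)
  ultimately have "f dvd L \<or> f dvd H" by (rule prime_elem_dvd_multD)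
  then show ?thesis
  proof
    assume "f dvd L"
    then obtain K where K: "L = f * K" by blast
    have "t dvd form_eval L a b" if "t > 0" for t :: int
    proof -
      have "t * form_eval L a b = form_eval f (t * a) (t * b) * form_eval K (t * a) (t * b)"
        using L[of t a b] by (metis K form_eval_mult)
      also have "\<dots> = t ^ k * (form_eval f a b * form_eval K (t * a) (t * b))"
        by (simp add: form_eval_scale[OF assms(1)])
      also have "t ^ k = t * (t * t ^ (k - 2))"
        using assms(2) by (metis add_2_eq_Suc le_add_diff_inverse power_Suc)
      finally have "t * form_eval L a b = t * (t * (t ^ (k - 2) * (form_eval f a b * form_eval K (t * a) (t * b))))"
        by (simp add: mult.assoc)
      then show ?thesis using that by (metis dvd_triv_left mult_cancel_left not_less_iff_gr_or_eq)
    qed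
    from this[of "\<bar>form_eval L a b\<bar> + 1"] show ?thesis
      using zdvd_imp_le[of "\<bar>form_eval L a b\<bar> + 1" "\<bar>form_eval L a b\<bar>"] by fastforce
  next
    assume "f dvd H"
    then obtain K where K: "H = f * K" by blast
    have "f * [:[:c:]:] = f * (L * K)" using assms(5) K by (simp add: mult_ac)
    then have "[:[:c:]:] = L * K" using assms(1) mult_left_cancel[of f] unfolding binary_form_def by blast
    then have "form_eval [:[:c:]:] 0 0 = 0" by (simp add: form_eval_mult L0)
    then show ?thesis using assms(4) by (simp add: form_eval_def)
  qed
qed

lemma binary_form_monom_expansion:
  assumes "binary_form k f"
  shows "f = (\<Sum>j\<le>k. monom (monom (coeff (coeff f j) (k - j)) (k - j)) j)"
proof (intro poly_eqI)
  fix j i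
  have "coeff (coeff f j) i = 0" if "i + j \<noteq> k"
    using assms that by (auto simp: binary_form_def)
  then show "coeff (coeff f j) i =
      coeff (coeff (\<Sum>j\<le>k. monom (monom (coeff (coeff f j) (k - j)) (k - j)) j) j) i"
    by (cases "i + j = k") (auto simp: coeff_sum coeff_monom)
qed

text \<open>A zero other than the origin would split off a linear factor, a y - b x or x, over the
  rationals. The divisor bound says something only where f does not vanish, so all later counting
  depends on this.\<close>

lemma form_eval_nonzero:
  assumes f: "binary_form k f" "k \<ge> 2" "irreducible f" and "a \<noteq> 0 \<or> b \<noteq> 0"
  shows "form_eval f a b \<noteq> 0"
proof
  assume zero: "form_eval f a b = 0"
  define c where "c j = coeff (coeff f j) (k - j)" for j
  define cc :: "int \<Rightarrow> int poly poly" where "cc u = [:[:u:]:]" for u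
  have cc_mult: "cc (u * v) = cc u * cc v" for u v by (simp add: cc_def)
  have cc_pow: "cc (u ^ n) = cc u ^ n" for u n by (simp add: cc_def poly_const_pow)
  have cc_add: "cc (u + v) = cc u + cc v" for u v by (simp add: cc_def)
  have cc_sum: "cc (\<Sum>j\<in>A. g j) = (\<Sum>j\<in>A. cc (g j))" for A :: "nat set" and g
    by (induction A rule: infinite_finite_induct) (simp_all add: cc_add, simp_all add: cc_def)
  define X where "X = [:monom (1 :: int) 1:]"
  define Y where "Y = monom (1 :: int poly) 1"
  have fXY: "f = (\<Sum>j\<le>k. cc (c j) * X ^ (k - j) * Y ^ j)"
  proof -
    have "monom (monom (c j) (k - j)) j = cc (c j) * X ^ (k - j) * Y ^ j" for j
      by (simp add: cc_def X_def Y_def monom_power poly_const_pow smult_monom flip: monom_0)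
        (simp add: mult_monom)
    then show ?thesis using binary_form_monom_expansion[OF f(1)] by (simp add: c_def)
  qed
  show False
  proof (cases "a = 0")
    case False
    define L where "L = cc (a) * Y - cc (b) * X"
    \<comment> \<open>This is f(a x, b x) = x^k f(a, b) = 0. Subtracting it from a^k f = f(a x, a y)
      leaves a combination of differences (a y)^j - (b x)^j, all divisible by a y - b x.\<close>
    have z: "(\<Sum>j\<le>k. cc (c j) * (cc (a) * X) ^ (k - j) * (cc (b) * X) ^ j) = 0"
    proof -
      have "cc (c j) * (cc (a) * X) ^ (k - j) * (cc (b) * X) ^ j
            = cc (c j * a ^ (k - j) * b ^ j) * X ^ k" if "j \<le> k" for j
      proof -
        have "X ^ k = X ^ (k - j) * X ^ j" using that by (simp flip: power_add)
        then show ?thesis by (simp only: power_mult_distrib cc_mult cc_pow mult_ac)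
      qed
      then have "(\<Sum>j\<le>k. cc (c j) * (cc (a) * X) ^ (k - j) * (cc (b) * X) ^ j)
          = (\<Sum>j\<le>k. cc (c j * a ^ (k - j) * b ^ j)) * X ^ k"
        by (simp add: sum_distrib_right)
      also have "(\<Sum>j\<le>k. cc (c j * a ^ (k - j) * b ^ j)) = cc ((\<Sum>j\<le>k. c j * a ^ (k - j) * b ^ j))"
        by (simp only: cc_sum)
      also have "(\<Sum>j\<le>k. c j * a ^ (k - j) * b ^ j) = 0"
        using zero form_eval_binary_form[OF f(1)] by (simp add: c_def)
      finally show ?thesis by (simp add: cc_def)
    qed
    have "cc (a ^ k) * f = (\<Sum>j\<le>k. cc (c j) * (cc (a) * X) ^ (k - j) * (cc (a) * Y) ^ j)"
    proof -
      have "cc (a ^ k) * (cc (c j) * X ^ (k - j) * Y ^ j)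
            = cc (c j) * (cc (a) * X) ^ (k - j) * (cc (a) * Y) ^ j" if "j \<le> k" for j
      proof -
        have "cc (a ^ k) = cc (a) ^ (k - j) * cc (a) ^ j"
          using that by (simp add: cc_pow flip: power_add)
        then show ?thesis by (simp only: power_mult_distrib mult_ac)
      qed
      moreover have "cc (a ^ k) * f = (\<Sum>j\<le>k. cc (a ^ k) * (cc (c j) * X ^ (k - j) * Y ^ j))"
        by (subst fXY) (rule sum_distrib_left)
      ultimately show ?thesis by (metis (no_types, lifting) atMost_iff sum.cong)
    qed
    also have "\<dots> = (\<Sum>j\<le>k. cc (c j) * (cc (a) * X) ^ (k - j) * ((cc (a) * Y) ^ j - (cc (b) * X) ^ j))"
      using z by (simp only: right_diff_distrib sum_subtractf diff_zero)
    finally have eq: "cc (a ^ k) * f = \<dots>" .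
    have "L dvd cc (a ^ k) * f"
      unfolding eq L_def power_diff_sumr2
      by (intro dvd_sum dvd_mult dvd_mult2 dvd_refl)
    then obtain H where H: "cc (a ^ k) * f = L * H" by blast
    have L: "form_eval L x y = a * y - b * x" for x y
      by (simp add: L_def cc_def X_def Y_def form_eval_def poly_monom)
    have "form_eval L 0 1 = 0"
      by (rule irreducible_form_not_linear_multiple[OF f _ H[unfolded cc_def]])
        (use False in \<open>auto simp: L algebra_simps\<close>)
    then show False using False by (simp add: L)
  next
    case True
    then have "b \<noteq> 0" using assms(4) by simp
    \<comment> \<open>On the axis x = 0 only the y^k term survives, so its coefficient is zero and x
      divides every other monomial.\<close>
    have "form_eval f 0 b = c k * b ^ k"
      unfolding form_eval_binary_form[OF f(1)] c_def
      by (subst sum.remove[of _ k]) (auto intro!: sum.neutral simp: power_0_left)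
    then have ck: "c k = 0" using zero True \<open>b \<noteq> 0\<close> by simp
    have "X dvd f"
    proof (subst fXY, rule dvd_sum)
      fix j assume "j \<in> {..k}"
      show "X dvd cc (c j) * X ^ (k - j) * Y ^ j"
      proof (cases "j = k")
        case False
        then have "X ^ (k - j) = X * X ^ (k - j - 1)" using \<open>j \<in> {..k}\<close>
          by (metis atMost_iff diff_is_0_eq le_antisym power_eq_if)
        then show ?thesis by simp
      qed (simp add: ck cc_def)
    qed
    then obtain H where "[:[:1:]:] * f = X * H" by (auto simp: one_pCons[symmetric])
    moreover have "form_eval X x y = x" for x y
      by (simp add: X_def form_eval_def poly_monom)
    ultimately show False
      using irreducible_form_not_linear_multiple[OF f, of 1 X H 1 0] by simp
  qed
qed

lemma form_eval_abs_le:
  assumes "binary_form k f"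
  shows "\<exists>C \<ge> 1. \<forall>a b B. B \<ge> 1 \<and> \<bar>real_of_int a\<bar> \<le> B \<and> \<bar>real_of_int b\<bar> \<le> B \<longrightarrow>
    \<bar>real_of_int (form_eval f a b)\<bar> \<le> C * B ^ k"
proof (intro exI[of _ "1 + (\<Sum>j\<le>k. \<bar>real_of_int (coeff (coeff f j) (k - j))\<bar>)"] conjI allI impI)
  show "1 \<le> 1 + (\<Sum>j\<le>k. \<bar>real_of_int (coeff (coeff f j) (k - j))\<bar>)" by (simp add: sum_nonneg)
  fix a b :: int and B :: real
  assume B: "B \<ge> 1 \<and> \<bar>real_of_int a\<bar> \<le> B \<and> \<bar>real_of_int b\<bar> \<le> B"
  have "\<bar>real_of_int (form_eval f a b)\<bar> \<le> (\<Sum>j\<le>k. \<bar>real_of_int (coeff (coeff f j) (k - j) * a ^ (k - j) * b ^ j)\<bar>)"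
    unfolding form_eval_binary_form[OF assms] of_int_sum by (rule sum_abs)
  also have "\<dots> \<le> (\<Sum>j\<le>k. \<bar>real_of_int (coeff (coeff f j) (k - j))\<bar> * B ^ k)"
  proof (intro sum_mono)
    fix j assume "j \<in> {..k}"
    have "\<bar>real_of_int a\<bar> ^ (k - j) * \<bar>real_of_int b\<bar> ^ j \<le> B ^ (k - j) * B ^ j"
      using B by (intro mult_mono power_mono) auto
    also have "\<dots> = B ^ k" using \<open>j \<in> {..k}\<close> by (simp flip: power_add)
    finally show "\<bar>real_of_int (coeff (coeff f j) (k - j) * a ^ (k - j) * b ^ j)\<bar>
        \<le> \<bar>real_of_int (coeff (coeff f j) (k - j))\<bar> * B ^ k"
      by (simp add: abs_mult power_abs mult.assoc mult_left_mono)
  qed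
  also have "\<dots> \<le> (1 + (\<Sum>j\<le>k. \<bar>real_of_int (coeff (coeff f j) (k - j))\<bar>)) * B ^ k"
    using B by (simp add: sum_distrib_right[symmetric] mult_right_mono)
  finally show "\<bar>real_of_int (form_eval f a b)\<bar> \<le> (1 + (\<Sum>j\<le>k. \<bar>real_of_int (coeff (coeff f j) (k - j))\<bar>)) * B ^ k" .
qed

text \<open>Values on a box of side B have size O(B^k), and the divisor bound with exponent
  \<epsilon> / k absorbs the degree. Nonvanishing gives the finiteness.\<close>

lemma form_divisor_bound:
  fixes \<epsilon> :: real
  assumes f: "binary_form k f" "k \<ge> 2" "irreducible f" and "\<epsilon> > 0"
  shows "\<exists>C \<ge> 1. \<forall>a b B. B \<ge> 1 \<and> \<bar>real_of_int a\<bar> \<le> B \<and> \<bar>real_of_int b\<bar> \<le> B \<and> (a \<noteq> 0 \<or> b \<noteq> 0) \<longrightarrow>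
    finite {d :: nat. int d dvd form_eval f a b} \<and>
    real (card {d :: nat. int d dvd form_eval f a b}) \<le> C * B powr \<epsilon>"
proof -
  obtain C1 where C1: "C1 \<ge> 1" "\<And>n. n > 0 \<Longrightarrow> real (card {d :: nat. d dvd n}) \<le> C1 * real n powr (\<epsilon> / k)"
    using divisor_bound[of "\<epsilon> / k"] assms by auto
  obtain C2 where C2: "C2 \<ge> 1" "\<And>a b B. B \<ge> 1 \<Longrightarrow> \<bar>real_of_int a\<bar> \<le> B \<Longrightarrow> \<bar>real_of_int b\<bar> \<le> B \<Longrightarrow>
    \<bar>real_of_int (form_eval f a b)\<bar> \<le> C2 * B ^ k"
    using form_eval_abs_le[OF f(1)] by blast
  show ?thesis
  proof (intro exI[of _ "C1 * C2 powr (\<epsilon> / k)"] conjI allI impI)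
    show "1 \<le> C1 * C2 powr (\<epsilon> / k)"
      using C1(1) C2(1) assms mult_mono[of 1 C1 1 "C2 powr (\<epsilon> / k)"] by (simp add: ge_one_powr_ge_zero)
    fix a b :: int and B :: real
    assume *: "B \<ge> 1 \<and> \<bar>real_of_int a\<bar> \<le> B \<and> \<bar>real_of_int b\<bar> \<le> B \<and> (a \<noteq> 0 \<or> b \<noteq> 0)"
    define n where "n = nat \<bar>form_eval f a b\<bar>"
    have n0: "n > 0" using form_eval_nonzero[OF f] * by (simp add: n_def)
    have eq: "{d :: nat. int d dvd form_eval f a b} = {d. d dvd n}"
      by (simp add: n_def flip: int_dvd_int_iff)
    show "finite {d :: nat. int d dvd form_eval f a b}" unfolding eq using n0 by simp
    have "real n = \<bar>real_of_int (form_eval f a b)\<bar>" by (simp add: n_def)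
    then have nle: "real n \<le> C2 * B ^ k" using C2(2) * by simp
    have "real (card {d. d dvd n}) \<le> C1 * real n powr (\<epsilon> / k)" by (rule C1(2)[OF n0])
    also have "\<dots> \<le> C1 * (C2 * B ^ k) powr (\<epsilon> / k)"
      using nle C1(1) assms by (intro mult_left_mono powr_mono2) auto
    also have "(C2 * B ^ k) powr (\<epsilon> / k) = C2 powr (\<epsilon> / k) * B powr \<epsilon>"
      using * C2(1) assms by (simp add: powr_mult powr_powr flip: powr_realpow)
    finally show "real (card {d :: nat. int d dvd form_eval f a b}) \<le> C1 * C2 powr (\<epsilon> / k) * B powr \<epsilon>"
      unfolding eq by (simp add: mult.assoc)
  qed
qed

section \<open>Roots of a binary form to dyadic moduli\<close>

definition dyadic :: "real \<Rightarrow> nat set" where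
  "dyadic D = {d. D \<le> real d \<and> real d < 2 * D}"

definition form_roots :: "int poly poly \<Rightarrow> nat \<Rightarrow> nat set" where
  "form_roots f d = {v. v < d \<and> int d dvd form_eval f 1 (int v)}"

definition root_pairs :: "int poly poly \<Rightarrow> real \<Rightarrow> (nat \<times> nat) set" where
  "root_pairs f D = Sigma (dyadic D) (form_roots f)"

lemma finite_dyadic [simp]: "finite (dyadic D)"
proof (rule finite_subset)
  show "dyadic D \<subseteq> {..nat \<lceil>2 * D\<rceil>}"
  proof
    fix d assume "d \<in> dyadic D"
    then have "real d < 2 * D" by (simp add: dyadic_def)
    then show "d \<in> {..nat \<lceil>2 * D\<rceil>}" by simp linarith
  qed
qed simp

lemma finite_form_roots [simp]: "finite (form_roots f d)"
  by (rule finite_subset[of _ "{..<d}"]) (auto simp: form_roots_def)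

lemma finite_root_pairs [simp]: "finite (root_pairs f D)"
  by (simp add: root_pairs_def)

lemma root_count_eq_card: "root_count f d = card (form_roots f d)"
proof -
  have "bij_betw int (form_roots f d) {n \<in> {0..<int d}. [form_eval f 1 n = 0] (mod int d)}"
    unfolding form_roots_def cong_0_iff
    by (rule bij_betwI[where g = nat]) auto
  then show ?thesis unfolding root_count_def by (rule bij_betw_same_card[symmetric])
qed

lemma sum_root_pairs:
  fixes g :: "nat \<Rightarrow> nat \<Rightarrow> 'a :: comm_monoid_add"
  shows "(\<Sum>d\<in>dyadic D. \<Sum>v\<in>form_roots f d. g d v) = (\<Sum>(d, v)\<in>root_pairs f D. g d v)"
  unfolding root_pairs_def by (rule sum.Sigma) auto

text \<open>To be read as a lower bound for \<open>totient d\<close>, which falls short of d by at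
  most the number of divisors, hence by a factor d^\<epsilon>.\<close>

lemma le_card_divisors_mult_totient: "d \<le> card {e. e dvd d} * totient d"
proof (cases "d = 0")
  case False
  have "d = (\<Sum>e | e dvd d. totient e)" by (simp add: totient_divisor_sum)
  also have "\<dots> \<le> (\<Sum>e | e dvd d. totient d)"
    using False by (intro sum_mono totient_dvd_mono) auto
  finally show ?thesis by simp
qed simp

text \<open>The common frame of the three counting arguments: the objects are injected into
  incidences ((a, b), d) with d | f(a, b), and these are at most as many as the points times a
  uniform divisor bound.\<close>

lemma sum_card_divisors_le:
  fixes B K :: real and S :: "(int \<times> int) set"
  assumes "finite S" "B \<ge> 1"
    and C: "\<And>a b. \<bar>real_of_int a\<bar> \<le> B \<Longrightarrow> \<bar>real_of_int b\<bar> \<le> B \<Longrightarrow> a \<noteq> 0 \<or> b \<noteq> 0 \<Longrightarrow>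
      finite {d :: nat. int d dvd form_eval f a b} \<and>
      real (card {d :: nat. int d dvd form_eval f a b}) \<le> K"
    and S: "\<And>a b. (a, b) \<in> S \<Longrightarrow> \<bar>real_of_int a\<bar> \<le> B \<and> \<bar>real_of_int b\<bar> \<le> B \<and> (a \<noteq> 0 \<or> b \<noteq> 0)"
  shows "finite (Sigma S (\<lambda>(a, b). {d :: nat. int d dvd form_eval f a b}))"
    and "real (card (Sigma S (\<lambda>(a, b). {d :: nat. int d dvd form_eval f a b}))) \<le> real (card S) * K"
proof -
  have fin: "\<forall>x\<in>S. finite (case x of (a, b) \<Rightarrow> {d :: nat. int d dvd form_eval f a b})"
    using C S by (auto split: prod.splits)
  show "finite (Sigma S (\<lambda>(a, b). {d :: nat. int d dvd form_eval f a b}))"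
    using assms(1) fin by (intro finite_SigmaI) auto
  have "card (Sigma S (\<lambda>(a, b). {d :: nat. int d dvd form_eval f a b})) =
      (\<Sum>x\<in>S. card (case x of (a, b) \<Rightarrow> {d :: nat. int d dvd form_eval f a b}))"
    by (rule card_SigmaI) (use assms(1) fin in auto)
  also have "real \<dots> \<le> real (card S) * K"
    unfolding of_nat_sum
    by (rule sum_bounded_above) (use C S in \<open>auto split: prod.splits\<close>)
  finally show "real (card (Sigma S (\<lambda>(a, b). {d :: nat. int d dvd form_eval f a b}))) \<le> real (card S) * K" .
qed

text \<open>
  Weight each root \<open>v\<close> modulo \<open>d\<close> with the \<open>totient d\<close> many points \<open>(m, m v mod d)\<close> on its line: these
  are zeros of \<open>f\<close> modulo \<open>d\<close> in a box of side \<open>2 D\<close>, where the divisor bound applies. This avoids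
  bounding the number of roots modulo prime powers.
\<close>

lemma card_root_pairs_le:
  fixes \<epsilon> :: real
  assumes f: "binary_form k f" "k \<ge> 2" "irreducible f" and "\<epsilon> > 0"
  shows "\<exists>C \<ge> 1. \<forall>D \<ge> 1. real (card (root_pairs f D)) \<le> C * D powr (1 + \<epsilon>)"
proof -
  obtain C1 where C1: "C1 \<ge> 1" "\<And>n. n > 0 \<Longrightarrow> real (card {d :: nat. d dvd n}) \<le> C1 * real n powr (\<epsilon> / 2)"
    using divisor_bound[of "\<epsilon> / 2"] assms by auto
  obtain C2 where C2: "C2 \<ge> 1" "\<And>a b B. B \<ge> 1 \<Longrightarrow> \<bar>real_of_int a\<bar> \<le> B \<Longrightarrow> \<bar>real_of_int b\<bar> \<le> B \<Longrightarrow> a \<noteq> 0 \<or> b \<noteq> 0 \<Longrightarrow>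
      finite {d :: nat. int d dvd form_eval f a b} \<and>
      real (card {d :: nat. int d dvd form_eval f a b}) \<le> C2 * B powr (\<epsilon> / 2)"
    using form_divisor_bound[OF f, of "\<epsilon> / 2"] assms by (metis half_gt_zero)
  show ?thesis
  proof (intro exI[of _ "4 * C1 * C2 * 2 powr \<epsilon>"] conjI allI impI)
    have "1 * 1 * 1 * 1 \<le> 4 * C1 * C2 * 2 powr \<epsilon>"
      using C1(1) C2(1) assms(4) by (intro mult_mono) (auto simp: ge_one_powr_ge_zero)
    then show "1 \<le> 4 * C1 * C2 * 2 powr \<epsilon>" by simp
    fix D :: real assume D: "D \<ge> 1"
    define M where "M = nat \<lfloor>2 * D\<rfloor>"
    have M: "real M \<le> 2 * D" using D by (simp add: M_def)
    have dM: "d \<le> M" if "d \<in> dyadic D" for d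
      using that D unfolding dyadic_def M_def by simp linarith
    define S where "S = {1..int M} \<times> {0..<int M}"
    define T where "T = Sigma S (\<lambda>(a, b). {d :: nat. int d dvd form_eval f a b})"
    define U where "U = Sigma (root_pairs f D) (\<lambda>(d, v). totatives d)"
    have finT: "finite T" and cardT: "real (card T) \<le> real (card S) * (C2 * (2 * D) powr (\<epsilon> / 2))"
    proof -
      have *: "\<bar>real_of_int x\<bar> \<le> 2 * D \<and> \<bar>real_of_int y\<bar> \<le> 2 * D \<and> (x \<noteq> 0 \<or> y \<noteq> 0)" if "(x, y) \<in> S" for x y
      proof -
        have "1 \<le> x" "x \<le> int M" "0 \<le> y" "y < int M" using that by (auto simp: S_def)
        then show ?thesis using M by linarith
      qed
      have D2: "1 \<le> 2 * D" using D by simp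
      show "finite T" unfolding T_def
        by (rule sum_card_divisors_le(1)[OF _ D2 C2(2)[OF D2] *]) (auto simp: S_def)
      show "real (card T) \<le> real (card S) * (C2 * (2 * D) powr (\<epsilon> / 2))" unfolding T_def
        by (rule sum_card_divisors_le(2)[OF _ D2 C2(2)[OF D2] *]) (auto simp: S_def)
    qed
    define \<phi> where "\<phi> = (\<lambda>((d, v), m). ((int m, int ((m * v) mod d)), d))"
    have "\<phi> ` U \<subseteq> T"
    proof (clarsimp simp: \<phi>_def U_def T_def root_pairs_def form_roots_def)
      fix d v m
      assume d: "d \<in> dyadic D" "m \<in> totatives d" "v < d" and dvd: "int d dvd form_eval f 1 (int v)"
      have "[form_eval f (int m) (int (m * v mod d)) = form_eval f (int m * 1) (int m * int v)] (mod int d)"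
        by (simp, rule form_eval_cong[OF f(1) cong_refl]) (simp add: cong_def zmod_int)
      also have "form_eval f (int m * 1) (int m * int v) = int m ^ k * form_eval f 1 (int v)"
        by (rule form_eval_scale[OF f(1)])
      also have "[\<dots> = 0] (mod int d)" using dvd by (simp add: cong_0_iff)
      finally have "int d dvd form_eval f (int m) (int (m * v mod d))" by (simp add: cong_0_iff)
      moreover have "m \<le> M" using d dM totatives_le by fastforce
      moreover have "m * v mod d < M" using d dM[OF d(1)] mod_less_divisor[of d "m * v"] by linarith
      ultimately show "(int m, int (m * v mod d)) \<in> S \<and> int d dvd form_eval f (int m) (int (m * v mod d))"
        using d by (auto simp: S_def in_totatives_iff)
    qed
    \<comment> \<open>m is invertible modulo d, so m and m v mod d recover v.\<close>
    moreover have "inj_on \<phi> U"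
    proof (rule inj_onI, clarsimp simp: \<phi>_def U_def root_pairs_def form_roots_def)
      fix d v v' m
      assume d: "m \<in> totatives d" "v < d" "v' < d" "m * v mod d = m * v' mod d"
      then have "[m * v = m * v'] (mod d)" by (simp add: cong_def)
      then have "[v = v'] (mod d)"
        using d(1) by (simp add: in_totatives_iff cong_mult_lcancel_nat)
      then show "v = v'" using d by (simp add: cong_def)
    qed
    ultimately have "card U \<le> card T" using finT by (meson card_inj_on_le)
    moreover have "real (card (root_pairs f D)) * (D / (C1 * (2 * D) powr (\<epsilon> / 2))) \<le> real (card U)"
    proof -
      have "card U = (\<Sum>x\<in>root_pairs f D. card (case x of (d, v) \<Rightarrow> totatives d))"
        unfolding U_def by (rule card_SigmaI) auto
      moreover have "real (card (root_pairs f D)) * (D / (C1 * (2 * D) powr (\<epsilon> / 2))) \<le>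
          (\<Sum>x\<in>root_pairs f D. real (card (case x of (d, v) \<Rightarrow> totatives d)))"
      proof (rule sum_bounded_below, clarsimp simp: root_pairs_def)
        fix d v assume "d \<in> dyadic D"
        then have d: "D \<le> real d" "real d \<le> 2 * D" "d > 0" using D by (auto simp: dyadic_def)
        have "real d \<le> real (card {e. e dvd d}) * real (totient d)"
          using le_card_divisors_mult_totient[of d] by (metis of_nat_le_iff of_nat_mult)
        also have "\<dots> \<le> (C1 * (2 * D) powr (\<epsilon> / 2)) * real (totient d)"
        proof (rule mult_right_mono)
          have "real (card {e. e dvd d}) \<le> C1 * real d powr (\<epsilon> / 2)" using C1(2) d by blast
          also have "\<dots> \<le> C1 * (2 * D) powr (\<epsilon> / 2)"
            using d C1(1) assms(4) by (intro mult_left_mono powr_mono2) auto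
          finally show "real (card {e. e dvd d}) \<le> C1 * (2 * D) powr (\<epsilon> / 2)" .
        qed simp
        finally have "D \<le> (C1 * (2 * D) powr (\<epsilon> / 2)) * real (totient d)" using d by simp
        then show "D / (C1 * (2 * D) powr (\<epsilon> / 2)) \<le> real (card (totatives d))"
          using C1(1) D by (simp add: totient_def field_simps)
      qed
      ultimately show ?thesis by simp
    qed
    ultimately have "real (card (root_pairs f D)) * (D / (C1 * (2 * D) powr (\<epsilon> / 2))) \<le>
        real (card S) * (C2 * (2 * D) powr (\<epsilon> / 2))"
      using cardT by linarith
    moreover have "real (card S) \<le> (2 * D) * (2 * D)"
      using mult_mono[OF M M] D by (simp add: S_def card_cartesian_product)
    then have "real (card S) * (C2 * (2 * D) powr (\<epsilon> / 2)) \<le> (2 * D) * (2 * D) * (C2 * (2 * D) powr (\<epsilon> / 2))"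
      using C2(1) by (intro mult_right_mono) auto
    ultimately have "real (card (root_pairs f D)) * (D / (C1 * (2 * D) powr (\<epsilon> / 2))) \<le>
        (2 * D) * (2 * D) * (C2 * (2 * D) powr (\<epsilon> / 2))" by linarith
    then have "real (card (root_pairs f D)) \<le>
        (2 * D) * (2 * D) * (C2 * (2 * D) powr (\<epsilon> / 2)) * (C1 * (2 * D) powr (\<epsilon> / 2)) / D"
      using D C1(1) by (simp add: field_simps)
    also have "\<dots> = 4 * C1 * C2 * D * ((2 * D) powr (\<epsilon> / 2) * (2 * D) powr (\<epsilon> / 2))"
      using D by (simp add: field_simps)
    also have "(2 * D) powr (\<epsilon> / 2) * (2 * D) powr (\<epsilon> / 2) = 2 powr \<epsilon> * D powr \<epsilon>"
      using D powr_add[of "2 * D" "\<epsilon> / 2" "\<epsilon> / 2"] by (simp add: powr_mult)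
    also have "4 * C1 * C2 * D * (2 powr \<epsilon> * D powr \<epsilon>) = 4 * C1 * C2 * 2 powr \<epsilon> * D powr (1 + \<epsilon>)"
      using D by (simp add: powr_add)
    finally show "real (card (root_pairs f D)) \<le> 4 * C1 * C2 * 2 powr \<epsilon> * D powr (1 + \<epsilon>)" .
  qed
qed

text \<open>
  Let \<open>a / q\<close> be a Dirichlet approximation of \<open>\<theta>\<close> with \<open>q\<close> of size at most about \<open>sqrt D\<close>. If \<open>v / d\<close>
  is within \<open>1 / D\<close> of \<open>\<theta>\<close>, then \<open>c = q v - a d\<close> has size \<open>O(sqrt D)\<close>, \<open>d\<close> divides \<open>f(q, c)\<close>, and
  \<open>(c, d)\<close> determines \<open>v\<close>.
\<close>

lemma card_root_pairs_near_le:
  fixes \<epsilon> :: real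
  assumes f: "binary_form k f" "k \<ge> 2" "irreducible f" and "\<epsilon> > 0"
  shows "\<exists>C \<ge> 1. \<forall>D \<ge> 1. \<forall>\<theta>.
    real (card {(d, v) \<in> root_pairs f D. \<bar>real v / real d - \<theta>\<bar> \<le> 1 / D}) \<le> C * D powr (1 / 2 + \<epsilon>)"
proof -
  obtain C2 where C2: "C2 \<ge> 1" "\<And>a b B. B \<ge> 1 \<Longrightarrow> \<bar>real_of_int a\<bar> \<le> B \<Longrightarrow> \<bar>real_of_int b\<bar> \<le> B \<Longrightarrow> a \<noteq> 0 \<or> b \<noteq> 0 \<Longrightarrow>
      finite {d :: nat. int d dvd form_eval f a b} \<and>
      real (card {d :: nat. int d dvd form_eval f a b}) \<le> C2 * B powr \<epsilon>"
    using form_divisor_bound[OF f, of \<epsilon>] assms by metis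
  show ?thesis
  proof (intro exI[of _ "13 * C2 * 6 powr \<epsilon>"] conjI allI impI)
    have "1 * 1 * 1 \<le> 13 * C2 * 6 powr \<epsilon>"
      using C2(1) assms(4) by (intro mult_mono) (auto simp: ge_one_powr_ge_zero)
    then show "1 \<le> 13 * C2 * 6 powr \<epsilon>" by simp
    fix D \<theta> :: real assume D: "D \<ge> 1"
    define P where "P = {(d, v) \<in> root_pairs f D. \<bar>real v / real d - \<theta>\<bar> \<le> 1 / D}"
    define s where "s = sqrt D"
    have s: "s \<ge> 1" "s * s = D" using D by (auto simp: s_def)
    \<comment> \<open>This size of Q balances the two contributions to q v - a d: about q from the
      distance 1 / D, and about D / Q from the approximation error.\<close>
    define Q where "Q = nat \<lceil>s\<rceil>"
    have Q: "s \<le> real Q" "real Q \<le> 2 * s" "Q > 0" using s(1) unfolding Q_def by linarith+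
    obtain a q where q: "0 < q" "q \<le> int Q" "\<bar>of_int q * \<theta> - of_int a\<bar> < 1 / Q"
      using Dirichlet_approx[OF Q(3)] by metis
    define M where "M = \<lfloor>6 * s\<rfloor>"
    define S where "S = {q} \<times> {-M..M}"
    define T where "T = Sigma S (\<lambda>(a, b). {d :: nat. int d dvd form_eval f a b})"
    have finT: "finite T" and cardT: "real (card T) \<le> real (card S) * (C2 * (6 * s) powr \<epsilon>)"
    proof -
      have *: "\<bar>real_of_int x\<bar> \<le> 6 * s \<and> \<bar>real_of_int y\<bar> \<le> 6 * s \<and> (x \<noteq> 0 \<or> y \<noteq> 0)" if "(x, y) \<in> S" for x y
      proof -
        have xy: "x = q" "\<bar>y\<bar> \<le> M" using that by (auto simp: S_def)
        have "real_of_int q \<le> real Q" using q(2) by linarith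
        then have "\<bar>real_of_int x\<bar> \<le> 6 * s" using xy q(1) Q(2) s(1) by simp
        moreover have "\<bar>real_of_int y\<bar> \<le> 6 * s" using xy(2) unfolding M_def by linarith
        ultimately show ?thesis using xy q(1) by simp
      qed
      have s6: "1 \<le> 6 * s" using s(1) by simp
      show "finite T" unfolding T_def
        by (rule sum_card_divisors_le(1)[OF _ s6 C2(2)[OF s6] *]) (auto simp: S_def)
      show "real (card T) \<le> real (card S) * (C2 * (6 * s) powr \<epsilon>)" unfolding T_def
        by (rule sum_card_divisors_le(2)[OF _ s6 C2(2)[OF s6] *]) (auto simp: S_def)
    qed
    define \<phi> where "\<phi> = (\<lambda>(d, v). ((q, int v * q - a * int d), d))"
    have "\<phi> ` P \<subseteq> T"
    proof (clarsimp simp: \<phi>_def P_def T_def root_pairs_def form_roots_def)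
      fix d v :: nat
      assume d: "d \<in> dyadic D" "\<bar>real v / real d - \<theta>\<bar> \<le> 1 / D" "v < d"
        and dvd: "int d dvd form_eval f 1 (int v)"
      have d': "D \<le> real d" "real d < 2 * D" "real d > 0" using d D by (auto simp: dyadic_def)
      have "[form_eval f q (int v * q - a * int d) = form_eval f (q * 1) (q * int v)] (mod int d)"
        by (simp, rule form_eval_cong[OF f(1) cong_refl]) (simp add: cong_iff_dvd_diff algebra_simps)
      also have "form_eval f (q * 1) (q * int v) = q ^ k * form_eval f 1 (int v)"
        by (rule form_eval_scale[OF f(1)])
      also have "[\<dots> = 0] (mod int d)" using dvd by (simp add: cong_0_iff)
      finally have 1: "int d dvd form_eval f q (int v * q - a * int d)" by (simp add: cong_0_iff)
      have "real_of_int (int v * q - a * int d) =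
          real d * (real_of_int q * (real v / real d - \<theta>) + (real_of_int q * \<theta> - real_of_int a))"
        using d' by (simp add: field_simps)
      also have "\<bar>\<dots>\<bar> \<le> 2 * D * (2 * s * (1 / D) + 1 / s)"
      proof (subst abs_mult, rule mult_mono)
        have "\<bar>real_of_int q * (real v / real d - \<theta>)\<bar> \<le> 2 * s * (1 / D)"
        proof (subst abs_mult, rule mult_mono)
          have "real_of_int q \<le> real Q" using q(2) by linarith
          then show "\<bar>real_of_int q\<bar> \<le> 2 * s" using Q q(1) by simp
        qed (use d s in auto)
        moreover have "1 / real Q \<le> 1 / s" using Q s by (simp add: frac_le)
        ultimately show "\<bar>real_of_int q * (real v / real d - \<theta>) + (real_of_int q * \<theta> - real_of_int a)\<bar>
            \<le> 2 * s * (1 / D) + 1 / s"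
          using q(3) by linarith
      qed (use d' D in auto)
      also have "\<dots> = 6 * s" using s by (simp add: s(2)[symmetric] field_simps)
      finally have "\<bar>int v * q - a * int d\<bar> \<le> M" unfolding M_def by linarith
      then have "(q, int v * q - a * int d) \<in> S" by (auto simp: S_def)
      with 1 show "(q, int v * q - a * int d) \<in> S \<and> int d dvd form_eval f q (int v * q - a * int d)" by simp
    qed
    moreover have "inj_on \<phi> P"
      using q(1) by (auto simp: inj_on_def \<phi>_def)
    ultimately have "card P \<le> card T" using finT by (meson card_inj_on_le)
    then have "real (card P) \<le> real (card S) * (C2 * (6 * s) powr \<epsilon>)" using cardT by linarith
    also have "\<dots> \<le> (13 * s) * (C2 * (6 * s) powr \<epsilon>)"
    proof (rule mult_right_mono)
      have "card S = nat (2 * M + 1)" by (simp add: S_def card_cartesian_product)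
      moreover have "0 \<le> M" "real_of_int M \<le> 6 * s" using s(1) unfolding M_def by auto
      ultimately show "real (card S) \<le> 13 * s" using s(1) by simp
    qed (use C2 in auto)
    also have "\<dots> = 13 * C2 * 6 powr \<epsilon> * (s * s powr \<epsilon>)" using s by (simp add: powr_mult)
    also have "\<dots> \<le> 13 * C2 * 6 powr \<epsilon> * D powr (1 / 2 + \<epsilon>)"
    proof (rule mult_left_mono)
      have "s = D powr (1 / 2)" using D by (simp add: s_def powr_half_sqrt)
      moreover have "s powr \<epsilon> \<le> D powr \<epsilon>"
      proof (rule powr_mono2)
        show "s \<le> D" using s by (metis mult_left_mono mult.right_neutral order_trans zero_le_one)
      qed (use s assms(4) in auto)
      ultimately show "s * s powr \<epsilon> \<le> D powr (1 / 2 + \<epsilon>)"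
        using s(1) by (simp add: powr_add mult_left_mono)
    qed (use C2(1) in auto)
    finally show "real (card P) \<le> 13 * C2 * 6 powr \<epsilon> * D powr (1 / 2 + \<epsilon>)" .
  qed
qed

section \<open>Exponential sums over the roots\<close>

definition ee :: "real \<Rightarrow> complex" where "ee x = cis (2 * pi * x)"

lemma ee_add: "ee (x + y) = ee x * ee y"
  by (simp add: ee_def cis_mult algebra_simps)

lemma ee_0 [simp]: "ee 0 = 1"
  by (simp add: ee_def)

lemma norm_ee [simp]: "norm (ee x) = 1"
  by (simp add: ee_def)

lemma cnj_ee: "cnj (ee x) = ee (- x)"
  by (simp add: ee_def cis_cnj)

lemma ee_of_int [simp]: "ee (of_int n) = 1"
  by (simp add: ee_def)

lemma ee_power: "ee x ^ n = ee (real n * x)"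
  by (simp add: ee_def Complex.DeMoivre algebra_simps)

lemma ee_frac: "ee (frac x) = ee x"
proof -
  have "ee x = ee (frac x + of_int \<lfloor>x\<rfloor>)" by (simp add: frac_def)
  then show ?thesis by (simp only: ee_add ee_of_int mult_1_right)
qed

lemma norm_1_minus_cis: "norm (1 - cis t) = 2 * \<bar>sin (t / 2)\<bar>"
proof -
  have "(norm (1 - cis t))\<^sup>2 = (1 - cos t)\<^sup>2 + (sin t)\<^sup>2"
    by (simp add: cmod_power2)
  also have "\<dots> = 2 - 2 * cos t"
    using sin_cos_squared_add[of t] by (simp add: power2_eq_square algebra_simps)
  also have "cos t = 1 - 2 * (sin (t / 2))\<^sup>2"
    using cos_double_sin[of "t / 2"] by simp
  finally have "(norm (1 - cis t))\<^sup>2 = (2 * \<bar>sin (t / 2)\<bar>)\<^sup>2" by (simp add: power_mult_distrib)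
  then show ?thesis by (rule power2_eq_imp_eq) auto
qed

text \<open>Concavity: on [0, pi/2] the sine lies above its chord.\<close>

lemma sin_pi_times_ge:
  assumes "0 \<le> y" "y \<le> 1 / 2"
  shows "2 * y \<le> sin (pi * y)"
proof -
  have "concave_on {0..pi/2} sin"
  proof (rule f''_le0_imp_concave[where f' = cos and f'' = "\<lambda>x. - sin x"])
    fix x :: real assume "x \<in> {0..pi/2}"
    then show "- sin x \<le> 0" using sin_ge_zero[of x] by (auto simp: field_simps)
  qed (auto intro!: derivative_eq_intros)
  then have "sin ((1 - 2 * y) *\<^sub>R 0 + (2 * y) *\<^sub>R (pi / 2)) \<ge> (1 - 2 * y) * sin 0 + (2 * y) * sin (pi / 2)"
    by (rule concave_onD) (use assms in auto)
  then show ?thesis by (simp add: mult.commute)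
qed

lemma norm_1_minus_ee_ge:
  assumes "0 \<le> y" "y \<le> 1"
  shows "4 * min y (1 - y) \<le> norm (1 - ee y)"
proof -
  have "norm (1 - ee y) = 2 * \<bar>sin (pi * y)\<bar>"
    by (simp add: ee_def norm_1_minus_cis)
  moreover have "2 * min y (1 - y) \<le> sin (pi * y)"
  proof (cases "y \<le> 1 / 2")
    case True
    then show ?thesis using sin_pi_times_ge[of y] assms by simp
  next
    case False
    have "sin (pi * y) = sin (pi * (1 - y))" by (simp add: algebra_simps)
    then show ?thesis using sin_pi_times_ge[of "1 - y"] assms False by simp
  qed
  ultimately show ?thesis by linarith
qed

section \<open>The geometric kernel and a large sieve inequality\<close>

definition exp_kernel :: "nat \<Rightarrow> real \<Rightarrow> complex" where
  "exp_kernel L x = (\<Sum>l = 1..L. ee (real l * x))"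

lemma exp_kernel_frac: "exp_kernel L (frac x) = exp_kernel L x"
  by (simp add: exp_kernel_def ee_power[symmetric] ee_frac)

lemma norm_exp_kernel_le: "norm (exp_kernel L x) \<le> real L"
  unfolding exp_kernel_def using norm_sum[of "\<lambda>l. ee (real l * x)" "{1..L}"] by simp

text \<open>The closed form of the geometric sum gives the reciprocal of twice the distance from y
  to the nearest integer. Replacing it by the sum of both one-sided terms keeps the bound additive
  when it is summed over bins from either end.\<close>

lemma norm_exp_kernel_le_inverse:
  assumes "0 < y" "y < 1"
  shows "norm (exp_kernel L y) \<le> 1 / (2 * y) + 1 / (2 * (1 - y))"
proof -
  have pos: "0 < 4 * min y (1 - y)" using assms by simp
  have ge: "4 * min y (1 - y) \<le> norm (1 - ee y)" using assms by (intro norm_1_minus_ee_ge) auto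
  have ne: "ee y \<noteq> 1" using pos ge by auto
  have "(1 - ee y) * exp_kernel L y = ee y * (1 - ee y ^ L)"
    unfolding exp_kernel_def ee_power[symmetric]
  proof (induction L)
    case (Suc L)
    have "(1 - ee y) * (\<Sum>l = 1..Suc L. ee y ^ l) = ee y * (1 - ee y ^ L) + (1 - ee y) * ee y ^ Suc L"
      using Suc by (simp add: distrib_left)
    also have "\<dots> = ee y * (1 - ee y ^ Suc L)" by (simp add: algebra_simps)
    finally show ?case .
  qed simp
  then have "norm (1 - ee y) * norm (exp_kernel L y) = norm (1 - ee y ^ L)"
    by (metis norm_mult norm_ee mult_1)
  also have "\<dots> \<le> 2" using norm_triangle_ineq4[of 1 "ee y ^ L"] by (simp add: norm_power)
  finally have "norm (exp_kernel L y) \<le> 2 / norm (1 - ee y)"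
    using ne by (simp add: field_simps)
  also have "\<dots> \<le> 2 / (4 * min y (1 - y))" using pos ge by (intro frac_le) auto
  also have "\<dots> \<le> 1 / (2 * y) + 1 / (2 * (1 - y))"
    using assms by (auto simp: min_def)
  finally show ?thesis .
qed

text \<open>Cut the circle, seen from \<theta>, into \<open>J\<close> bins of length 1 / J. The two
  bins next to the integers get the trivial bound L; in a bin at distance i / J the kernel is O(J /
  i), and summation yields the harmonic number. No separation of the points is assumed:
  \<open>K\<close> measures how much they crowd.\<close>

lemma sum_norm_exp_kernel_le:
  fixes x :: "'a \<Rightarrow> real" and K \<theta> :: real
  assumes "finite P" "J \<ge> 1" and x: "\<And>p. p \<in> P \<Longrightarrow> 0 \<le> x p \<and> x p < 1" and \<theta>: "0 \<le> \<theta>" "\<theta> < 1"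
    and K: "\<And>t. real (card {p \<in> P. t \<le> x p \<and> x p \<le> t + 1 / real J}) \<le> K"
  shows "(\<Sum>p\<in>P. norm (exp_kernel L (x p - \<theta>))) \<le> 2 * K * (2 * real L + real J * harm J)"
proof -
  define y where "y p = frac (x p - \<theta>)" for p
  define bin where "bin p = nat \<lfloor>real J * y p\<rfloor>" for p
  have y: "0 \<le> y p" "y p < 1" for p by (simp_all add: y_def frac_lt_1)
  have J: "real J > 0" using assms by simp
  have binJ: "bin p < J" for p
  proof -
    have "real J * y p < real J" using y[of p] J by simp
    then show ?thesis unfolding bin_def using J y[of p]
      by (metis floor_less_iff mult_nonneg_nonneg nat_less_iff of_int_of_nat_eq of_nat_0_le_iff zero_le_floor)
  qed
  have bin: "real (bin p) \<le> real J * y p" "real J * y p < real (bin p) + 1" for p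
    using y[of p] J unfolding bin_def by auto
  \<comment> \<open>One formula for all bins: bins 0 and J - 1 touch an integer and get L, and there
    the reciprocal of the zero index vanishes because division by zero is 0.\<close>
  define G where "G i = (if i = 0 then real L else 0) + (if i = J - 1 then real L else 0)
      + real J / 2 * (1 / real i) + real J / 2 * (1 / real (J - 1 - i))" for i
  have gG: "norm (exp_kernel L (x p - \<theta>)) \<le> G (bin p)" for p
  proof (cases "bin p = 0 \<or> bin p = J - 1")
    case True
    have "norm (exp_kernel L (x p - \<theta>)) \<le> real L" by (rule norm_exp_kernel_le)
    also have "\<dots> \<le> G (bin p)" using True by (auto simp: G_def)
    finally show ?thesis .
  next
    case False
    define i where "i = bin p"
    have i: "0 < i" "i < J - 1" using False binJ[of p] by (auto simp: i_def)
    have yi: "real i / real J \<le> y p" "real (J - 1 - i) / real J \<le> 1 - y p"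
      using bin[of p] i J by (auto simp: i_def[symmetric] field_simps of_nat_diff)
    have pos: "0 < real i / real J" "0 < real (J - 1 - i) / real J" using i J by auto
    have "norm (exp_kernel L (x p - \<theta>)) = norm (exp_kernel L (y p))"
      by (simp add: y_def exp_kernel_frac)
    also have "\<dots> \<le> 1 / (2 * y p) + 1 / (2 * (1 - y p))"
      using pos yi by (intro norm_exp_kernel_le_inverse) linarith+
    also have "\<dots> \<le> 1 / (2 * (real i / real J)) + 1 / (2 * (real (J - 1 - i) / real J))"
      using pos yi by (intro add_mono divide_left_mono mult_left_mono mult_pos_pos) linarith+
    also have "\<dots> \<le> G i" using i by (simp add: G_def)
    finally show ?thesis by (simp add: i_def)
  qed
  have G0: "G i \<ge> 0" for i by (simp add: G_def)
  have fiber: "real (card {p \<in> P. bin p = i}) \<le> 2 * K" for i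
  proof -
    define A where "A t = {p \<in> P. t \<le> x p \<and> x p \<le> t + 1 / real J}" for t
    have "{p \<in> P. bin p = i} \<subseteq> A (\<theta> + real i / real J) \<union> A (\<theta> + real i / real J - 1)"
    proof
      fix p assume "p \<in> {p \<in> P. bin p = i}"
      then have p: "p \<in> P" "bin p = i" by auto
      have 1: "real i / real J \<le> y p" "y p \<le> real i / real J + 1 / real J"
        using bin[of p] p(2) J by (auto simp: field_simps)
      \<comment> \<open>The fractional part wraps around at most once, so a bin pulls back to two
        intervals of length 1 / J on the line: the source of the factor 2.\<close>
      have "\<lfloor>x p - \<theta>\<rfloor> = 0 \<or> \<lfloor>x p - \<theta>\<rfloor> = -1" using x[OF p(1)] \<theta> by linarith
      then have "y p = x p - \<theta> \<or> y p = x p - \<theta> + 1" by (auto simp: y_def frac_def)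
      then show "p \<in> A (\<theta> + real i / real J) \<union> A (\<theta> + real i / real J - 1)"
        using 1 p(1) by (auto simp: A_def)
    qed
    then have "card {p \<in> P. bin p = i} \<le> card (A (\<theta> + real i / real J) \<union> A (\<theta> + real i / real J - 1))"
      using assms(1) by (intro card_mono) (auto simp: A_def)
    also have "\<dots> \<le> card (A (\<theta> + real i / real J)) + card (A (\<theta> + real i / real J - 1))"
      by (rule card_Un_le)
    finally show ?thesis using K[of "\<theta> + real i / real J"] K[of "\<theta> + real i / real J - 1"]
      unfolding A_def by linarith
  qed
  have "(\<Sum>p\<in>P. norm (exp_kernel L (x p - \<theta>))) \<le> (\<Sum>p\<in>P. G (bin p))"
    by (intro sum_mono gG)
  also have "\<dots> = (\<Sum>i<J. \<Sum>p | p \<in> P \<and> bin p = i. G (bin p))"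
    by (rule sum.group[symmetric]) (use assms(1) binJ in auto)
  also have "\<dots> = (\<Sum>i<J. real (card {p \<in> P. bin p = i}) * G i)" by simp
  also have "\<dots> \<le> (\<Sum>i<J. 2 * K * G i)"
    using fiber G0 by (intro sum_mono mult_right_mono) auto
  also have "\<dots> = 2 * K * (\<Sum>i<J. G i)" by (simp add: sum_distrib_left)
  also have "(\<Sum>i<J. G i) = 2 * real L + real J * (\<Sum>i<J. 1 / real i)"
  proof -
    have "(\<Sum>i<J. 1 / real (J - 1 - i)) = (\<Sum>i<J. 1 / real i)"
      using sum.nat_diff_reindex[of "\<lambda>i. 1 / real i" J] by simp
    moreover have "(\<Sum>i<J. if i = 0 then real L else 0) = real L"
      "(\<Sum>i<J. if i = J - 1 then real L else 0) = real L" using assms(2) by auto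
    ultimately show ?thesis
      unfolding G_def sum.distrib sum_distrib_left[symmetric] by simp
  qed
  also have "(\<Sum>i<J. 1 / real i) \<le> harm J"
  proof -
    have "(\<Sum>i<J. 1 / real i) = (\<Sum>i=1..<J. 1 / real i)"
      by (rule sum.mono_neutral_right) (auto simp: not_le)
    also have "\<dots> \<le> harm J" unfolding harm_def
      by (rule order_trans[OF _ sum_mono2[of "{1..J}" "{1..<J}"]]) (auto simp: inverse_eq_divide)
    finally show ?thesis .
  qed
  finally show ?thesis
    using K[of 0] by (smt (verit) J mult_left_mono of_nat_0_le_iff)
qed

text \<open>Duality: absorb the phases into factors of norm at most 1, exchange the sums, apply
  Cauchy-Schwarz in l and open the square. The sum over l attached to a pair of points is then the
  kernel.\<close>

lemma sum_norm_exp_sums_le: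
  fixes x :: "'a \<Rightarrow> real" and a :: "nat \<Rightarrow> complex"
  assumes "finite P"
  shows "(\<Sum>p\<in>P. norm (\<Sum>l = 1..L. a l * ee (real l * x p))) \<le>
    sqrt (\<Sum>l = 1..L. (norm (a l))\<^sup>2) * sqrt (\<Sum>p\<in>P. \<Sum>q\<in>P. norm (exp_kernel L (x p - x q)))"
proof -
  define T where "T p = (\<Sum>l = 1..L. a l * ee (real l * x p))" for p
  \<comment> \<open>The factor is 0 where the inner sum vanishes, so its norm is only bounded by
    1.\<close>
  define s where "s p = cnj (sgn (T p))" for p
  define B where "B l = (\<Sum>p\<in>P. s p * ee (real l * x p))" for l
  have sT: "s p * T p = of_real (norm (T p))" for p
  proof (cases "T p = 0")
    case False
    have "s p * T p = (T p * cnj (T p)) / of_real (norm (T p))"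
      by (simp add: s_def sgn_eq)
    also have "\<dots> = of_real (norm (T p))"
      unfolding complex_norm_square[symmetric] using False by (simp add: power2_eq_square)
    finally show ?thesis .
  qed (simp add: s_def)
  have s1: "norm (s p) \<le> 1" for p by (simp add: s_def norm_sgn)
  have "complex_of_real (\<Sum>p\<in>P. norm (T p)) = (\<Sum>p\<in>P. s p * T p)" by (simp add: sT)
  also have "\<dots> = (\<Sum>l = 1..L. a l * B l)"
    unfolding T_def B_def sum_distrib_left by (subst sum.swap) (simp add: mult_ac)
  finally have "\<bar>\<Sum>p\<in>P. norm (T p)\<bar> = norm (\<Sum>l = 1..L. a l * B l)"
    by (metis norm_of_real)
  then have "(\<Sum>p\<in>P. norm (T p)) \<le> norm (\<Sum>l = 1..L. a l * B l)" by linarith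
  also have "\<dots> \<le> (\<Sum>l = 1..L. \<bar>norm (a l)\<bar> * \<bar>norm (B l)\<bar>)"
    by (rule order_trans[OF norm_sum]) (simp add: norm_mult)
  also have "\<dots> \<le> L2_set (\<lambda>l. norm (a l)) {1..L} * L2_set (\<lambda>l. norm (B l)) {1..L}"
    by (rule L2_set_mult_ineq)
  also have "\<dots> = sqrt (\<Sum>l = 1..L. (norm (a l))\<^sup>2) * sqrt (\<Sum>l = 1..L. (norm (B l))\<^sup>2)"
    by (simp add: L2_set_def)
  also have "\<dots> \<le> sqrt (\<Sum>l = 1..L. (norm (a l))\<^sup>2) * sqrt (\<Sum>p\<in>P. \<Sum>q\<in>P. norm (exp_kernel L (x p - x q)))"
  proof (intro mult_left_mono real_sqrt_le_mono)
    have B2: "complex_of_real ((norm (B l))\<^sup>2) = (\<Sum>p\<in>P. \<Sum>q\<in>P. s p * cnj (s q) * ee (real l * (x p - x q)))" for l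
    proof -
      have "complex_of_real ((norm (B l))\<^sup>2) = B l * cnj (B l)" by (rule complex_norm_square)
      also have "\<dots> = (\<Sum>p\<in>P. \<Sum>q\<in>P. (s p * ee (real l * x p)) * (cnj (s q) * ee (- (real l * x q))))"
        by (simp add: B_def sum_product cnj_ee)
      also have "\<dots> = (\<Sum>p\<in>P. \<Sum>q\<in>P. s p * cnj (s q) * ee (real l * (x p - x q)))"
      proof (intro sum.cong refl)
        fix p q
        have "ee (real l * (x p - x q)) = ee (real l * x p) * ee (- (real l * x q))"
          by (simp add: algebra_simps flip: ee_add)
        then show "(s p * ee (real l * x p)) * (cnj (s q) * ee (- (real l * x q))) = s p * cnj (s q) * ee (real l * (x p - x q))"
          by (simp only: mult_ac)
      qed
      finally show ?thesis .
    qed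
    have "complex_of_real (\<Sum>l = 1..L. (norm (B l))\<^sup>2) =
        (\<Sum>l = 1..L. \<Sum>p\<in>P. \<Sum>q\<in>P. s p * cnj (s q) * ee (real l * (x p - x q)))"
      by (simp add: B2 flip: of_real_power)
    also have "\<dots> = (\<Sum>p\<in>P. \<Sum>l = 1..L. \<Sum>q\<in>P. s p * cnj (s q) * ee (real l * (x p - x q)))"
      by (rule sum.swap)
    also have "\<dots> = (\<Sum>p\<in>P. \<Sum>q\<in>P. \<Sum>l = 1..L. s p * cnj (s q) * ee (real l * (x p - x q)))"
      by (intro sum.cong refl sum.swap)
    also have "\<dots> = (\<Sum>p\<in>P. \<Sum>q\<in>P. s p * cnj (s q) * exp_kernel L (x p - x q))"
      by (simp add: exp_kernel_def sum_distrib_left)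
    finally have "\<bar>\<Sum>l = 1..L. (norm (B l))\<^sup>2\<bar> = norm (\<Sum>p\<in>P. \<Sum>q\<in>P. s p * cnj (s q) * exp_kernel L (x p - x q))"
      by (metis norm_of_real)
    then have "(\<Sum>l = 1..L. (norm (B l))\<^sup>2) \<le> norm (\<Sum>p\<in>P. \<Sum>q\<in>P. s p * cnj (s q) * exp_kernel L (x p - x q))"
      by linarith
    also have "\<dots> \<le> (\<Sum>p\<in>P. \<Sum>q\<in>P. norm (exp_kernel L (x p - x q)))"
    proof (intro sum_norm_le)
      fix p q
      have "norm (s p) * norm (s q) \<le> 1 * 1" by (intro mult_mono s1) auto
      then show "norm (s p * cnj (s q) * exp_kernel L (x p - x q)) \<le> norm (exp_kernel L (x p - x q))"
        by (simp add: norm_mult mult_left_le_one_le)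
    qed
    finally show "(\<Sum>l = 1..L. (norm (B l))\<^sup>2) \<le> (\<Sum>p\<in>P. \<Sum>q\<in>P. norm (exp_kernel L (x p - x q)))" .
  qed (simp add: sum_nonneg)
  finally show ?thesis by (simp add: T_def)
qed

lemma harm_le_powr:
  fixes \<epsilon> :: real
  assumes "\<epsilon> > 0"
  shows "\<exists>C \<ge> 1. \<forall>n > 0. harm n \<le> C * real n powr \<epsilon>"
proof (intro exI[of _ "1 + 1 / \<epsilon>"] conjI allI impI)
  show "1 \<le> 1 + 1 / \<epsilon>" using assms by simp
  fix n :: nat assume n: "n > 0"
  have "harm n \<le> 1 + ln (real n)"
    using euler_mascheroni_sequence_decreasing[of 1 n] n by (simp add: harm_def)
  also have "ln (real n) \<le> real n powr \<epsilon> / \<epsilon>"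
    using n assms by (intro ln_powr_bound) auto
  also have "1 + real n powr \<epsilon> / \<epsilon> \<le> (1 + 1 / \<epsilon>) * real n powr \<epsilon>"
    using n assms by (simp add: algebra_simps ge_one_powr_ge_zero)
  finally show "harm n \<le> (1 + 1 / \<epsilon>) * real n powr \<epsilon>" by simp
qed

section \<open>The large sieve at the fractions v / d\<close>

lemma root_pairs_fraction:
  assumes "(d, v) \<in> root_pairs f D"
  shows "0 \<le> real v / real d" "real v / real d < 1"
  using assms by (auto simp: root_pairs_def form_roots_def)

text \<open>The exponent is 1 + 1/2 + 1: the number of roots, the number in an interval of length 1
  / D, and the sum of the kernel over the bins. Each of the three loses one \<epsilon>. Y dominates
  both the moduli and the length of the sum.\<close>

lemma sum_root_pairs_exp_kernel_le:
  fixes \<epsilon> :: real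
  assumes f: "binary_form k f" "k \<ge> 2" "irreducible f" and "\<epsilon> > 0"
  shows "\<exists>C \<ge> 1. \<forall>D Y L. 1 \<le> D \<and> D \<le> Y \<and> real L \<le> Y \<longrightarrow>
    (\<Sum>(d, v)\<in>root_pairs f D. \<Sum>(d', v')\<in>root_pairs f D.
       norm (exp_kernel L (real v / real d - real v' / real d'))) \<le> C * Y powr (5 / 2 + 3 * \<epsilon>)"
proof -
  obtain C1 where C1: "C1 \<ge> 1" "\<And>D. D \<ge> 1 \<Longrightarrow> real (card (root_pairs f D)) \<le> C1 * D powr (1 + \<epsilon>)"
    using card_root_pairs_le[OF assms] by blast
  obtain C2 where C2: "C2 \<ge> 1" "\<And>D \<theta>. D \<ge> 1 \<Longrightarrow>
    real (card {(d, v) \<in> root_pairs f D. \<bar>real v / real d - \<theta>\<bar> \<le> 1 / D}) \<le> C2 * D powr (1 / 2 + \<epsilon>)"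
    using card_root_pairs_near_le[OF assms] by blast
  obtain C3 where C3: "C3 \<ge> 1" "\<And>n. n > 0 \<Longrightarrow> harm n \<le> C3 * real n powr \<epsilon>"
    using harm_le_powr[OF assms(4)] by blast
  define C where "C = C1 * (2 * C2 * (2 + 2 * (C3 * 2 powr \<epsilon>)))"
  show ?thesis
  proof (intro exI[of _ C] conjI allI impI)
    have "1 * (1 * 1 * (1 + 0)) \<le> C" unfolding C_def
      using C1(1) C2(1) C3(1) by (intro mult_mono add_mono) auto
    then show "1 \<le> C" by simp
    fix D Y :: real and L :: nat
    assume asm: "1 \<le> D \<and> D \<le> Y \<and> real L \<le> Y"
    then have D: "1 \<le> D" "D \<le> Y" "real L \<le> Y" by auto
    define x where "x p = real (snd p) / real (fst p)" for p :: "nat \<times> nat"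
    \<comment> \<open>Rounding D up makes the bins no longer than 1 / D, the length for which the
      local count is known.\<close>
    define J where "J = nat \<lceil>D\<rceil>"
    have J: "J \<ge> 1" "D \<le> real J" "real J \<le> 2 * D" using D(1) unfolding J_def by linarith+
    define K where "K = C2 * D powr (1 / 2 + \<epsilon>)"
    have near: "real (card {p \<in> root_pairs f D. t \<le> x p \<and> x p \<le> t + 1 / real J}) \<le> K" for t
    proof -
      have "1 / real J \<le> 1 / D" using J D by (intro frac_le) auto
      then have "card {p \<in> root_pairs f D. t \<le> x p \<and> x p \<le> t + 1 / real J} \<le>
          card {(d, v) \<in> root_pairs f D. \<bar>real v / real d - t\<bar> \<le> 1 / D}"
        by (intro card_mono finite_subset[OF _ finite_root_pairs[of f D]]) (auto simp: x_def)
      then show ?thesis using C2(2)[OF D(1), of t] by (simp add: K_def)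
    qed
    have K0: "K \<ge> 0" using C2(1) by (simp add: K_def)
    have inner: "(\<Sum>p\<in>root_pairs f D. norm (exp_kernel L (x p - x q))) \<le>
        2 * K * (2 * real L + real J * harm J)" if "q \<in> root_pairs f D" for q
      using near root_pairs_fraction[of _ _ f D] that J
      by (intro sum_norm_exp_kernel_le) (auto simp: x_def)
    have harmJ: "harm J \<le> C3 * 2 powr \<epsilon> * Y powr \<epsilon>"
    proof -
      have "harm J \<le> C3 * real J powr \<epsilon>" using C3(2) J(1) by simp
      also have "\<dots> \<le> C3 * (2 * Y) powr \<epsilon>"
        using C3(1) J D assms(4) by (intro mult_left_mono powr_mono2) auto
      finally show ?thesis using D by (simp add: powr_mult mult.assoc)
    qed
    have Y1: "Y powr \<epsilon> \<ge> 1" using D assms(4) by (intro ge_one_powr_ge_zero) auto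
    have "(\<Sum>(d, v)\<in>root_pairs f D. \<Sum>(d', v')\<in>root_pairs f D.
       norm (exp_kernel L (real v / real d - real v' / real d'))) =
       (\<Sum>p\<in>root_pairs f D. \<Sum>q\<in>root_pairs f D. norm (exp_kernel L (x p - x q)))"
      by (simp add: x_def case_prod_unfold)
    also have "\<dots> = (\<Sum>q\<in>root_pairs f D. \<Sum>p\<in>root_pairs f D. norm (exp_kernel L (x p - x q)))"
      by (rule sum.swap)
    also have "\<dots> \<le> real (card (root_pairs f D)) * (2 * K * (2 * real L + real J * harm J))"
      by (rule sum_bounded_above) (rule inner)
    also have "\<dots> \<le> (C1 * Y powr (1 + \<epsilon>)) * (2 * (C2 * Y powr (1 / 2 + \<epsilon>)) *
        (2 * (Y * Y powr \<epsilon>) + (2 * Y) * (C3 * 2 powr \<epsilon> * Y powr \<epsilon>)))"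
    proof (intro mult_mono add_mono)
      have "real (card (root_pairs f D)) \<le> C1 * D powr (1 + \<epsilon>)" using C1(2) D by blast
      also have "\<dots> \<le> C1 * Y powr (1 + \<epsilon>)"
        using C1(1) D assms(4) by (intro mult_left_mono powr_mono2) auto
      finally show "real (card (root_pairs f D)) \<le> C1 * Y powr (1 + \<epsilon>)" .
      show "K \<le> C2 * Y powr (1 / 2 + \<epsilon>)" unfolding K_def
        using C2(1) D assms(4) by (intro mult_left_mono powr_mono2) auto
      have "Y * 1 \<le> Y * Y powr \<epsilon>" using Y1 D by (intro mult_left_mono) auto
      then show "real L \<le> Y * Y powr \<epsilon>" using D by linarith
    qed (use J D harmJ C1 C2 C3 K0 in \<open>auto simp: harm_nonneg\<close>)
    also have "\<dots> = C * (Y powr (1 + \<epsilon>) * Y powr (1 / 2 + \<epsilon>) * (Y powr 1 * Y powr \<epsilon>))"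
      using D by (simp add: C_def algebra_simps)
    also have "\<dots> = C * Y powr (5 / 2 + 3 * \<epsilon>)"
      by (simp only: powr_add[symmetric]) (simp add: field_simps)
    finally show "(\<Sum>(d, v)\<in>root_pairs f D. \<Sum>(d', v')\<in>root_pairs f D.
       norm (exp_kernel L (real v / real d - real v' / real d'))) \<le> C * Y powr (5 / 2 + 3 * \<epsilon>)" .
  qed
qed

text \<open>Collecting the products i m = l gives a single exponential sum of length at most Y whose
  coefficients are bounded by the number of divisors of l, so arbitrary \<alpha> cost only a small
  power of Y. The large sieve then yields the square root of Y * Y^(5/2).\<close>

lemma bilinear_sum_over_roots_le:
  fixes \<epsilon> :: real
  assumes f: "binary_form k f" "k \<ge> 2" "irreducible f" and "\<epsilon> > 0"
  shows "\<exists>C \<ge> 1. \<forall>D Y h M (\<alpha> :: nat \<Rightarrow> complex).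
    1 \<le> D \<and> D \<le> Y \<and> real h * real M \<le> Y \<and> (\<forall>m. norm (\<alpha> m) \<le> 1) \<longrightarrow>
    (\<Sum>(d, v)\<in>root_pairs f D.
       norm (\<Sum>i = 1..h. \<Sum>m = 1..M. \<alpha> m * ee (real i * real m * (real v / real d)))) \<le> C * Y powr (7 / 4 + \<epsilon>)"
proof -
  \<comment> \<open>The losses are \<eta> from the coefficients and 3 \<eta> / 2 from the kernel
    sum, together less than \<epsilon>.\<close>
  define \<eta> where "\<eta> = \<epsilon> / 3"
  have \<eta>: "\<eta> > 0" using assms(4) by (simp add: \<eta>_def)
  obtain C1 where C1: "C1 \<ge> 1" "\<And>n. n > 0 \<Longrightarrow> real (card {d :: nat. d dvd n}) \<le> C1 * real n powr \<eta>"
    using divisor_bound[OF \<eta>] by blast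
  obtain C2 where C2: "C2 \<ge> 1" "\<And>D Y L. 1 \<le> D \<Longrightarrow> D \<le> Y \<Longrightarrow> real L \<le> Y \<Longrightarrow>
    (\<Sum>(d, v)\<in>root_pairs f D. \<Sum>(d', v')\<in>root_pairs f D.
       norm (exp_kernel L (real v / real d - real v' / real d'))) \<le> C2 * Y powr (5 / 2 + 3 * \<eta>)"
    using sum_root_pairs_exp_kernel_le[OF f \<eta>] by blast
  show ?thesis
  proof (intro exI[of _ "C1 * C2"] conjI allI impI)
    show "1 \<le> C1 * C2" using mult_mono[OF C1(1) C2(1)] C1(1) by simp
    fix D Y :: real and h M :: nat and \<alpha> :: "nat \<Rightarrow> complex"
    assume "1 \<le> D \<and> D \<le> Y \<and> real h * real M \<le> Y \<and> (\<forall>m. norm (\<alpha> m) \<le> 1)"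
    then have D: "1 \<le> D" "D \<le> Y" and hM: "real (h * M) \<le> Y" and \<alpha>: "\<And>m. norm (\<alpha> m) \<le> 1" by auto
    define L where "L = h * M"
    define R where "R l = {p. p \<in> {1..h} \<times> {1..M} \<and> fst p * snd p = l}" for l
    define a where "a l = (\<Sum>p\<in>R l. \<alpha> (snd p))" for l
    have rewr: "(\<Sum>i = 1..h. \<Sum>m = 1..M. \<alpha> m * ee (real i * real m * t)) = (\<Sum>l = 1..L. a l * ee (real l * t))" for t
    proof -
      have "(\<Sum>i = 1..h. \<Sum>m = 1..M. \<alpha> m * ee (real i * real m * t)) =
          (\<Sum>p\<in>{1..h} \<times> {1..M}. \<alpha> (snd p) * ee (real (fst p * snd p) * t))"
        by (subst sum.cartesian_product) (simp add: case_prod_unfold)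
      also have "\<dots> = (\<Sum>l = 1..L. \<Sum>p\<in>R l. \<alpha> (snd p) * ee (real (fst p * snd p) * t))"
        unfolding R_def by (rule sum.group[symmetric]) (auto simp: L_def intro!: mult_le_mono)
      also have "\<dots> = (\<Sum>l = 1..L. a l * ee (real l * t))"
        by (intro sum.cong refl) (auto simp: a_def sum_distrib_right R_def)
      finally show ?thesis .
    qed
    have a_le: "norm (a l) \<le> C1 * Y powr \<eta>" if "l \<in> {1..L}" for l
    proof -
      have l: "l > 0" "real l \<le> Y" using that hM unfolding L_def
        by (auto intro: order_trans[OF of_nat_mono, of l "h * M"])
      have "norm (a l) \<le> real (card (R l))"
        unfolding a_def using \<alpha> by (rule order_trans[OF sum_norm_le[of _ _ "\<lambda>_. 1"]]) auto
      also have "card (R l) \<le> card {d. d dvd l}"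
        by (rule card_inj_on_le[of fst]) (use l in \<open>auto simp: inj_on_def R_def\<close>)
      then have "real (card (R l)) \<le> real (card {d. d dvd l})" by simp
      also have "\<dots> \<le> C1 * real l powr \<eta>" by (rule C1(2)[OF l(1)])
      also have "\<dots> \<le> C1 * Y powr \<eta>" using C1(1) l \<eta> by (intro mult_left_mono powr_mono2) auto
      finally show ?thesis .
    qed
    have sum_a: "(\<Sum>l = 1..L. (norm (a l))\<^sup>2) \<le> C1\<^sup>2 * Y powr (1 + 2 * \<eta>)"
    proof -
      have "(\<Sum>l = 1..L. (norm (a l))\<^sup>2) \<le> real (card {1..L}) * (C1 * Y powr \<eta>)\<^sup>2"
        by (rule sum_bounded_above) (use a_le in \<open>auto intro: power_mono\<close>)
      also have "\<dots> \<le> Y * (C1 * Y powr \<eta>)\<^sup>2" using hM by (intro mult_right_mono) (auto simp: L_def)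
      also have "\<dots> = C1\<^sup>2 * (Y powr 1 * (Y powr \<eta> * Y powr \<eta>))"
        using D by (simp add: power2_eq_square)
      also have "\<dots> = C1\<^sup>2 * Y powr (1 + 2 * \<eta>)"
        by (simp only: powr_add[symmetric]) simp
      finally show ?thesis .
    qed
    have "(\<Sum>(d, v)\<in>root_pairs f D.
       norm (\<Sum>i = 1..h. \<Sum>m = 1..M. \<alpha> m * ee (real i * real m * (real v / real d)))) =
       (\<Sum>p\<in>root_pairs f D. norm (\<Sum>l = 1..L. a l * ee (real l * (real (snd p) / real (fst p)))))"
      by (simp only: rewr case_prod_unfold)
    also have "\<dots> \<le> sqrt (\<Sum>l = 1..L. (norm (a l))\<^sup>2) * sqrt (\<Sum>p\<in>root_pairs f D. \<Sum>q\<in>root_pairs f D.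
        norm (exp_kernel L (real (snd p) / real (fst p) - real (snd q) / real (fst q))))"
      by (rule sum_norm_exp_sums_le) simp
    also have "\<dots> \<le> sqrt (C1\<^sup>2 * Y powr (1 + 2 * \<eta>)) * sqrt (C2 * Y powr (5 / 2 + 3 * \<eta>))"
      using sum_a C2(2)[OF D, of L] hM
      by (intro mult_mono real_sqrt_le_mono) (auto simp: L_def case_prod_unfold sum_nonneg)
    also have "\<dots> \<le> C1 * C2 * (Y powr ((1 + 2 * \<eta>) / 2) * Y powr ((5 / 2 + 3 * \<eta>) / 2))"
    proof -
      have sq: "sqrt (Y powr t) = Y powr (t / 2)" for t
        by (simp add: powr_half_sqrt[symmetric] powr_powr)
      have "sqrt C2 \<le> C2" using C2(1) by (intro real_le_lsqrt) (auto simp: power2_eq_square)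
      then have "C1 * Y powr ((1 + 2 * \<eta>) / 2) * (sqrt C2 * Y powr ((5 / 2 + 3 * \<eta>) / 2)) \<le>
          C1 * Y powr ((1 + 2 * \<eta>) / 2) * (C2 * Y powr ((5 / 2 + 3 * \<eta>) / 2))"
        using C1(1) by (intro mult_left_mono mult_right_mono) auto
      then show ?thesis using C1(1) by (simp add: real_sqrt_mult sq mult_ac)
    qed
    also have "\<dots> = C1 * C2 * Y powr (7 / 4 + 5 / 2 * \<eta>)"
      unfolding powr_add[symmetric] by (rule arg_cong[where f = "\<lambda>t. C1 * C2 * Y powr t"]) (simp add: field_simps)
    also have "\<dots> \<le> C1 * C2 * Y powr (7 / 4 + \<epsilon>)"
      using C1(1) C2(1) D \<eta> by (intro mult_left_mono powr_mono) (auto simp: \<eta>_def)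
    finally show "(\<Sum>(d, v)\<in>root_pairs f D.
       norm (\<Sum>i = 1..h. \<Sum>m = 1..M. \<alpha> m * ee (real i * real m * (real v / real d)))) \<le> C1 * C2 * Y powr (7 / 4 + \<epsilon>)" .
  qed
qed

section \<open>Sums with a smooth weight\<close>

text \<open>A class closed under \<open>deriv\<close>, so that bounds can be proved by induction on
  the number of differences.\<close>

definition bump :: "(real \<Rightarrow> real) \<Rightarrow> bool" where
  "bump W \<longleftrightarrow> smooth W \<and> (\<forall>t. t < 0 \<or> 1 < t \<longrightarrow> W t = 0)"

lemma smooth_has_real_derivative:
  assumes "smooth W"
  shows "(W has_real_derivative deriv W x) (at x)"
proof -
  have "W differentiable (at x)" using assms unfolding smooth_def by (metis funpow_0)
  then show ?thesis by (simp add: DERIV_deriv_iff_real_differentiable)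
qed

lemma smooth_deriv: "smooth W \<Longrightarrow> smooth (deriv W)"
  unfolding smooth_def by (metis funpow_Suc_right o_apply)

lemma bump_deriv:
  assumes "bump W"
  shows "bump (deriv W)"
  unfolding bump_def
proof (intro conjI allI impI)
  show "smooth (deriv W)" using assms smooth_deriv by (auto simp: bump_def)
  fix t :: real assume t: "t < 0 \<or> 1 < t"
  have "open ({..<0} \<union> {1<..} :: real set)" by auto
  moreover have "t \<in> {..<0} \<union> {1<..}" using t by auto
  moreover have "\<And>u. u \<in> {..<0} \<union> {1<..} \<Longrightarrow> (\<lambda>_. 0) u = W u" using assms by (auto simp: bump_def)
  ultimately have "(W has_real_derivative 0) (at t)"
    using has_field_derivative_transform_within_open[of "\<lambda>_. 0" 0 t "{..<0} \<union> {1<..}" W] by simp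
  then show "deriv W t = 0" by (rule DERIV_imp_deriv)
qed

lemma bump_continuous: "bump W \<Longrightarrow> continuous_on A W"
  by (metis DERIV_continuous_on bump_def has_field_derivative_at_within smooth_has_real_derivative)

lemma bump_bounded:
  assumes "bump W"
  obtains B where "B \<ge> 0" "\<And>t. \<bar>W t\<bar> \<le> B"
proof -
  have "compact (W ` {0..1})" using bump_continuous[OF assms] by (intro compact_continuous_image) auto
  then obtain B where B: "\<forall>t\<in>{0..1}. \<bar>W t\<bar> \<le> B"
    using compact_imp_bounded[of "W ` {0..1}"] unfolding bounded_iff by auto
  show ?thesis
  proof (rule that[of "\<bar>B\<bar>"])
    fix t
    show "\<bar>W t\<bar> \<le> \<bar>B\<bar>"
    proof (cases "t \<in> {0..1}")
      case False
      then have "W t = 0" using assms by (auto simp: bump_def)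
      then show ?thesis by simp
    qed (use B in force)
  qed simp
qed

section \<open>Backward differences and summation by parts\<close>

definition backdiff :: "real \<Rightarrow> (real \<Rightarrow> real) \<Rightarrow> real \<Rightarrow> real" where
  "backdiff s g t = g t - g (t - s)"

lemma backdiff_power_has_derivative:
  assumes "smooth W"
  shows "((backdiff s ^^ j) W has_real_derivative (backdiff s ^^ j) (deriv W) t) (at t)"
proof (induction j arbitrary: t)
  case 0
  then show ?case using smooth_has_real_derivative[OF assms] by simp
next
  case (Suc j)
  have "((\<lambda>t. (backdiff s ^^ j) W (t - s)) has_real_derivative (backdiff s ^^ j) (deriv W) (t - s)) (at t)"
    using Suc.IH[of "t - s"] DERIV_shift[of "(backdiff s ^^ j) W" _ t "- s"] by simp
  then have "((\<lambda>t. (backdiff s ^^ j) W t - (backdiff s ^^ j) W (t - s)) has_real_derivative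
      (backdiff s ^^ j) (deriv W) t - (backdiff s ^^ j) (deriv W) (t - s)) (at t)"
    using Suc.IH[of t] by (rule DERIV_diff[rotated])
  moreover have "(backdiff s ^^ Suc j) g = (\<lambda>t. (backdiff s ^^ j) g t - (backdiff s ^^ j) g (t - s))" for g
    by (simp add: backdiff_def fun_eq_iff)
  ultimately show ?case by simp
qed

text \<open>Differencing commutes with differentiation, so the mean value theorem trades one
  difference at a time for a derivative and a factor s.\<close>

lemma backdiff_power_bound:
  assumes "bump W"
  shows "\<exists>C \<ge> 0. \<forall>s > 0. \<forall>t. \<bar>(backdiff s ^^ j) W t\<bar> \<le> C * s ^ j"
  using assms
proof (induction j arbitrary: W)
  case 0
  then show ?case using bump_bounded[of W] by (metis funpow_0 mult.right_neutral power_0)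
next
  case (Suc j)
  obtain C where C: "C \<ge> 0" "\<And>s t. s > 0 \<Longrightarrow> \<bar>(backdiff s ^^ j) (deriv W) t\<bar> \<le> C * s ^ j"
    using Suc.IH[OF bump_deriv[OF Suc.prems]] by blast
  have "\<bar>(backdiff s ^^ Suc j) W t\<bar> \<le> C * s ^ Suc j" if s: "s > 0" for s t
  proof -
    have "smooth W" using Suc.prems by (simp add: bump_def)
    then obtain z where "(backdiff s ^^ j) W t - (backdiff s ^^ j) W (t - s)
        = (t - (t - s)) * (backdiff s ^^ j) (deriv W) z"
      using MVT2[of "t - s" t "(backdiff s ^^ j) W" "(backdiff s ^^ j) (deriv W)"]
        backdiff_power_has_derivative[of W j s] s by auto
    then have "\<bar>(backdiff s ^^ Suc j) W t\<bar> = s * \<bar>(backdiff s ^^ j) (deriv W) z\<bar>"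
      using s by (simp add: backdiff_def abs_mult)
    also have "\<dots> \<le> s * (C * s ^ j)" using C(2) s by (intro mult_left_mono) auto
    finally show ?thesis by (simp add: mult_ac)
  qed
  then show ?case using C(1) by blast
qed

text \<open>Multiplication by 1 - z replaces the coefficients by their backward differences. The
  boundary terms drop out since g vanishes at -s and at the top point s P.\<close>

lemma summation_by_parts_backdiff:
  fixes z :: complex and g :: "real \<Rightarrow> real"
  assumes "s > 0" "\<And>t. t < 0 \<Longrightarrow> g t = 0" "\<And>t. hi < t \<Longrightarrow> g t = 0" "hi + s * real j < s * real P"
  shows "(1 - z) ^ j * (\<Sum>n\<le>P. of_real (g (s * real n)) * z ^ n) =
    (\<Sum>n\<le>P. of_real ((backdiff s ^^ j) g (s * real n)) * z ^ n)"
  using assms(2-4)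
proof (induction j arbitrary: g hi)
  case (Suc j)
  have step: "(1 - z) * (\<Sum>n\<le>Q. of_real (g (s * real n)) * z ^ n) =
      (\<Sum>n\<le>Q. of_real (backdiff s g (s * real n)) * z ^ n) - of_real (g (s * real Q)) * z ^ Suc Q" for Q
  proof (induction Q)
    case 0
    have "g (- s) = 0" using Suc.prems(1) assms(1) by simp
    then show ?case by (simp add: backdiff_def algebra_simps)
  next
    case (Suc Q)
    have "backdiff s g (s * real (Suc Q)) = g (s * real (Suc Q)) - g (s * real Q)"
      by (simp add: backdiff_def algebra_simps)
    then show ?case using Suc by (simp add: distrib_left) (simp add: algebra_simps)
  qed
  have sj: "0 \<le> s * real j" using assms(1) by simp
  have "s * real (Suc j) = s + s * real j" by (simp add: algebra_simps)
  then have "hi < s * real P" using Suc.prems(3) assms(1) sj by linarith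
  then have 1: "(1 - z) * (\<Sum>n\<le>P. of_real (g (s * real n)) * z ^ n) =
      (\<Sum>n\<le>P. of_real (backdiff s g (s * real n)) * z ^ n)"
    using step[of P] Suc.prems(2) by simp
  have "(1 - z) ^ Suc j * (\<Sum>n\<le>P. of_real (g (s * real n)) * z ^ n) =
      (1 - z) ^ j * ((1 - z) * (\<Sum>n\<le>P. of_real (g (s * real n)) * z ^ n))" by (simp add: mult_ac)
  also have "\<dots> = (1 - z) ^ j * (\<Sum>n\<le>P. of_real (backdiff s g (s * real n)) * z ^ n)" by (simp only: 1)
  also have "\<dots> = (\<Sum>n\<le>P. of_real ((backdiff s ^^ j) (backdiff s g) (s * real n)) * z ^ n)"
  proof (rule Suc.IH)
    show "backdiff s g t = 0" if "t < 0" for t using Suc.prems(1) that assms(1) by (simp add: backdiff_def)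
    \<comment> \<open>Each difference moves the right end of the support up by s; hence the range
      has to exceed \<open>hi\<close> by s j.\<close>
    show "backdiff s g t = 0" if "hi + s < t" for t using Suc.prems(2) that assms(1) by (simp add: backdiff_def)
    show "hi + s + s * real j < s * real P" using Suc.prems(3) by (simp add: algebra_simps)
  qed
  finally show ?case by (simp only: funpow_Suc_right o_apply)
qed simp

text \<open>The discrete Fourier transform of W(n / N), of period 1 in \<theta>. The range n \<le> N
  suffices for weights vanishing outside [0, 1].\<close>

definition weight_sum :: "(real \<Rightarrow> real) \<Rightarrow> real \<Rightarrow> real \<Rightarrow> complex" where
  "weight_sum W N \<theta> = (\<Sum>n\<le>nat \<lfloor>N\<rfloor>. of_real (W (real n / N)) * ee (- (real n * \<theta>)))"

text \<open>Zero padding, which makes room for the support that repeated differencing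
  enlarges.\<close>

lemma weight_sum_extend:
  assumes "bump W" "N \<ge> 1" "nat \<lfloor>N\<rfloor> \<le> P"
  shows "weight_sum W N \<theta> = (\<Sum>n\<le>P. of_real (W (real n / N)) * ee (- (real n * \<theta>)))"
  unfolding weight_sum_def
proof (rule sum.mono_neutral_left)
  show "\<forall>n\<in>{..P} - {..nat \<lfloor>N\<rfloor>}. complex_of_real (W (real n / N)) * ee (- (real n * \<theta>)) = 0"
  proof
    fix n assume "n \<in> {..P} - {..nat \<lfloor>N\<rfloor>}"
    then have "N < real n" by simp linarith
    then have "1 < real n / N" using assms(2) by (simp add: field_simps)
    then show "complex_of_real (W (real n / N)) * ee (- (real n * \<theta>)) = 0"
      using assms(1) by (simp add: bump_def)
  qed
qed (use assms(3) in auto)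

text \<open>j summations by parts leave O(N) terms, each a j-th difference of size O(N^(-j)).
  Keeping the power of |1 - e(\<theta>)| on the left avoids a case distinction at integers.
  Smoothness makes every j available.\<close>

lemma weight_sum_decay:
  assumes "bump W"
  shows "\<exists>C \<ge> 0. \<forall>N \<ge> 1. \<forall>\<theta>. norm (1 - ee \<theta>) ^ j * norm (weight_sum W N \<theta>) \<le> C * N / N ^ j"
proof -
  obtain C where C: "C \<ge> 0" "\<And>s t. s > 0 \<Longrightarrow> \<bar>(backdiff s ^^ j) W t\<bar> \<le> C * s ^ j"
    using backdiff_power_bound[OF assms] by blast
  show ?thesis
  proof (intro exI[of _ "(real j + 4) * C"] conjI allI impI)
    show "0 \<le> (real j + 4) * C" using C by simp
    fix N \<theta> :: real assume N: "1 \<le> N"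
    define P where "P = nat \<lfloor>N\<rfloor> + j + 2"
    define z where "z = ee (- \<theta>)"
    have P: "N + real j < real P" "real P + 1 \<le> (real j + 4) * N"
    proof -
      have "real (nat \<lfloor>N\<rfloor>) \<le> N" "N < real (nat \<lfloor>N\<rfloor>) + 1" using N by auto
      moreover have "real j * 1 \<le> real j * N" using N by (intro mult_left_mono) auto
      ultimately show "N + real j < real P" "real P + 1 \<le> (real j + 4) * N"
        using N unfolding P_def by (simp_all add: algebra_simps del: of_nat_nat of_int_floor_le)
    qed
    have "weight_sum W N \<theta> = (\<Sum>n\<le>P. of_real (W (real n / N)) * ee (- (real n * \<theta>)))"
      by (rule weight_sum_extend[OF assms N]) (simp add: P_def)
    also have "\<dots> = (\<Sum>n\<le>P. of_real (W (1 / N * real n)) * z ^ n)"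
      by (simp add: z_def ee_power)
    finally have "(1 - z) ^ j * weight_sum W N \<theta> = (1 - z) ^ j * (\<Sum>n\<le>P. of_real (W (1 / N * real n)) * z ^ n)"
      by simp
    also have "\<dots> = (\<Sum>n\<le>P. of_real ((backdiff (1 / N) ^^ j) W (1 / N * real n)) * z ^ n)"
    proof (rule summation_by_parts_backdiff[where hi = 1])
      have "(N + real j) / N < real P / N" using P(1) N by (intro divide_strict_right_mono) auto
      then show "1 + 1 / N * real j < 1 / N * real P" using N by (simp add: add_divide_distrib)
    qed (use N assms in \<open>auto simp: bump_def\<close>)
    finally have "norm ((1 - z) ^ j * weight_sum W N \<theta>) \<le>
        (\<Sum>n\<le>P. norm (of_real ((backdiff (1 / N) ^^ j) W (1 / N * real n)) * z ^ n))"
      by (simp only: norm_sum)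
    also have "\<dots> \<le> real (card {..P}) * (C * (1 / N) ^ j)"
      by (rule sum_bounded_above) (use C N in \<open>auto simp: norm_mult norm_power z_def\<close>)
    also have "\<dots> \<le> ((real j + 4) * N) * (C * (1 / N) ^ j)"
      using P C N by (intro mult_right_mono) auto
    also have "\<dots> = (real j + 4) * C * N / N ^ j" by (simp add: power_divide)
    finally have "norm (1 - z) ^ j * norm (weight_sum W N \<theta>) \<le> (real j + 4) * C * N / N ^ j"
      by (simp add: norm_mult norm_power)
    moreover have "norm (1 - z) = norm (1 - ee \<theta>)"
      using complex_mod_cnj[of "1 - ee \<theta>"] by (simp add: cnj_ee z_def)
    ultimately show "norm (1 - ee \<theta>) ^ j * norm (weight_sum W N \<theta>) \<le> (real j + 4) * C * N / N ^ j"
      by simp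
  qed
qed

lemma norm_ee_diff_le: "norm (ee a - ee b) \<le> 2 * pi * \<bar>a - b\<bar>"
proof -
  have "ee a - ee b = - ee b * (1 - ee (a - b))"
    using ee_add[of b "a - b"] by (simp add: algebra_simps)
  then have "norm (ee a - ee b) = norm (1 - ee (a - b))" by (simp add: norm_mult)
  also have "\<dots> = 2 * \<bar>sin (pi * (a - b))\<bar>" by (simp add: ee_def norm_1_minus_cis)
  also have "\<dots> \<le> 2 * \<bar>pi * (a - b)\<bar>" using abs_sin_x_le_abs_x[of "pi * (a - b)"] by simp
  finally show ?thesis by (simp add: abs_mult)
qed

text \<open>Prepares Abel summation in the frequency. N^2 comes from O(N) terms, each with Lipschitz
  constant O(N) in \<theta>.\<close>

lemma weight_sum_bounded_lipschitz:
  assumes "bump W"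
  shows "\<exists>C \<ge> 0. \<forall>N \<ge> 1. \<forall>\<theta> \<theta>'. norm (weight_sum W N \<theta>) \<le> C * N \<and>
    norm (weight_sum W N \<theta> - weight_sum W N \<theta>') \<le> C * N ^ 2 * \<bar>\<theta> - \<theta>'\<bar>"
proof -
  obtain B where B: "B \<ge> 0" "\<And>t. \<bar>W t\<bar> \<le> B" using bump_bounded[OF assms] by blast
  show ?thesis
  proof (intro exI[of _ "4 * pi * B"] conjI allI impI)
    show "0 \<le> 4 * pi * B" using B by simp
    fix N \<theta> \<theta>' :: real assume N: "1 \<le> N"
    define M where "M = nat \<lfloor>N\<rfloor>"
    have M: "real M \<le> N" "real M + 1 \<le> 2 * N" using N by (auto simp: M_def) linarith
    have "norm (weight_sum W N \<theta>) \<le> (\<Sum>n\<le>M. norm (of_real (W (real n / N)) * ee (- (real n * \<theta>))))"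
      unfolding weight_sum_def M_def by (rule norm_sum)
    also have "\<dots> \<le> real (card {..M}) * B"
      by (rule sum_bounded_above) (use B in \<open>auto simp: norm_mult\<close>)
    also have "\<dots> \<le> (2 * N) * B" using M B by (intro mult_right_mono) auto
    also have "\<dots> \<le> 4 * pi * B * N"
    proof -
      have "2 \<le> 4 * pi" using pi_gt3 by simp
      then have "2 * (B * N) \<le> (4 * pi) * (B * N)" using B N by (intro mult_right_mono) auto
      then show ?thesis by (simp add: mult_ac)
    qed
    finally show "norm (weight_sum W N \<theta>) \<le> 4 * pi * B * N" .
    have "norm (weight_sum W N \<theta> - weight_sum W N \<theta>') \<le>
        (\<Sum>n\<le>M. norm (of_real (W (real n / N)) * (ee (- (real n * \<theta>)) - ee (- (real n * \<theta>')))))"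
      unfolding weight_sum_def M_def sum_subtractf[symmetric] right_diff_distrib[symmetric] by (rule norm_sum)
    also have "\<dots> \<le> real (card {..M}) * (B * (2 * pi * (N * \<bar>\<theta> - \<theta>'\<bar>)))"
    proof (rule sum_bounded_above)
      fix n assume n: "n \<in> {..M}"
      have "norm (ee (- (real n * \<theta>)) - ee (- (real n * \<theta>'))) \<le> 2 * pi * \<bar>- (real n * \<theta>) - - (real n * \<theta>')\<bar>"
        by (rule norm_ee_diff_le)
      also have "\<bar>- (real n * \<theta>) - - (real n * \<theta>')\<bar> = real n * \<bar>\<theta> - \<theta>'\<bar>"
        using abs_mult[of "real n" "\<theta> - \<theta>'"] by (simp add: algebra_simps abs_minus_commute)
      also have "2 * pi * (real n * \<bar>\<theta> - \<theta>'\<bar>) \<le> 2 * pi * (N * \<bar>\<theta> - \<theta>'\<bar>)"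
        using n M by (intro mult_left_mono mult_right_mono) auto
      finally show "norm (of_real (W (real n / N)) * (ee (- (real n * \<theta>)) - ee (- (real n * \<theta>'))))
          \<le> B * (2 * pi * (N * \<bar>\<theta> - \<theta>'\<bar>))"
        unfolding norm_mult using B N by (intro mult_mono) auto
    qed
    also have "\<dots> \<le> (2 * N) * (B * (2 * pi * (N * \<bar>\<theta> - \<theta>'\<bar>)))"
      using M B N by (intro mult_right_mono) auto
    also have "\<dots> = 4 * pi * B * N ^ 2 * \<bar>\<theta> - \<theta>'\<bar>" by (simp add: power2_eq_square)
    finally show "norm (weight_sum W N \<theta> - weight_sum W N \<theta>') \<le> 4 * pi * B * N ^ 2 * \<bar>\<theta> - \<theta>'\<bar>" .
  qed
qed

text \<open>The freedom in b serves the Riemann sum below: cells of length 1 / N starting at 0 need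
  not end exactly at 1.\<close>

lemma hat_zero_eq_integral:
  assumes "bump W" "b \<ge> 1"
  shows "hat_zero W = integral {0..b} W"
proof -
  have "set_integrable lborel {0..b} W"
    unfolding set_integrable_def
    using borel_integrable_compact[of "{0..b}" W] bump_continuous[OF assms(1)]
    by (simp add: indicator_scaleR_eq_if)
  then have "(LINT t:{0..b}|lborel. W t) = integral {0..b} W"
    by (rule set_borel_integral_eq_integral(2))
  moreover have "(LINT t:{0..b}|lborel. W t) = (LINT t|lborel. W t)"
    unfolding set_lebesgue_integral_def
  proof (rule Bochner_Integration.integral_cong)
    fix t
    have "t \<in> {0..b}" if "W t \<noteq> 0"
      using assms that unfolding bump_def by (meson atLeastAtMost_iff not_le order_trans)
    then show "indicator {0..b} t *\<^sub>R W t = W t" by (auto simp: indicator_def)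
  qed simp
  ultimately show ?thesis by (simp add: hat_zero_def)
qed

text \<open>A Riemann sum of mesh 1 / N for a Lipschitz function: each of O(N) cells has error at
  most B / N after scaling by N, so the total stays bounded.\<close>

lemma weight_sum_0_approx:
  assumes "bump W"
  shows "\<exists>C \<ge> 0. \<forall>N \<ge> 1. norm (weight_sum W N 0 - of_real (N * hat_zero W)) \<le> C"
proof -
  obtain B where B: "B \<ge> 0" "\<And>t. \<bar>deriv W t\<bar> \<le> B" using bump_bounded[OF bump_deriv[OF assms]] by blast
  have sm: "smooth W" using assms by (simp add: bump_def)
  have lip: "\<bar>W x - W y\<bar> \<le> B * \<bar>x - y\<bar>" for x y
    using field_differentiable_bound[of UNIV W "deriv W" B x y] smooth_has_real_derivative[OF sm] B(2) by auto
  show ?thesis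
  proof (intro exI[of _ "2 * B"] conjI allI impI)
    show "0 \<le> 2 * B" using B by simp
    fix N :: real assume N: "1 \<le> N"
    define M where "M = nat \<lfloor>N\<rfloor>"
    have M: "real M + 1 \<le> 2 * N" "N \<le> real (Suc M)" using N unfolding M_def by linarith+
    have int: "W integrable_on {a..b}" for a b :: real
      by (rule integrable_continuous_real) (rule bump_continuous[OF assms])
    have split: "integral {0..real P / N} W = (\<Sum>n<P. integral {real n / N..real (Suc n) / N} W)" for P
    proof (induction P)
      case (Suc P)
      have "integral {0..real P / N} W + integral {real P / N..real (Suc P) / N} W = integral {0..real (Suc P) / N} W"
        by (rule Henstock_Kurzweil_Integration.integral_combine) (use N int in \<open>auto simp: divide_right_mono\<close>)
      then show ?case using Suc by simp
    qed simp
    have one: "\<bar>W (real n / N) - N * integral {real n / N..real (Suc n) / N} W\<bar> \<le> B / N" for n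
    proof -
      define a b where "a = real n / N" and "b = real (Suc n) / N"
      have ab: "b - a = 1 / N" using N by (simp add: a_def b_def field_simps)
      then have ab': "a \<le> b" using N by (smt (verit) divide_nonneg_nonneg)
      have "(W has_integral integral {a..b} W) {a..b}" using int by (rule integrable_integral)
      moreover have "((\<lambda>_. W a) has_integral (b - a) * W a) {a..b}"
        using has_integral_const_real[of "W a" a b] ab' by simp
      ultimately have "((\<lambda>t. W t - W a) has_integral (integral {a..b} W - (b - a) * W a)) {a..b}"
        by (rule has_integral_diff)
      then have "norm (integral {a..b} W - (b - a) * W a) \<le> (B / N) * measure lborel {a..b}"
      proof (rule has_integral_bound_real[where S = "{}", rotated 2])
        fix t assume "t \<in> {a..b} - {}"
        then have "\<bar>t - a\<bar> \<le> 1 / N" using ab by auto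
        then have "B * \<bar>t - a\<bar> \<le> B * (1 / N)" using B by (intro mult_left_mono) auto
        then show "norm (W t - W a) \<le> B / N" using lip[of t a] by simp
      qed (use B N ab' in auto)
      then have "N * \<bar>integral {a..b} W - W a / N\<bar> \<le> N * (B / N * (1 / N))"
        using N ab ab' by (intro mult_left_mono) auto
      moreover have "N * \<bar>integral {a..b} W - W a / N\<bar> = \<bar>W a - N * integral {a..b} W\<bar>"
      proof -
        have "N * \<bar>integral {a..b} W - W a / N\<bar> = \<bar>N * (integral {a..b} W - W a / N)\<bar>"
          using N by (simp add: abs_mult)
        also have "N * (integral {a..b} W - W a / N) = N * integral {a..b} W - W a" using N by (simp add: field_simps)
        finally show ?thesis by (simp add: abs_minus_commute)
      qed
      ultimately show ?thesis using N by (simp add: a_def b_def)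
    qed
    have "1 \<le> real (Suc M) / N" using M N by (simp add: field_simps)
    then have "N * hat_zero W = (\<Sum>n<Suc M. N * integral {real n / N..real (Suc n) / N} W)"
      using hat_zero_eq_integral[OF assms] by (simp only: split sum_distrib_left)
    moreover have "weight_sum W N 0 = of_real (\<Sum>n<Suc M. W (real n / N))"
      by (simp add: weight_sum_def M_def lessThan_Suc_atMost)
    ultimately have "norm (weight_sum W N 0 - of_real (N * hat_zero W)) =
        \<bar>\<Sum>n<Suc M. W (real n / N) - N * integral {real n / N..real (Suc n) / N} W\<bar>"
      by (simp only: sum_subtractf of_real_diff[symmetric] norm_of_real)
    also have "\<dots> \<le> (\<Sum>n<Suc M. \<bar>W (real n / N) - N * integral {real n / N..real (Suc n) / N} W\<bar>)" by (rule sum_abs)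
    also have "\<dots> \<le> real (card {..<Suc M}) * (B / N)" by (rule sum_bounded_above) (rule one)
    also have "\<dots> \<le> (2 * N) * (B / N)" using M B N by (intro mult_right_mono) auto
    also have "\<dots> = 2 * B" using N by simp
    finally show "norm (weight_sum W N 0 - of_real (N * hat_zero W)) \<le> 2 * B" .
  qed
qed

section \<open>Fourier expansion over residues\<close>

lemma ee_eq_1_imp:
  assumes "ee x = 1"
  shows "\<exists>i :: int. x = of_int i"
proof -
  have "2 * \<bar>sin (pi * x)\<bar> = norm (1 - ee x)"
    by (simp add: ee_def norm_1_minus_cis)
  then have "sin (pi * x) = 0" using assms by simp
  then obtain i :: int where "pi * x = of_int i * pi" using sin_zero_iff_int2 by blast
  then have "x = of_int i" by simp
  then show ?thesis ..
qed

lemma sum_ee_residues: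
  fixes d n r :: nat
  assumes "d > 0"
  shows "(\<Sum>h<d. ee (real h * ((real r - real n) / real d))) = (if [n = r] (mod d) then of_nat d else 0)"
proof -
  define x where "x = (real r - real n) / real d"
  have sum: "(\<Sum>h<d. ee (real h * x)) = (\<Sum>h<d. ee x ^ h)" by (simp add: ee_power)
  have xd: "real d * x = of_int (int r - int n)" using assms by (simp add: x_def)
  have "ee x ^ d = ee (of_int (int r - int n))" unfolding ee_power xd ..
  then have zd: "ee x ^ d = 1" by (simp only: ee_of_int)
  show ?thesis
  proof (cases "[n = r] (mod d)")
    case True
    then have "int d dvd int r - int n"
      by (metis cong_iff_dvd_diff cong_int_iff cong_sym)
    then obtain i where "int r - int n = int d * i" by blast
    then have "real d * x = real d * of_int i" using xd by simp
    then have "x = of_int i" using assms by simp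
    then show ?thesis using True sum by (simp add: x_def[symmetric])
  next
    case False
    have "ee x \<noteq> 1"
    proof
      assume "ee x = 1"
      then obtain i :: int where "x = of_int i" using ee_eq_1_imp by blast
      then have "real_of_int (int r - int n) = real_of_int (int d * i)" using xd by simp
      then have "int r - int n = int d * i" by (simp only: of_int_eq_iff)
      then have "[int r = int n] (mod int d)" by (simp add: cong_iff_dvd_diff)
      then show False using False by (simp add: cong_int_iff cong_sym)
    qed
    then show ?thesis using False sum zd by (simp add: x_def[symmetric] geometric_sum)
  qed
qed

lemma sum_progression_fourier:
  fixes d r :: nat
  assumes "d > 0"
  shows "(\<Sum>n | n \<le> nat \<lfloor>N\<rfloor> \<and> [n = r] (mod d). complex_of_real (W (real n / N))) =
    (\<Sum>h<d. weight_sum W N (real h / real d) * ee (real h * (real r / real d))) / of_nat d"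
proof -
  define M where "M = nat \<lfloor>N\<rfloor>"
  have "(\<Sum>h<d. weight_sum W N (real h / real d) * ee (real h * (real r / real d))) =
      (\<Sum>h<d. \<Sum>n\<le>M. of_real (W (real n / N)) * ee (real h * ((real r - real n) / real d)))"
  proof (rule sum.cong[OF refl])
    fix h
    have "ee (real h * ((real r - real n) / real d)) = ee (- (real n * (real h / real d))) * ee (real h * (real r / real d))" for n
      by (simp flip: ee_add add: diff_divide_distrib right_diff_distrib mult.commute)
    then show "weight_sum W N (real h / real d) * ee (real h * (real r / real d)) =
        (\<Sum>n\<le>M. of_real (W (real n / N)) * ee (real h * ((real r - real n) / real d)))"
      by (simp add: weight_sum_def M_def sum_distrib_right mult.assoc)
  qed
  also have "\<dots> = (\<Sum>n\<le>M. of_real (W (real n / N)) * (\<Sum>h<d. ee (real h * ((real r - real n) / real d))))"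
    by (subst sum.swap) (simp add: sum_distrib_left)
  also have "\<dots> = (\<Sum>n\<le>M. if [n = r] (mod d) then of_real (W (real n / N)) * of_nat d else 0)"
    unfolding sum_ee_residues[OF assms] by (intro sum.cong refl) simp
  also have "\<dots> = (\<Sum>n | n \<le> M \<and> [n = r] (mod d). of_real (W (real n / N)) * of_nat d)"
    by (subst sum.inter_filter[symmetric]) simp_all
  also have "\<dots> = (\<Sum>n | n \<le> M \<and> [n = r] (mod d). of_real (W (real n / N))) * of_nat d"
    by (simp add: sum_distrib_right)
  finally show ?thesis using assms by (simp add: M_def)
qed

text \<open>For m invertible modulo d the zeros n of f(m, n) are partitioned according to the
  residue v = n / m, and the factor m^k does not affect divisibility by d. Coprimality is essential
  for both points, so m sharing a factor with d have to be treated apart.\<close>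

lemma sum_over_roots_coprime:
  fixes m d M :: nat and g :: "nat \<Rightarrow> 'a :: comm_monoid_add"
  assumes f: "binary_form k f" and "coprime m d" "d > 0"
  shows "(\<Sum>v\<in>form_roots f d. \<Sum>n | n \<le> M \<and> [n = m * v] (mod d). g n) =
    (\<Sum>n | n \<le> M \<and> int d dvd form_eval f (int m) (int n). g n)"
proof -
  have key: "int d dvd form_eval f (int m) (int n) \<longleftrightarrow> int d dvd form_eval f 1 (int v)"
    if "[n = m * v] (mod d)" for n v
  proof -
    have "[form_eval f (int m) (int n) = form_eval f (int m * 1) (int m * int v)] (mod int d)"
      using that by (intro form_eval_cong[OF f]) (auto simp: cong_int_iff simp flip: of_nat_mult)
    then have "int d dvd form_eval f (int m) (int n) \<longleftrightarrow> int d dvd int m ^ k * form_eval f 1 (int v)"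
      unfolding form_eval_scale[OF f] by (metis cong_0_iff cong_sym cong_trans)
    also have "\<dots> \<longleftrightarrow> int d dvd form_eval f 1 (int v)"
      using assms(2) by (intro coprime_dvd_mult_right_iff) (simp add: coprime_commute)
    finally show ?thesis .
  qed
  have "(\<Sum>n | n \<le> M \<and> int d dvd form_eval f (int m) (int n). g n) =
      (\<Sum>n\<in>(\<Union>v\<in>form_roots f d. {n. n \<le> M \<and> [n = m * v] (mod d)}). g n)"
  proof (rule sum.cong[OF _ refl], intro equalityI subsetI)
    fix n assume n: "n \<in> {n. n \<le> M \<and> int d dvd form_eval f (int m) (int n)}"
    obtain y where "[m * y = 1] (mod d)" using cong_solve_coprime_nat[OF assms(2)] by auto
    then have "[m * y * n = 1 * n] (mod d)" by (rule cong_mult) simp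
    define v where "v = (y * n) mod d"
    have "[m * v = m * (y * n)] (mod d)" by (simp add: v_def cong_def mod_mult_right_eq)
    then have nv: "[n = m * v] (mod d)"
      using \<open>[m * y * n = 1 * n] (mod d)\<close> by (simp add: cong_def mult.assoc)
    have "v \<in> form_roots f d"
      using key[OF nv] n assms(3) by (simp add: form_roots_def v_def)
    then show "n \<in> (\<Union>v\<in>form_roots f d. {n. n \<le> M \<and> [n = m * v] (mod d)})" using n nv by auto
  next
    fix n assume "n \<in> (\<Union>v\<in>form_roots f d. {n. n \<le> M \<and> [n = m * v] (mod d)})"
    then show "n \<in> {n. n \<le> M \<and> int d dvd form_eval f (int m) (int n)}"
      using key by (auto simp: form_roots_def)
  qed
  also have "\<dots> = (\<Sum>v\<in>form_roots f d. \<Sum>n | n \<le> M \<and> [n = m * v] (mod d). g n)"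
  proof (rule sum.UNION_disjoint)
    show "\<forall>v\<in>form_roots f d. \<forall>w\<in>form_roots f d. v \<noteq> w \<longrightarrow>
        {n. n \<le> M \<and> [n = m * v] (mod d)} \<inter> {n. n \<le> M \<and> [n = m * w] (mod d)} = {}"
    proof (intro ballI impI equals0I)
      fix v w n assume vw: "v \<in> form_roots f d" "w \<in> form_roots f d" "v \<noteq> w"
        and "n \<in> {n. n \<le> M \<and> [n = m * v] (mod d)} \<inter> {n. n \<le> M \<and> [n = m * w] (mod d)}"
      then have "[m * v = m * w] (mod d)" by (auto simp: cong_def)
      then have "[v = w] (mod d)" using assms(2) by (simp add: cong_mult_lcancel_nat)
      then show False using vw by (auto simp: cong_def form_roots_def)
    qed
  qed auto
  finally show ?thesis ..
qed

text \<open>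
  Agrees with \<open>A_sum\<close> on the \<open>m\<close> coprime to \<open>d\<close>. Keeping the other \<open>m\<close> in makes the Fourier expansion
  uniform in \<open>m\<close>, with frequency \<open>0\<close> contributing the full sum of the coefficients.
\<close>

definition root_model ::
  "int poly poly \<Rightarrow> (real \<Rightarrow> real) \<Rightarrow> nat \<Rightarrow> real \<Rightarrow> (nat \<Rightarrow> complex) \<Rightarrow> complex" where
  "root_model f W d N \<alpha> = (\<Sum>m = 1..nat \<lfloor>N\<rfloor>. \<alpha> m *
     (\<Sum>v\<in>form_roots f d. \<Sum>n | n \<le> nat \<lfloor>N\<rfloor> \<and> [n = m * v] (mod d). of_real (W (real n / N))))"

definition twisted_sum :: "(nat \<Rightarrow> complex) \<Rightarrow> nat \<Rightarrow> real \<Rightarrow> complex" where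
  "twisted_sum \<alpha> M x = (\<Sum>m = 1..M. \<alpha> m * ee (real m * x))"

lemma root_model_fourier:
  assumes "d > 0"
  shows "root_model f W d N \<alpha> = (\<Sum>v\<in>form_roots f d.
    (\<Sum>h<d. weight_sum W N (real h / real d) * twisted_sum \<alpha> (nat \<lfloor>N\<rfloor>) (real h * (real v / real d))) / of_nat d)"
proof -
  define M where "M = nat \<lfloor>N\<rfloor>"
  have "root_model f W d N \<alpha> = (\<Sum>m = 1..M. \<alpha> m * (\<Sum>v\<in>form_roots f d.
      (\<Sum>h<d. weight_sum W N (real h / real d) * ee (real m * (real h * (real v / real d)))) / of_nat d))"
    unfolding root_model_def sum_progression_fourier[OF assms] M_def
    by (simp add: mult_ac)
  also have "\<dots> = (\<Sum>m = 1..M. \<Sum>v\<in>form_roots f d. \<Sum>h<d.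
      weight_sum W N (real h / real d) * (\<alpha> m * ee (real m * (real h * (real v / real d)))) / of_nat d)"
    by (simp add: sum_distrib_left sum_divide_distrib mult_ac)
  also have "\<dots> = (\<Sum>v\<in>form_roots f d. \<Sum>m = 1..M. \<Sum>h<d.
      weight_sum W N (real h / real d) * (\<alpha> m * ee (real m * (real h * (real v / real d)))) / of_nat d)"
    by (rule sum.swap)
  also have "\<dots> = (\<Sum>v\<in>form_roots f d. \<Sum>h<d. \<Sum>m = 1..M.
      weight_sum W N (real h / real d) * (\<alpha> m * ee (real m * (real h * (real v / real d)))) / of_nat d)"
    by (intro sum.cong refl sum.swap)
  also have "\<dots> = (\<Sum>v\<in>form_roots f d.
    (\<Sum>h<d. weight_sum W N (real h / real d) * twisted_sum \<alpha> M (real h * (real v / real d))) / of_nat d)"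
    by (simp add: twisted_sum_def sum_distrib_left sum_divide_distrib)
  finally show ?thesis by (simp add: M_def)
qed

section \<open>Comparison of the arithmetic sum with the model\<close>

lemma A_sum_eq_finite_sum:
  assumes "bump W" "N \<ge> 1"
  shows "A_sum f W d N \<alpha> = (\<Sum>m = 1..nat \<lfloor>N\<rfloor>. \<alpha> m *
    (\<Sum>n | n \<le> nat \<lfloor>N\<rfloor> \<and> int d dvd form_eval f (int m) (int n). of_real (W (real n / N))))"
proof -
  define M where "M = nat \<lfloor>N\<rfloor>"
  define S where "S = {(m :: nat, n :: int). 0 < m \<and> real m \<le> N \<and> [form_eval f (int m) n = 0] (mod int d)}"
  define T where "T = Sigma {1..M} (\<lambda>m. {n. n \<le> M \<and> int d dvd form_eval f (int m) (int n)})"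
  define g where "g = (\<lambda>(m, n). \<alpha> m * complex_of_real (W (real_of_int n / N)))"
  define \<phi> where "\<phi> = (\<lambda>(m :: nat, n :: nat). (m, int n))"
  have mM: "real m \<le> N \<longleftrightarrow> m \<le> M" for m using assms(2) by (simp add: M_def le_nat_floor le_nat_iff le_floor_iff)
  have "finite T" unfolding T_def by auto
  have sub: "\<phi> ` T \<subseteq> S"
    by (auto simp: \<phi>_def T_def S_def mM cong_0_iff)
  have "A_sum f W d N \<alpha> = infsum g S" by (simp add: A_sum_def g_def S_def)
  also have "\<dots> = infsum g (\<phi> ` T)"
  proof (rule infsum_cong_neutral)
    fix p assume p: "p \<in> S - \<phi> ` T"
    obtain m n where mn: "p = (m, n)" by fastforce
    have mS: "0 < m" "m \<le> M" "int d dvd form_eval f (int m) n"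
      using p by (auto simp: mn S_def mM cong_0_iff)
    have "n < 0 \<or> N < real_of_int n"
    proof (rule ccontr)
      assume "\<not> (n < 0 \<or> N < real_of_int n)"
      then have n: "0 \<le> n" "real (nat n) \<le> N" by auto
      then have "(m, nat n) \<in> T" using mS mM[of "nat n"] by (auto simp: T_def)
      moreover have "\<phi> (m, nat n) = p" using n by (simp add: \<phi>_def mn)
      ultimately show False using p by blast
    qed
    then have "real_of_int n / N < 0 \<or> 1 < real_of_int n / N"
      using assms(2) by (auto simp: field_simps)
    then show "g p = 0" using assms(1) by (auto simp: g_def mn bump_def)
  qed (use sub in auto)
  also have "\<dots> = sum g (\<phi> ` T)" by (rule infsum_finite) (use \<open>finite T\<close> in simp)
  also have "\<dots> = sum (g \<circ> \<phi>) T" by (rule sum.reindex) (auto simp: inj_on_def \<phi>_def)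
  also have "\<dots> = (\<Sum>(m, n)\<in>T. \<alpha> m * of_real (W (real n / N)))"
    by (intro sum.cong refl) (auto simp: g_def \<phi>_def)
  also have "\<dots> = (\<Sum>m = 1..M. \<Sum>n | n \<le> M \<and> int d dvd form_eval f (int m) (int n). \<alpha> m * of_real (W (real n / N)))"
    unfolding T_def by (rule sum.Sigma[symmetric]) auto
  finally show ?thesis by (simp add: M_def sum_distrib_left)
qed

lemma card_progression_le:
  fixes d r M :: nat
  assumes "d > 0"
  shows "card {n. n \<le> M \<and> [n = r] (mod d)} \<le> M div d + 1"
proof -
  have "inj_on (\<lambda>n. n div d) {n. n \<le> M \<and> [n = r] (mod d)}"
    by (rule inj_onI) (metis (mono_tags, lifting) cong_def div_mult_mod_eq mem_Collect_eq)
  then have "card {n. n \<le> M \<and> [n = r] (mod d)} \<le> card {..M div d}"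
    by (rule card_inj_on_le) (auto intro: div_le_mono)
  then show ?thesis by simp
qed

text \<open>Since \<alpha> lives on primes, m is coprime to d unless it is a prime divisor of d, and
  for coprime m both sides agree term by term. For the exceptional m both inner sums are bounded
  trivially, each residue class having at most N / d + 1 members.\<close>

lemma A_sum_root_model_diff_le:
  assumes f: "binary_form k f" and W: "bump W" "\<And>t. \<bar>W t\<bar> \<le> B" and "N \<ge> 1" "d > 0"
    and \<alpha>: "\<And>m. norm (\<alpha> m) \<le> 1" "\<And>m. \<alpha> m \<noteq> 0 \<Longrightarrow> prime m"
  shows "norm (A_sum f W d N \<alpha> - root_model f W d N \<alpha>) \<le>
    B * (\<Sum>m | m \<in> {1..nat \<lfloor>N\<rfloor>} \<and> prime m \<and> m dvd d.
          real (card {n. n \<le> nat \<lfloor>N\<rfloor> \<and> int d dvd form_eval f (int m) (int n)})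
          + real (card (form_roots f d)) * (N / real d + 1))"
proof -
  define M where "M = nat \<lfloor>N\<rfloor>"
  define w where "w n = complex_of_real (W (real n / N))" for n :: nat
  define a b where "a m = (\<Sum>n | n \<le> M \<and> int d dvd form_eval f (int m) (int n). w n)"
    and "b m = (\<Sum>v\<in>form_roots f d. \<Sum>n | n \<le> M \<and> [n = m * v] (mod d). w n)" for m :: nat
  have w: "norm (w n) \<le> B" for n using W(2) by (simp add: w_def)
  have B: "B \<ge> 0" using W(2)[of 0] by linarith
  have "A_sum f W d N \<alpha> - root_model f W d N \<alpha> = (\<Sum>m = 1..M. \<alpha> m * (a m - b m))"
    unfolding A_sum_eq_finite_sum[OF W(1) \<open>N \<ge> 1\<close>] root_model_def
    by (simp add: M_def a_def b_def w_def right_diff_distrib sum_subtractf)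
  also have "\<dots> = (\<Sum>m | m \<in> {1..M} \<and> prime m \<and> m dvd d. \<alpha> m * (a m - b m))"
  proof (rule sum.mono_neutral_right)
    show "\<forall>m\<in>{1..M} - {m. m \<in> {1..M} \<and> prime m \<and> m dvd d}. \<alpha> m * (a m - b m) = 0"
    proof
      fix m assume m: "m \<in> {1..M} - {m. m \<in> {1..M} \<and> prime m \<and> m dvd d}"
      show "\<alpha> m * (a m - b m) = 0"
      proof (cases "\<alpha> m = 0")
        case False
        then have "coprime m d" using \<alpha>(2) m prime_imp_coprime by auto
        then have "a m = b m" unfolding a_def b_def
          by (rule sum_over_roots_coprime[OF f _ \<open>d > 0\<close>, symmetric])
        then show ?thesis by simp
      qed simp
    qed
  qed auto
  finally have eq: "A_sum f W d N \<alpha> - root_model f W d N \<alpha> =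
      (\<Sum>m | m \<in> {1..M} \<and> prime m \<and> m dvd d. \<alpha> m * (a m - b m))" .
  have "norm (A_sum f W d N \<alpha> - root_model f W d N \<alpha>) \<le> (\<Sum>m | m \<in> {1..M} \<and> prime m \<and> m dvd d.
      B * (real (card {n. n \<le> M \<and> int d dvd form_eval f (int m) (int n)})
          + real (card (form_roots f d)) * (N / real d + 1)))"
    unfolding eq
  proof (rule sum_norm_le)
    fix m
    have "norm (a m) \<le> real (card {n. n \<le> M \<and> int d dvd form_eval f (int m) (int n)}) * B"
      unfolding a_def using w sum_norm_bound[of _ w B] by blast
    moreover have "norm (b m) \<le> real (card (form_roots f d)) * ((N / real d + 1) * B)"
      unfolding b_def
    proof (rule sum_norm_bound)
      fix v
      have "norm (\<Sum>n | n \<le> M \<and> [n = m * v] (mod d). w n) \<le> real (card {n. n \<le> M \<and> [n = m * v] (mod d)}) * B"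
        using w sum_norm_bound[of _ w B] by blast
      also have "\<dots> \<le> (N / real d + 1) * B"
      proof (rule mult_right_mono[OF _ B])
        have "real (card {n. n \<le> M \<and> [n = m * v] (mod d)}) \<le> real (M div d + 1)"
          using card_progression_le[OF \<open>d > 0\<close>] of_nat_mono by blast
        also have "\<dots> \<le> real M / real d + 1" using of_nat_div_le_of_nat[of M d] by simp
        also have "\<dots> \<le> N / real d + 1" using \<open>N \<ge> 1\<close> by (simp add: M_def divide_right_mono)
        finally show "real (card {n. n \<le> M \<and> [n = m * v] (mod d)}) \<le> N / real d + 1" .
      qed
      finally show "norm (\<Sum>n | n \<le> M \<and> [n = m * v] (mod d). w n) \<le> (N / real d + 1) * B" .
    qed
    moreover have "norm (\<alpha> m * (a m - b m)) \<le> 1 * (norm (a m) + norm (b m))"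
      unfolding norm_mult using \<alpha>(1) by (intro mult_mono norm_triangle_ineq4) auto
    ultimately show "norm (\<alpha> m * (a m - b m)) \<le> B * (real (card {n. n \<le> M \<and> int d dvd form_eval f (int m) (int n)})
          + real (card (form_roots f d)) * (N / real d + 1))"
      by (simp add: algebra_simps)
  qed
  then show ?thesis unfolding M_def sum_distrib_left .
qed

section \<open>Prime values dividing the modulus\<close>

lemma powr_le_of_le_powr:
  fixes D N t x :: real
  assumes "1 \<le> D" "D \<le> N powr t" "x \<ge> 0"
  shows "D powr x \<le> N powr (t * x)"
proof -
  have "D powr x \<le> (N powr t) powr x" using assms by (intro powr_mono2) auto
  then show ?thesis by (simp add: powr_powr)
qed

text \<open>If a prime m divides d and d | f(m, n), reduction modulo m gives m | n^k f(0, 1). So n =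
  0, or m is one of the few divisors of n f(0, 1): O(N^(1 + \<epsilon>)) pairs (m, n), each with
  O(N^\<epsilon>) moduli. D is unrestricted because d is counted only as a divisor.\<close>

lemma prime_divisor_incidences_le:
  fixes \<epsilon> :: real
  assumes f: "binary_form k f" "k \<ge> 2" "irreducible f" and "\<epsilon> > 0"
  shows "\<exists>C \<ge> 0. \<forall>N \<ge> 1. \<forall>D.
    (\<Sum>d\<in>dyadic D. \<Sum>m | m \<in> {1..nat \<lfloor>N\<rfloor>} \<and> prime m \<and> m dvd d.
       real (card {n. n \<le> nat \<lfloor>N\<rfloor> \<and> int d dvd form_eval f (int m) (int n)})) \<le> C * N powr (1 + 2 * \<epsilon>)"
proof -
  obtain C1 where C1: "C1 \<ge> 1" "\<And>n. n > 0 \<Longrightarrow> real (card {d :: nat. d dvd n}) \<le> C1 * real n powr \<epsilon>"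
    using divisor_bound[OF assms(4)] by blast
  obtain C2 where C2: "C2 \<ge> 1" "\<And>a b B. B \<ge> 1 \<Longrightarrow> \<bar>real_of_int a\<bar> \<le> B \<Longrightarrow> \<bar>real_of_int b\<bar> \<le> B \<Longrightarrow> a \<noteq> 0 \<or> b \<noteq> 0 \<Longrightarrow>
      finite {d :: nat. int d dvd form_eval f a b} \<and>
      real (card {d :: nat. int d dvd form_eval f a b}) \<le> C2 * B powr \<epsilon>"
    using form_divisor_bound[OF assms] by metis
  define c where "c = nat \<bar>form_eval f 0 1\<bar>"
  have c: "c > 0" using form_eval_nonzero[OF f, of 0 1] by (simp add: c_def)
  show ?thesis
  proof (intro exI[of _ "(1 + C1 * real c powr \<epsilon>) * C2"] conjI allI impI)
    show "0 \<le> (1 + C1 * real c powr \<epsilon>) * C2" using C1 C2 by simp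
    fix N D :: real assume N: "1 \<le> N"
    define M where "M = nat \<lfloor>N\<rfloor>"
    have M: "real M \<le> N" using N by (simp add: M_def)
    define S' where "S' = ({0} \<times> {1..M}) \<union> Sigma {1..M} (\<lambda>n. {m. m dvd n * c})"
    define S where "S = (\<lambda>(n, m). (int m, int n)) ` {p \<in> S'. snd p \<in> {1..M}}"
    define T where "T = Sigma S (\<lambda>(a, b). {d :: nat. int d dvd form_eval f a b})"
    define P where "P d = {m. m \<in> {1..M} \<and> prime m \<and> m dvd d}" for d
    define Q where "Q d m = {n. n \<le> M \<and> int d dvd form_eval f (int m) (int n)}" for d m
    define U where "U = Sigma (Sigma (dyadic D) P) (\<lambda>(d, m). Q d m)"
    have finS': "finite S'" using c by (auto simp: S'_def)
    have finS: "finite S" using finS' by (simp add: S_def)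
    have N0: "N powr \<epsilon> \<ge> 1" using N assms(4) by (intro ge_one_powr_ge_zero) auto
    have cardS': "real (card S') \<le> N * ((1 + C1 * real c powr \<epsilon>) * N powr \<epsilon>)"
    proof -
      have "card S' \<le> card ({0::nat} \<times> {1..M}) + card (Sigma {1..M} (\<lambda>n. {m. m dvd n * c}))"
        unfolding S'_def by (rule card_Un_le)
      also have "\<dots> = M + (\<Sum>n = 1..M. card {m. m dvd n * c})"
        using c by (simp add: card_cartesian_product card_SigmaI)
      finally have "real (card S') \<le> real (M + (\<Sum>n = 1..M. card {m. m dvd n * c}))"
        by (rule of_nat_mono)
      also have "\<dots> = real M + (\<Sum>n = 1..M. real (card {m. m dvd n * c}))" by simp
      also have "\<dots> \<le> real M + real (card {1..M}) * (C1 * (N * real c) powr \<epsilon>)"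
      proof (rule add_left_mono)
        show "(\<Sum>n = 1..M. real (card {m. m dvd n * c})) \<le> real (card {1..M}) * (C1 * (N * real c) powr \<epsilon>)"
        proof (rule sum_bounded_above)
          fix n assume n: "n \<in> {1..M}"
          then have nN: "real n \<le> N" using M by (meson atLeastAtMost_iff of_nat_mono order_trans)
          have "real (card {m. m dvd n * c}) \<le> C1 * real (n * c) powr \<epsilon>" using C1(2)[of "n * c"] n c by simp
          also have "\<dots> \<le> C1 * (N * real c) powr \<epsilon>"
            using C1(1) assms(4) nN by (intro mult_left_mono powr_mono2) (auto intro: mult_right_mono)
          finally show "real (card {m. m dvd n * c}) \<le> C1 * (N * real c) powr \<epsilon>" .
        qed
      qed
      also have "\<dots> = real M * (1 + C1 * (real c powr \<epsilon> * N powr \<epsilon>))"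
        using N by (simp add: powr_mult algebra_simps)
      also have "\<dots> \<le> N * ((1 + C1 * real c powr \<epsilon>) * N powr \<epsilon>)"
        using M N N0 C1(1) by (intro mult_mono) (auto simp: algebra_simps)
      finally show ?thesis by simp
    qed
    have "card S \<le> card {p \<in> S'. snd p \<in> {1..M}}" unfolding S_def using finS' by (intro card_image_le) simp
    also have "\<dots> \<le> card S'" using finS' by (intro card_mono) auto
    finally have cardS: "real (card S) \<le> N * ((1 + C1 * real c powr \<epsilon>) * N powr \<epsilon>)" using cardS' by simp
    have finT: "finite T" and cardT: "real (card T) \<le> real (card S) * (C2 * N powr \<epsilon>)"
    proof -
      have *: "\<bar>real_of_int x\<bar> \<le> N \<and> \<bar>real_of_int y\<bar> \<le> N \<and> (x \<noteq> 0 \<or> y \<noteq> 0)" if xy: "(x, y) \<in> S" for x y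
      proof -
        obtain p where p: "p \<in> S'" "snd p \<in> {1..M}" "(x, y) = (int (snd p), int (fst p))"
          using xy unfolding S_def by (auto simp: case_prod_unfold)
        define n m where "n = fst p" and "m = snd p"
        have nm: "x = int m" "y = int n" "1 \<le> m" "m \<le> M" "n \<le> M"
          using p unfolding n_def m_def by (auto simp: S'_def)
        then have "real m \<le> real M" "real n \<le> real M" by simp_all
        then show ?thesis using M nm by auto
      qed
      show "finite T" unfolding T_def
        by (rule sum_card_divisors_le(1)[OF finS N C2(2)[OF N] *])
      show "real (card T) \<le> real (card S) * (C2 * N powr \<epsilon>)" unfolding T_def
        by (rule sum_card_divisors_le(2)[OF finS N C2(2)[OF N] *])
    qed
    define \<phi> where "\<phi> = (\<lambda>((d :: nat, m), n). ((int m, int n), d))"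
    have "\<phi> ` U \<subseteq> T"
    proof (rule image_subsetI)
      fix u assume u: "u \<in> U"
      define d m n where "d = fst (fst u)" and "m = snd (fst u)" and "n = snd u"
      have \<phi>u: "\<phi> u = ((int m, int n), d)" by (simp add: \<phi>_def d_def m_def n_def case_prod_unfold)
      have m: "1 \<le> m" "m \<le> M" "prime m" "m dvd d" and n: "n \<le> M"
        and dvd: "int d dvd form_eval f (int m) (int n)"
        using u by (auto simp: U_def P_def Q_def d_def m_def n_def)
      have "(n, m) \<in> S'"
      proof (cases "n = 0")
        case False
        have "[form_eval f (int m) (int n) = form_eval f (int n * 0) (int n * 1)] (mod int m)"
          by (intro form_eval_cong[OF f(1)]) (auto simp: cong_0_iff)
        moreover have "int m dvd form_eval f (int m) (int n)"
          using dvd m(4) by (meson dvd_trans int_dvd_int_iff)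
        ultimately have "int m dvd int n ^ k * form_eval f 0 1"
          unfolding form_eval_scale[OF f(1)] by (metis cong_0_iff cong_sym cong_trans)
        moreover have pm: "prime (int m)" using m(3) by simp
        ultimately have "int m dvd int n \<or> int m dvd form_eval f 0 1"
          using prime_dvd_mult_iff prime_dvd_power by blast
        then have "m dvd n \<or> m dvd c" unfolding c_def by (auto simp flip: int_dvd_int_iff)
        then have "m dvd n * c" by auto
        then show ?thesis using False n by (auto simp: S'_def)
      qed (use m in \<open>auto simp: S'_def\<close>)
      then have "(int m, int n) \<in> S"
        using m unfolding S_def by (intro image_eqI[of _ _ "(n, m)"]) auto
      then show "\<phi> u \<in> T" using dvd by (simp add: \<phi>u T_def)
    qed
    moreover have "inj_on \<phi> U" by (auto simp: inj_on_def \<phi>_def)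
    ultimately have "card U \<le> card T" using finT by (meson card_inj_on_le)
    moreover have "real (card U) = (\<Sum>d\<in>dyadic D. \<Sum>m\<in>P d. real (card (Q d m)))"
    proof -
      have finP: "finite (P d)" for d by (simp add: P_def)
      have finQ: "finite (Q d m)" for d m by (simp add: Q_def)
      have "card U = (\<Sum>p\<in>Sigma (dyadic D) P. card (case p of (d, m) \<Rightarrow> Q d m))"
        unfolding U_def by (rule card_SigmaI) (use finP finQ in auto)
      also have "\<dots> = (\<Sum>(d, m)\<in>Sigma (dyadic D) P. card (Q d m))"
        by (simp add: case_prod_unfold)
      also have "\<dots> = (\<Sum>d\<in>dyadic D. \<Sum>m\<in>P d. card (Q d m))"
        by (rule sum.Sigma[symmetric]) (use finP in auto)
      finally show ?thesis by simp
    qed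
    ultimately have "(\<Sum>d\<in>dyadic D. \<Sum>m\<in>P d. real (card (Q d m))) \<le> real (card S) * (C2 * N powr \<epsilon>)"
      using cardT by linarith
    also have "\<dots> \<le> (N * ((1 + C1 * real c powr \<epsilon>) * N powr \<epsilon>)) * (C2 * N powr \<epsilon>)"
      using cardS C2(1) by (intro mult_right_mono) auto
    also have "\<dots> = (1 + C1 * real c powr \<epsilon>) * C2 * (N powr 1 * (N powr \<epsilon> * N powr \<epsilon>))"
      using N by simp
    also have "\<dots> = (1 + C1 * real c powr \<epsilon>) * C2 * N powr (1 + 2 * \<epsilon>)"
      by (simp only: powr_add[symmetric]) simp
    finally show "(\<Sum>d\<in>dyadic D. \<Sum>m | m \<in> {1..nat \<lfloor>N\<rfloor>} \<and> prime m \<and> m dvd d.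
       real (card {n. n \<le> nat \<lfloor>N\<rfloor> \<and> int d dvd form_eval f (int m) (int n)}))
       \<le> (1 + C1 * real c powr \<epsilon>) * C2 * N powr (1 + 2 * \<epsilon>)"
      by (simp add: P_def Q_def M_def)
  qed
qed

text \<open>The trivial bound for the model costs the number of prime divisors times N / D + 1 times
  the number of roots, about N + D, hence N^(4/3) up to \<epsilon>. The exponent 3/2 is a convenient
  value below 2 that covers the secondary errors.\<close>

lemma sum_A_sum_root_model_diff_le:
  fixes \<epsilon> :: real
  assumes f: "binary_form k f" "k \<ge> 2" "irreducible f" and W: "bump W" and "\<epsilon> > 0"
  shows "\<exists>C \<ge> 0. \<forall>N D (\<alpha> :: nat \<Rightarrow> complex). N \<ge> 1 \<and> 1 \<le> D \<and> D \<le> N powr (4 / 3) \<and>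
      (\<forall>m. norm (\<alpha> m) \<le> 1) \<and> (\<forall>m. \<alpha> m \<noteq> 0 \<longrightarrow> prime m) \<longrightarrow>
    (\<Sum>d\<in>dyadic D. norm (A_sum f W d N \<alpha> - root_model f W d N \<alpha>)) \<le> C * N powr (3 / 2 + 4 * \<epsilon>)"
proof -
  obtain C1 where C1: "C1 \<ge> 0" "\<And>N D. N \<ge> 1 \<Longrightarrow>
    (\<Sum>d\<in>dyadic D. \<Sum>m | m \<in> {1..nat \<lfloor>N\<rfloor>} \<and> prime m \<and> m dvd d.
       real (card {n. n \<le> nat \<lfloor>N\<rfloor> \<and> int d dvd form_eval f (int m) (int n)})) \<le> C1 * N powr (1 + 2 * \<epsilon>)"
    using prime_divisor_incidences_le[OF f assms(5)] by blast
  obtain C2 where C2: "C2 \<ge> 1" "\<And>n. n > 0 \<Longrightarrow> real (card {d :: nat. d dvd n}) \<le> C2 * real n powr \<epsilon>"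
    using divisor_bound[OF assms(5)] by blast
  obtain C3 where C3: "C3 \<ge> 1" "\<And>D. D \<ge> 1 \<Longrightarrow> real (card (root_pairs f D)) \<le> C3 * D powr (1 + \<epsilon>)"
    using card_root_pairs_le[OF f assms(5)] by blast
  obtain B where B: "B \<ge> 0" "\<And>t. \<bar>W t\<bar> \<le> B" using bump_bounded[OF W] by blast
  define C4 where "C4 = C2 * 2 powr \<epsilon> * C3"
  have C4: "C4 \<ge> 0" using C2 C3 by (simp add: C4_def)
  show ?thesis
  proof (intro exI[of _ "B * (C1 + C4 * 2)"] conjI allI impI)
    show "0 \<le> B * (C1 + C4 * 2)" using B C1 C4 by simp
    fix N D :: real and \<alpha> :: "nat \<Rightarrow> complex"
    assume "N \<ge> 1 \<and> 1 \<le> D \<and> D \<le> N powr (4 / 3) \<and>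
      (\<forall>m. norm (\<alpha> m) \<le> 1) \<and> (\<forall>m. \<alpha> m \<noteq> 0 \<longrightarrow> prime m)"
    then have N: "N \<ge> 1" and D: "1 \<le> D" "D \<le> N powr (4 / 3)"
      and \<alpha>: "\<And>m. norm (\<alpha> m) \<le> 1" "\<And>m. \<alpha> m \<noteq> 0 \<Longrightarrow> prime m" by auto
    define P where "P d = {m. m \<in> {1..nat \<lfloor>N\<rfloor>} \<and> prime m \<and> m dvd d}" for d
    define q where "q d m = real (card {n. n \<le> nat \<lfloor>N\<rfloor> \<and> int d dvd form_eval f (int m) (int n)})" for d m
    define r where "r d = real (card (form_roots f d))" for d
    have d0: "d > 0" "D \<le> real d" "real d < 2 * D" if "d \<in> dyadic D" for d
      using that D(1) by (auto simp: dyadic_def)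
    have "(\<Sum>d\<in>dyadic D. norm (A_sum f W d N \<alpha> - root_model f W d N \<alpha>)) \<le>
        (\<Sum>d\<in>dyadic D. B * (\<Sum>m\<in>P d. q d m + r d * (N / real d + 1)))"
      unfolding P_def q_def r_def
      by (intro sum_mono A_sum_root_model_diff_le[OF f(1) W B(2) N _ \<alpha>]) (use d0 in auto)
    also have "\<dots> = B * ((\<Sum>d\<in>dyadic D. \<Sum>m\<in>P d. q d m) + (\<Sum>d\<in>dyadic D. real (card (P d)) * (r d * (N / real d + 1))))"
      by (simp add: sum.distrib sum_distrib_left algebra_simps)
    also have "\<dots> \<le> B * (C1 * N powr (3 / 2 + 4 * \<epsilon>) + C4 * 2 * N powr (3 / 2 + 4 * \<epsilon>))"
    proof (intro mult_left_mono add_mono)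
      have "(\<Sum>d\<in>dyadic D. \<Sum>m\<in>P d. q d m) \<le> C1 * N powr (1 + 2 * \<epsilon>)"
        unfolding P_def q_def by (rule C1(2)[OF N])
      also have "\<dots> \<le> C1 * N powr (3 / 2 + 4 * \<epsilon>)"
        using C1(1) N assms(5) by (intro mult_left_mono powr_mono) auto
      finally show "(\<Sum>d\<in>dyadic D. \<Sum>m\<in>P d. q d m) \<le> C1 * N powr (3 / 2 + 4 * \<epsilon>)" .
      have "(\<Sum>d\<in>dyadic D. real (card (P d)) * (r d * (N / real d + 1))) \<le>
          (\<Sum>d\<in>dyadic D. (C2 * (2 * D) powr \<epsilon>) * (r d * (N / D + 1)))"
      proof (intro sum_mono mult_mono add_mono)
        fix d assume d: "d \<in> dyadic D"
        have "card (P d) \<le> card {e. e dvd d}" using d0[OF d] by (intro card_mono) (auto simp: P_def)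
        then have "real (card (P d)) \<le> real (card {e. e dvd d})" by simp
        also have "\<dots> \<le> C2 * real d powr \<epsilon>" using C2(2) d0[OF d] by blast
        also have "\<dots> \<le> C2 * (2 * D) powr \<epsilon>"
          using C2(1) d0[OF d] assms(5) by (intro mult_left_mono powr_mono2) auto
        finally show "real (card (P d)) \<le> C2 * (2 * D) powr \<epsilon>" .
        show "N / real d \<le> N / D" using d0[OF d] N D by (intro divide_left_mono) auto
      qed (use N C2 in \<open>auto simp: r_def\<close>)
      also have "\<dots> = (\<Sum>d\<in>dyadic D. (C2 * (2 * D) powr \<epsilon>) * (N / D + 1) * r d)"
        by (simp add: mult_ac)
      also have "\<dots> = (C2 * (2 * D) powr \<epsilon>) * (N / D + 1) * (\<Sum>d\<in>dyadic D. r d)"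
        by (rule sum_distrib_left[symmetric])
      also have "(\<Sum>d\<in>dyadic D. r d) = real (card (root_pairs f D))"
        by (simp add: r_def root_pairs_def card_SigmaI)
      also have "(C2 * (2 * D) powr \<epsilon>) * (N / D + 1) * real (card (root_pairs f D)) \<le>
          (C2 * (2 * D) powr \<epsilon>) * (N / D + 1) * (C3 * D powr (1 + \<epsilon>))"
        using C3(2)[OF D(1)] C2(1) N D by (intro mult_left_mono) auto
      also have "\<dots> = C4 * ((N / D + 1) * D * (D powr \<epsilon> * D powr \<epsilon>))"
        using D by (simp add: C4_def powr_mult powr_add)
      also have "\<dots> = C4 * ((N + D) * D powr (2 * \<epsilon>))"
        using D by (simp add: field_simps flip: powr_add)
      also have "\<dots> \<le> C4 * ((N powr (4 / 3) + N powr (4 / 3)) * N powr (4 / 3 * (2 * \<epsilon>)))"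
      proof (intro mult_left_mono mult_mono add_mono powr_le_of_le_powr D C4)
        show "N \<le> N powr (4 / 3)" using powr_mono[of 1 "4 / 3" N] N by simp
      qed (use assms(5) in auto)
      also have "\<dots> = C4 * 2 * N powr (4 / 3 + 4 / 3 * (2 * \<epsilon>))" by (simp add: powr_add)
      also have "\<dots> \<le> C4 * 2 * N powr (3 / 2 + 4 * \<epsilon>)"
        using C4 N assms(5) by (intro mult_left_mono powr_mono) auto
      finally show "(\<Sum>d\<in>dyadic D. real (card (P d)) * (r d * (N / real d + 1))) \<le> C4 * 2 * N powr (3 / 2 + 4 * \<epsilon>)" .
    qed (use B in auto)
    finally show "(\<Sum>d\<in>dyadic D. norm (A_sum f W d N \<alpha> - root_model f W d N \<alpha>)) \<le>
        B * (C1 + C4 * 2) * N powr (3 / 2 + 4 * \<epsilon>)"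
      by (simp add: algebra_simps)
  qed
qed

section \<open>Low and high frequencies\<close>

lemma abel_summation:
  fixes s t :: "nat \<Rightarrow> complex"
  shows "(\<Sum>h = 1..H. s h * t h) =
    s H * (\<Sum>i = 1..H. t i) + (\<Sum>h<H. (s h - s (Suc h)) * (\<Sum>i = 1..h. t i))"
proof (induction H)
  case (Suc H)
  define A where "A = (\<Sum>i = 1..H. t i)"
  define B where "B = (\<Sum>h<H. (s h - s (Suc h)) * (\<Sum>i = 1..h. t i))"
  have "(\<Sum>h = 1..Suc H. s h * t h) = (s H * A + B) + s (Suc H) * t (Suc H)"
    using Suc.IH by (simp add: A_def B_def)
  moreover have "(\<Sum>i = 1..Suc H. t i) = A + t (Suc H)" by (simp add: A_def)
  moreover have "(\<Sum>h<Suc H. (s h - s (Suc h)) * (\<Sum>i = 1..h. t i)) = B + (s H - s (Suc H)) * A"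
    unfolding A_def B_def by (rule sum.lessThan_Suc)
  moreover have "s H * A + B + s (Suc H) * t (Suc H) =
      s (Suc H) * (A + t (Suc H)) + (B + (s H - s (Suc H)) * A)"
    by (simp add: algebra_simps)
  ultimately show ?case by (simp only:)
qed simp

text \<open>Only the frequencies 1, ..., H. Those at d - H, ..., d - 1 are conjugates of the same
  expression for the conjugated coefficients, so one definition serves both.\<close>

definition low_part ::
  "(real \<Rightarrow> real) \<Rightarrow> real \<Rightarrow> (nat \<Rightarrow> complex) \<Rightarrow> nat \<Rightarrow> nat \<Rightarrow> nat \<Rightarrow> complex" where
  "low_part W N \<alpha> H d v = (\<Sum>h = 1..H. weight_sum W N (real h / real d) *
     twisted_sum \<alpha> (nat \<lfloor>N\<rfloor>) (real h * (real v / real d)))"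

text \<open>The weight has size O(N) and total variation O(H N^2 / D) over h \<le> H, hence O(N^(1 +
  \<epsilon>)) by the bound on H. Each partial sum in the Abel summation is a bilinear sum of length
  at most h N \<le> D N^\<epsilon>, and the factor 1 / d costs 1 / D.\<close>

lemma low_frequency_sum_le:
  fixes \<epsilon> :: real
  assumes f: "binary_form k f" "k \<ge> 2" "irreducible f" and W: "bump W" and "\<epsilon> > 0"
  shows "\<exists>C \<ge> 0. \<forall>N D H (\<alpha> :: nat \<Rightarrow> complex). N \<ge> 1 \<and> 1 \<le> D \<and> real H \<le> D * N powr (\<epsilon> - 1) \<and>
      (\<forall>m. norm (\<alpha> m) \<le> 1) \<longrightarrow>
    (\<Sum>(d, v)\<in>root_pairs f D. norm (low_part W N \<alpha> H d v) / real d)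
      \<le> C * (N powr (1 + \<epsilon>) / D * (D * N powr \<epsilon>) powr (7 / 4 + \<epsilon>))"
proof -
  obtain C1 where C1: "C1 \<ge> 1" "\<forall>D Y h M (\<alpha> :: nat \<Rightarrow> complex).
    1 \<le> D \<and> D \<le> Y \<and> real h * real M \<le> Y \<and> (\<forall>m. norm (\<alpha> m) \<le> 1) \<longrightarrow>
    (\<Sum>(d, v)\<in>root_pairs f D.
       norm (\<Sum>i = 1..h. \<Sum>m = 1..M. \<alpha> m * ee (real i * real m * (real v / real d)))) \<le> C1 * Y powr (7 / 4 + \<epsilon>)"
    using bilinear_sum_over_roots_le[OF f assms(5)] by blast
  obtain C2 where C2: "C2 \<ge> 0" "\<And>N \<theta> \<theta>'. N \<ge> 1 \<Longrightarrow> norm (weight_sum W N \<theta>) \<le> C2 * N"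
    "\<And>N \<theta> \<theta>'. N \<ge> 1 \<Longrightarrow> norm (weight_sum W N \<theta> - weight_sum W N \<theta>') \<le> C2 * N ^ 2 * \<bar>\<theta> - \<theta>'\<bar>"
    using weight_sum_bounded_lipschitz[OF W] by blast
  show ?thesis
  proof (intro exI[of _ "2 * C2 * C1"] conjI allI impI)
    show "0 \<le> 2 * C2 * C1" using C1(1) C2(1) by simp
    fix N D :: real and H :: nat and \<alpha> :: "nat \<Rightarrow> complex"
    assume "N \<ge> 1 \<and> 1 \<le> D \<and> real H \<le> D * N powr (\<epsilon> - 1) \<and> (\<forall>m. norm (\<alpha> m) \<le> 1)"
    then have N: "N \<ge> 1" and D: "1 \<le> D" and H: "real H \<le> D * N powr (\<epsilon> - 1)" and \<alpha>: "\<forall>m. norm (\<alpha> m) \<le> 1" by auto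
    define M where "M = nat \<lfloor>N\<rfloor>"
    have M: "real M \<le> N" using N by (simp add: M_def)
    define Y where "Y = D * N powr \<epsilon>"
    have "1 \<le> N powr \<epsilon>" using N assms(5) by (intro ge_one_powr_ge_zero) auto
    then have DY: "D \<le> Y" using D mult_left_mono[of 1 "N powr \<epsilon>" D] by (simp add: Y_def)
    define Q where "Q = C1 * Y powr (7 / 4 + \<epsilon>)"
    have Q0: "Q \<ge> 0" using C1(1) by (simp add: Q_def)
    define s where "s p h = weight_sum W N (real h / real (fst p))" for p :: "nat \<times> nat" and h :: nat
    define t where "t p h = twisted_sum \<alpha> M (real h * (real (snd p) / real (fst p)))" for p :: "nat \<times> nat" and h :: nat
    define E where "E h p = norm (\<Sum>i = 1..h. t p i)" for h p
    have EQ: "(\<Sum>p\<in>root_pairs f D. E h p) \<le> Q" if "h \<le> H" for h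
    proof -
      have "real h * real M \<le> (D * N powr (\<epsilon> - 1)) * N"
        using H M that N D by (intro mult_mono) auto
      also have "\<dots> = Y" using N by (simp add: Y_def powr_diff)
      finally have "real h * real M \<le> Y" .
      then have "(\<Sum>(d, v)\<in>root_pairs f D.
          norm (\<Sum>i = 1..h. \<Sum>m = 1..M. \<alpha> m * ee (real i * real m * (real v / real d)))) \<le> Q"
        unfolding Q_def using C1(2)[rule_format, of D Y h M \<alpha>] D DY \<alpha> by blast
      moreover have "E h p = norm (\<Sum>i = 1..h. \<Sum>m = 1..M. \<alpha> m * ee (real i * real m * (real (snd p) / real (fst p))))" for p
        unfolding E_def t_def twisted_sum_def by (simp only: mult.assoc mult.left_commute)
      ultimately show ?thesis by (simp only: case_prod_unfold)
    qed
    have term_le: "norm (\<Sum>h = 1..H. s p h * t p h) / real (fst p) \<le>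
        (C2 * N * E H p + (\<Sum>h<H. C2 * N ^ 2 / D * E h p)) / D" if "p \<in> root_pairs f D" for p
    proof -
      have d: "D \<le> real (fst p)" using that by (auto simp: root_pairs_def dyadic_def)
      have "norm (\<Sum>h = 1..H. s p h * t p h) \<le>
          norm (s p H * (\<Sum>i = 1..H. t p i)) + (\<Sum>h<H. norm ((s p h - s p (Suc h)) * (\<Sum>i = 1..h. t p i)))"
        unfolding abel_summation by (rule order_trans[OF norm_triangle_ineq add_left_mono[OF norm_sum]])
      also have "\<dots> \<le> C2 * N * E H p + (\<Sum>h<H. C2 * N ^ 2 / D * E h p)"
        unfolding norm_mult E_def[symmetric]
      proof (intro add_mono sum_mono mult_right_mono)
        show "norm (s p H) \<le> C2 * N" unfolding s_def by (rule C2(2)[OF N])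
        fix h
        have "norm (s p h - s p (Suc h)) \<le> C2 * N ^ 2 * \<bar>real h / real (fst p) - real (Suc h) / real (fst p)\<bar>"
          unfolding s_def by (rule C2(3)[OF N])
        also have "\<bar>real h / real (fst p) - real (Suc h) / real (fst p)\<bar> = 1 / real (fst p)"
          using d D by (simp add: diff_divide_distrib[symmetric])
        also have "C2 * N ^ 2 * (1 / real (fst p)) \<le> C2 * N ^ 2 * (1 / D)"
          using C2(1) d D by (intro mult_left_mono frac_le) auto
        finally show "norm (s p h - s p (Suc h)) \<le> C2 * N ^ 2 / D" by simp
      qed (auto simp: E_def)
      finally have le: "norm (\<Sum>h = 1..H. s p h * t p h) \<le> C2 * N * E H p + (\<Sum>h<H. C2 * N ^ 2 / D * E h p)" .
      show ?thesis
        by (rule frac_le[OF order_trans[OF norm_ge_zero le] le]) (use d D in auto)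
    qed
    have "(\<Sum>(d, v)\<in>root_pairs f D. norm (low_part W N \<alpha> H d v) / real d) =
        (\<Sum>p\<in>root_pairs f D. norm (\<Sum>h = 1..H. s p h * t p h) / real (fst p))"
      by (simp add: low_part_def s_def t_def M_def case_prod_unfold)
    also have "\<dots> \<le> (\<Sum>p\<in>root_pairs f D. (C2 * N * E H p + (\<Sum>h<H. C2 * N ^ 2 / D * E h p)) / D)"
      by (intro sum_mono term_le)
    also have "\<dots> = (C2 * N * (\<Sum>p\<in>root_pairs f D. E H p) + (\<Sum>p\<in>root_pairs f D. \<Sum>h<H. C2 * N ^ 2 / D * E h p)) / D"
      by (simp only: sum_divide_distrib[symmetric] sum.distrib sum_distrib_left)
    also have "(\<Sum>p\<in>root_pairs f D. \<Sum>h<H. C2 * N ^ 2 / D * E h p) = (\<Sum>h<H. C2 * N ^ 2 / D * (\<Sum>p\<in>root_pairs f D. E h p))"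
      by (subst sum.swap) (simp only: sum_distrib_left)
    also have "(C2 * N * (\<Sum>p\<in>root_pairs f D. E H p) + (\<Sum>h<H. C2 * N ^ 2 / D * (\<Sum>p\<in>root_pairs f D. E h p))) / D
        \<le> (C2 * N * Q + (\<Sum>h<H. C2 * N ^ 2 / D * Q)) / D"
      using EQ C2(1) N D by (intro divide_right_mono add_mono mult_left_mono sum_mono) auto
    also have "\<dots> = (C2 * Q * N + C2 * Q * (N ^ 2 / D * real H)) / D" by (simp add: mult_ac)
    also have "\<dots> \<le> (C2 * Q * N powr (1 + \<epsilon>) + C2 * Q * N powr (1 + \<epsilon>)) / D"
    proof (intro divide_right_mono add_mono mult_left_mono)
      show "N \<le> N powr (1 + \<epsilon>)" using powr_mono[of 1 "1 + \<epsilon>" N] N assms(5) by simp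
      have "N ^ 2 / D * real H \<le> N ^ 2 / D * (D * N powr (\<epsilon> - 1))" using H D by (intro mult_left_mono) auto
      also have "\<dots> = N ^ 2 * N powr (\<epsilon> - 1)" using D by simp
      also have "\<dots> = N powr 2 * N powr (\<epsilon> - 1)" using N by simp
      also have "\<dots> = N powr (1 + \<epsilon>)" by (simp only: powr_add[symmetric]) (simp add: add.commute)
      finally show "N ^ 2 / D * real H \<le> N powr (1 + \<epsilon>)" .
    qed (use C2(1) Q0 D in auto)
    also have "\<dots> = 2 * C2 * C1 * (N powr (1 + \<epsilon>) / D * (D * N powr \<epsilon>) powr (7 / 4 + \<epsilon>))"
      by (simp add: Q_def Y_def)
    finally show "(\<Sum>(d, v)\<in>root_pairs f D. norm (low_part W N \<alpha> H d v) / real d)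
      \<le> 2 * C2 * C1 * (N powr (1 + \<epsilon>) / D * (D * N powr \<epsilon>) powr (7 / 4 + \<epsilon>))" .
  qed
qed

lemma weight_sum_reflect:
  assumes "h \<le> d" "d > 0"
  shows "weight_sum W N (real (d - h) / real d) = cnj (weight_sum W N (real h / real d))"
proof -
  have "ee (- (real n * (real (d - h) / real d))) = cnj (ee (- (real n * (real h / real d))))" for n
  proof -
    have "- (real n * (real (d - h) / real d)) = of_int (- int n) + real n * (real h / real d)"
      using assms by (simp add: of_nat_diff field_simps)
    then show ?thesis by (simp only: ee_add ee_of_int cnj_ee) simp
  qed
  then show ?thesis by (simp add: weight_sum_def)
qed

text \<open>The frequency d - h is -h modulo d. The transform of a real weight is merely conjugated,
  but \<alpha> is complex, so here the conjugation passes to the coefficients, which keep their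
  bound.\<close>

lemma twisted_sum_reflect:
  assumes "h \<le> d" "d > 0"
  shows "twisted_sum \<alpha> M (real (d - h) * (real v / real d)) =
    cnj (twisted_sum (\<lambda>m. cnj (\<alpha> m)) M (real h * (real v / real d)))"
proof -
  have "ee (real m * (real (d - h) * (real v / real d))) = cnj (ee (real m * (real h * (real v / real d))))" for m
  proof -
    have "real m * (real (d - h) * (real v / real d)) = of_int (int m * int v) + - (real m * (real h * (real v / real d)))"
      using assms by (simp add: of_nat_diff field_simps)
    then show ?thesis by (simp only: ee_add ee_of_int cnj_ee) simp
  qed
  then show ?thesis by (simp add: twisted_sum_def)
qed

lemma norm_twisted_sum_le:
  assumes "\<And>m. norm (\<alpha> m) \<le> 1"
  shows "norm (twisted_sum \<alpha> M x) \<le> real M"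
proof -
  have "norm (twisted_sum \<alpha> M x) \<le> real (card {1..M}) * 1"
    unfolding twisted_sum_def by (rule sum_norm_bound) (simp add: norm_mult assms)
  then show ?thesis by simp
qed

lemma sum_residues_split:
  fixes F :: "nat \<Rightarrow> complex"
  assumes "2 * H < d"
  shows "(\<Sum>h<d. F h) = F 0 + (\<Sum>h = 1..H. F h) + (\<Sum>h = 1..H. F (d - h)) + (\<Sum>h\<in>{Suc H..<d - H}. F h)"
proof -
  define A B C where "A = {1..H}" and "B = (\<lambda>h. d - h) ` {1..H}" and "C = {Suc H..<d - H}"
  have fin: "finite A" "finite B" "finite C" by (simp_all add: A_def B_def C_def)
  have "{..<d} = insert 0 (A \<union> B \<union> C)"
  proof (intro equalityI subsetI)
    fix h assume h: "h \<in> {..<d}"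
    show "h \<in> insert 0 (A \<union> B \<union> C)"
    proof (cases "d - H \<le> h")
      case True
      then have "h = d - (d - h)" "d - h \<in> {1..H}" using h by auto
      then show ?thesis unfolding B_def by blast
    qed (use h in \<open>auto simp: A_def C_def\<close>)
  qed (use assms in \<open>auto simp: A_def B_def C_def\<close>)
  moreover have "0 \<notin> A \<union> B \<union> C" using assms by (auto simp: A_def B_def C_def)
  ultimately have "(\<Sum>h<d. F h) = F 0 + sum F (A \<union> B \<union> C)"
    using fin by (simp only: sum.insert finite_Un simp_thms)
  also have "sum F (A \<union> B \<union> C) = sum F (A \<union> B) + sum F C"
    by (rule sum.union_disjoint) (use fin in \<open>auto simp: A_def B_def C_def\<close>)
  also have "sum F (A \<union> B) = sum F A + sum F B"
    by (rule sum.union_disjoint) (use fin assms in \<open>auto simp: A_def B_def\<close>)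
  also have "sum F B = (\<Sum>h = 1..H. F (d - h))"
    unfolding B_def using assms by (subst sum.reindex) (auto simp: inj_on_def)
  finally show ?thesis by (simp add: A_def C_def add.assoc)
qed

text \<open>\<open>M_sum\<close> gives each root the same share, which is compared with frequency 0
  of that root. The other frequencies split into low positive, low negative and middle ones; for the
  middle ones the twisted sum is bounded by N.\<close>

lemma root_model_M_sum_diff_le:
  fixes \<alpha> :: "nat \<Rightarrow> complex"
  assumes "N \<ge> 1" "2 * H < d" and \<alpha>: "\<And>m. norm (\<alpha> m) \<le> 1"
  shows "norm (root_model f W d N \<alpha> - M_sum f W d N \<alpha>) \<le> (\<Sum>v\<in>form_roots f d.
    (norm (weight_sum W N 0 - of_real (N * hat_zero W)) * N + norm (low_part W N \<alpha> H d v) + norm (low_part W N (\<lambda>m. cnj (\<alpha> m)) H d v)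
      + (\<Sum>h\<in>{Suc H..<d - H}. norm (weight_sum W N (real h / real d))) * N) / real d)"
proof -
  have d: "d > 0" using assms(2) by simp
  define M where "M = nat \<lfloor>N\<rfloor>"
  have M: "real M \<le> N" using assms(1) by (simp add: M_def)
  have tw: "norm (twisted_sum \<alpha> M x) \<le> N" for x using norm_twisted_sum_le[of \<alpha> M x] \<alpha> M by force
  define G where "G v h = weight_sum W N (real h / real d) * twisted_sum \<alpha> M (real h * (real v / real d))" for v h :: nat
  define w where "w = complex_of_real (N * hat_zero W)"
  have "{m. 0 < m \<and> real m \<le> N} = {1..M}"
    using assms(1) by (auto simp: M_def le_nat_floor le_nat_iff le_floor_iff)
  then have "M_sum f W d N \<alpha> = complex_of_real (N * real (card (form_roots f d)) * hat_zero W / real d) * twisted_sum \<alpha> M 0"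
    by (simp add: M_sum_def root_count_eq_card twisted_sum_def)
  also have "\<dots> = (\<Sum>v\<in>form_roots f d. w * twisted_sum \<alpha> M 0 / of_nat d)"
    by (simp add: w_def)
  finally have "root_model f W d N \<alpha> - M_sum f W d N \<alpha> =
      (\<Sum>v\<in>form_roots f d. ((\<Sum>h<d. G v h) - w * twisted_sum \<alpha> M 0) / of_nat d)"
    unfolding root_model_fourier[OF d] by (simp add: sum_subtractf diff_divide_distrib G_def M_def)
  then have "norm (root_model f W d N \<alpha> - M_sum f W d N \<alpha>) \<le>
      (\<Sum>v\<in>form_roots f d. norm (((\<Sum>h<d. G v h) - w * twisted_sum \<alpha> M 0) / of_nat d))"
    by (simp only: norm_sum)
  also have "\<dots> \<le> (\<Sum>v\<in>form_roots f d.
    (norm (weight_sum W N 0 - w) * N + norm (low_part W N \<alpha> H d v) + norm (low_part W N (\<lambda>m. cnj (\<alpha> m)) H d v)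
      + (\<Sum>h\<in>{Suc H..<d - H}. norm (weight_sum W N (real h / real d))) * N) / real d)"
  proof (rule sum_mono)
    fix v
    have refl: "(\<Sum>h = 1..H. G v (d - h)) = cnj (\<Sum>h = 1..H. weight_sum W N (real h / real d) *
        twisted_sum (\<lambda>m. cnj (\<alpha> m)) M (real h * (real v / real d)))"
      unfolding cnj_sum
    proof (rule sum.cong[OF refl])
      fix h assume "h \<in> {1..H}"
      then have "h \<le> d" using assms(2) by simp
      then show "G v (d - h) = cnj (weight_sum W N (real h / real d) *
          twisted_sum (\<lambda>m. cnj (\<alpha> m)) M (real h * (real v / real d)))"
        unfolding G_def using weight_sum_reflect[OF _ d] twisted_sum_reflect[OF _ d] by simp
    qed
    have "(\<Sum>h<d. G v h) - w * twisted_sum \<alpha> M 0 = (weight_sum W N 0 - w) * twisted_sum \<alpha> M 0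
        + (\<Sum>h = 1..H. G v h) + (\<Sum>h = 1..H. G v (d - h)) + (\<Sum>h\<in>{Suc H..<d - H}. G v h)"
      unfolding sum_residues_split[OF assms(2)] by (simp add: G_def algebra_simps)
    then have "norm ((\<Sum>h<d. G v h) - w * twisted_sum \<alpha> M 0) \<le> norm ((weight_sum W N 0 - w) * twisted_sum \<alpha> M 0)
        + norm (\<Sum>h = 1..H. G v h) + norm (\<Sum>h = 1..H. G v (d - h)) + norm (\<Sum>h\<in>{Suc H..<d - H}. G v h)"
      by (metis (no_types, lifting) add_mono norm_triangle_ineq norm_triangle_mono order_refl)
    also have "\<dots> \<le> norm (weight_sum W N 0 - w) * N + norm (low_part W N \<alpha> H d v) + norm (low_part W N (\<lambda>m. cnj (\<alpha> m)) H d v)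
      + (\<Sum>h\<in>{Suc H..<d - H}. norm (weight_sum W N (real h / real d))) * N"
    proof (intro add_mono)
      show "norm ((weight_sum W N 0 - w) * twisted_sum \<alpha> M 0) \<le> norm (weight_sum W N 0 - w) * N"
        unfolding norm_mult using tw by (intro mult_left_mono) auto
      show "norm (\<Sum>h = 1..H. G v h) \<le> norm (low_part W N \<alpha> H d v)" by (simp add: G_def low_part_def M_def)
      show "norm (\<Sum>h = 1..H. G v (d - h)) \<le> norm (low_part W N (\<lambda>m. cnj (\<alpha> m)) H d v)"
        unfolding refl complex_mod_cnj by (simp add: low_part_def M_def)
      show "norm (\<Sum>h\<in>{Suc H..<d - H}. G v h) \<le> (\<Sum>h\<in>{Suc H..<d - H}. norm (weight_sum W N (real h / real d))) * N"
        unfolding sum_distrib_right G_def using tw by (intro sum_norm_le) (auto simp: norm_mult intro: mult_left_mono)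
    qed
    finally show "norm (((\<Sum>h<d. G v h) - w * twisted_sum \<alpha> M 0) / of_nat d) \<le>
      (norm (weight_sum W N 0 - w) * N + norm (low_part W N \<alpha> H d v) + norm (low_part W N (\<lambda>m. cnj (\<alpha> m)) H d v)
      + (\<Sum>h\<in>{Suc H..<d - H}. norm (weight_sum W N (real h / real d))) * N) / real d"
      by (simp add: norm_divide divide_right_mono)
  qed
  finally show ?thesis by (simp add: w_def)
qed

text \<open>Frequency 0 and the middle frequencies contribute O(N / D + 1) per root, in total
  N^(4/3) up to \<epsilon>. The low frequencies carry the main error; its dependence on D is kept,
  to be evaluated where a stronger bound on D is assumed.\<close>

lemma sum_root_model_M_sum_diff_le:
  fixes \<epsilon> :: real
  assumes f: "binary_form k f" "k \<ge> 2" "irreducible f" and W: "bump W" and \<epsilon>: "0 < \<epsilon>" "\<epsilon> \<le> 1"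
  shows "\<exists>C \<ge> 0. \<forall>N D (\<alpha> :: nat \<Rightarrow> complex). N \<ge> 1 \<and> 1 \<le> D \<and> D \<le> N powr (4 / 3) \<and>
      (\<forall>m. norm (\<alpha> m) \<le> 1) \<longrightarrow>
    (\<Sum>d\<in>dyadic D. norm (root_model f W d N \<alpha> - M_sum f W d N \<alpha>)) \<le>
      C * (N powr (3 / 2 + 4 * \<epsilon>) + N powr (1 + \<epsilon>) / D * (D * N powr \<epsilon>) powr (7 / 4 + \<epsilon>))"
proof -
  \<comment> \<open>Middle frequencies will satisfy |1 - e(y)| \<ge> N^(\<epsilon> - 1), so j
    summations by parts leave N^(1 - \<epsilon> j). With \<epsilon> j \<ge> 2 this is at most 1 /
    N.\<close>
  define j where "j = nat \<lceil>2 / \<epsilon>\<rceil>"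
  have j: "\<epsilon> * real j \<ge> 2"
  proof -
    have "2 / \<epsilon> \<le> real j" unfolding j_def by linarith
    then show ?thesis using \<epsilon> by (simp add: field_simps)
  qed
  obtain C1 where C1: "C1 \<ge> 0" "\<And>N. N \<ge> 1 \<Longrightarrow> norm (weight_sum W N 0 - of_real (N * hat_zero W)) \<le> C1"
    using weight_sum_0_approx[OF W] by blast
  obtain C2 where C2: "C2 \<ge> 0" "\<And>N \<theta>. N \<ge> 1 \<Longrightarrow> norm (1 - ee \<theta>) ^ j * norm (weight_sum W N \<theta>) \<le> C2 * N / N ^ j"
    using weight_sum_decay[OF W] by blast
  obtain C3 where C3: "C3 \<ge> 0" "\<forall>N D H (\<alpha> :: nat \<Rightarrow> complex). N \<ge> 1 \<and> 1 \<le> D \<and> real H \<le> D * N powr (\<epsilon> - 1) \<and>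
      (\<forall>m. norm (\<alpha> m) \<le> 1) \<longrightarrow>
    (\<Sum>(d, v)\<in>root_pairs f D. norm (low_part W N \<alpha> H d v) / real d)
      \<le> C3 * (N powr (1 + \<epsilon>) / D * (D * N powr \<epsilon>) powr (7 / 4 + \<epsilon>))"
    using low_frequency_sum_le[OF f W \<epsilon>(1)] by blast
  obtain C4 where C4: "C4 \<ge> 1" "\<And>D. D \<ge> 1 \<Longrightarrow> real (card (root_pairs f D)) \<le> C4 * D powr (1 + \<epsilon>)"
    using card_root_pairs_le[OF f \<epsilon>(1)] by blast
  define C where "C = C4 * (C1 + C2) + 2 * C3"
  show ?thesis
  proof (intro exI[of _ C] conjI allI impI)
    show "0 \<le> C" using C1(1) C2(1) C3(1) C4(1) by (simp add: C_def)
    fix N D :: real and \<alpha> :: "nat \<Rightarrow> complex"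
    assume "N \<ge> 1 \<and> 1 \<le> D \<and> D \<le> N powr (4 / 3) \<and> (\<forall>m. norm (\<alpha> m) \<le> 1)"
    then have N: "N \<ge> 1" and D: "1 \<le> D" "D \<le> N powr (4 / 3)" and \<alpha>: "\<And>m. norm (\<alpha> m) \<le> 1" by auto
    define X where "X = N powr (1 + \<epsilon>) / D * (D * N powr \<epsilon>) powr (7 / 4 + \<epsilon>)"
    have X0: "X \<ge> 0" using D by (simp add: X_def)
    define q where "q = N powr (\<epsilon> - 1)"
    have q: "0 < q" "q \<le> 1" using N \<epsilon> powr_mono[of "\<epsilon> - 1" 0 N] by (auto simp: q_def)
    \<comment> \<open>D q is the cut-off D N^(\<epsilon> - 1); the cap D / 2 ensures 2 H < d for
      every modulus, also when q is close to 1.\<close>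
    define Z where "Z = min (D * q) (D / 2)"
    have Z0: "Z > 0" using D q by (simp add: Z_def)
    \<comment> \<open>The largest integer strictly below Z: strictness gives 2 H < d, and every h
      \<ge> H + 1 is at least Z. It may be 0, and then there are no low frequencies.\<close>
    define H where "H = nat \<lceil>Z\<rceil> - 1"
    have H: "real H < Z" "Z \<le> real H + 1" using Z0 unfolding H_def by linarith+
    have HD: "real H \<le> D * N powr (\<epsilon> - 1)" using H(1) by (simp add: Z_def q_def)
    have d: "D \<le> real d" "real d < 2 * D" "2 * H < d" if "d \<in> dyadic D" for d
    proof -
      show d1: "D \<le> real d" "real d < 2 * D" using that by (auto simp: dyadic_def)
      have "2 * real H < D" using H(1) by (simp add: Z_def)
      then have "real (2 * H) < real d" using d1 by simp
      then show "2 * H < d" by (simp only: of_nat_less_iff)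
    qed
    have middle: "norm (weight_sum W N (real h / real d)) \<le> C2 / N"
      if dd: "d \<in> dyadic D" and h: "h \<in> {Suc H..<d - H}" for d h
    proof -
      define y where "y = real h / real d"
      have dpos: "real d > 0" using d[OF dd] D by simp
      have hd: "h \<le> d" using h by auto
      have y: "0 \<le> y" "y \<le> 1" using hd dpos by (auto simp: y_def)
      have "Z \<le> real h" "Z \<le> real d - real h" using H(2) h hd by (auto simp: of_nat_diff)
      then have "Z / real d \<le> y" "Z / real d \<le> 1 - y"
        using dpos by (auto simp: y_def field_simps)
      moreover have "Z / (2 * D) \<le> Z / real d" using Z0 d[OF dd] dpos by (intro divide_left_mono) auto
      \<comment> \<open>Z / (2 D) is the minimum of q / 2 and 1 / 4, at least q / 4 as q \<le> 1.
        The 4 then cancels against the constant in |1 - e(y)| \<ge> 4 min(y, 1 - y).\<close>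
      moreover have "q / 4 \<le> Z / (2 * D)" using q D by (auto simp: Z_def min_def field_simps)
      ultimately have "q / 4 \<le> y" "q / 4 \<le> 1 - y" by (meson order_trans)+
      then have "q \<le> 4 * min y (1 - y)" by (cases "y \<le> 1 - y") (simp_all add: min_def)
      also have "\<dots> \<le> norm (1 - ee y)" by (rule norm_1_minus_ee_ge[OF y])
      finally have "q ^ j \<le> norm (1 - ee y) ^ j" using q by (intro power_mono) auto
      then have "q ^ j * norm (weight_sum W N y) \<le> norm (1 - ee y) ^ j * norm (weight_sum W N y)"
        by (intro mult_right_mono) auto
      also have "\<dots> \<le> C2 * N / N ^ j" by (rule C2(2)[OF N])
      finally have "norm (weight_sum W N y) \<le> C2 * N / (N ^ j * q ^ j)"
        using q N by (simp add: field_simps)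
      also have "N ^ j * q ^ j = N powr (\<epsilon> * real j)"
      proof -
        have "N * q = N powr \<epsilon>" using N by (simp add: q_def powr_diff)
        then have "N ^ j * q ^ j = (N powr \<epsilon>) ^ j" by (simp flip: power_mult_distrib)
        also have "\<dots> = N powr (\<epsilon> * real j)" using N by (simp add: powr_powr flip: powr_realpow)
        finally show ?thesis .
      qed
      also have "C2 * N / N powr (\<epsilon> * real j) \<le> C2 * N / N powr 2"
        using j N C2(1) by (intro divide_left_mono powr_mono) auto
      also have "\<dots> = C2 / N" using N by (simp add: power2_eq_square)
      finally show ?thesis by (simp add: y_def)
    qed
    have point: "norm (root_model f W d N \<alpha> - M_sum f W d N \<alpha>) \<le> (\<Sum>v\<in>form_roots f d.
        (C1 * N / D + C2) + norm (low_part W N \<alpha> H d v) / real d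
          + norm (low_part W N (\<lambda>m. cnj (\<alpha> m)) H d v) / real d)" if dd: "d \<in> dyadic D" for d
    proof (rule order_trans[OF root_model_M_sum_diff_le[OF N d(3)[OF dd] \<alpha>]], rule sum_mono)
      fix v
      have dpos: "real d > 0" using d[OF dd] D by simp
      have 1: "norm (weight_sum W N 0 - of_real (N * hat_zero W)) * N / real d \<le> C1 * N / D"
        using C1(2)[OF N] C1(1) N d[OF dd] D by (intro frac_le mult_right_mono) auto
      have "(\<Sum>h\<in>{Suc H..<d - H}. norm (weight_sum W N (real h / real d))) \<le> real (card {Suc H..<d - H}) * (C2 / N)"
        by (rule sum_bounded_above) (rule middle[OF dd])
      also have "\<dots> \<le> real d * (C2 / N)" using C2(1) N by (intro mult_right_mono) auto
      finally have "(\<Sum>h\<in>{Suc H..<d - H}. norm (weight_sum W N (real h / real d))) * N \<le> real d * (C2 / N) * N"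
        using N by (intro mult_right_mono) auto
      then have 2: "(\<Sum>h\<in>{Suc H..<d - H}. norm (weight_sum W N (real h / real d))) * N / real d \<le> C2"
        using N dpos by (simp add: field_simps)
      show "(norm (weight_sum W N 0 - of_real (N * hat_zero W)) * N + norm (low_part W N \<alpha> H d v)
          + norm (low_part W N (\<lambda>m. cnj (\<alpha> m)) H d v)
          + (\<Sum>h\<in>{Suc H..<d - H}. norm (weight_sum W N (real h / real d))) * N) / real d \<le>
          (C1 * N / D + C2) + norm (low_part W N \<alpha> H d v) / real d
          + norm (low_part W N (\<lambda>m. cnj (\<alpha> m)) H d v) / real d"
        unfolding add_divide_distrib using 1 2 by linarith
    qed
    have "(\<Sum>d\<in>dyadic D. norm (root_model f W d N \<alpha> - M_sum f W d N \<alpha>)) \<le>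
        (\<Sum>d\<in>dyadic D. \<Sum>v\<in>form_roots f d. (C1 * N / D + C2) + norm (low_part W N \<alpha> H d v) / real d
          + norm (low_part W N (\<lambda>m. cnj (\<alpha> m)) H d v) / real d)"
      by (rule sum_mono) (rule point)
    also have "\<dots> = (\<Sum>(d, v)\<in>root_pairs f D. C1 * N / D + C2)
        + (\<Sum>(d, v)\<in>root_pairs f D. norm (low_part W N \<alpha> H d v) / real d)
        + (\<Sum>(d, v)\<in>root_pairs f D. norm (low_part W N (\<lambda>m. cnj (\<alpha> m)) H d v) / real d)"
      unfolding sum_root_pairs case_prod_unfold sum.distrib ..
    also have "\<dots> \<le> C4 * (C1 + C2) * N powr (3 / 2 + 4 * \<epsilon>) + C3 * X + C3 * X"
    proof (intro add_mono)
      have "(\<Sum>(d, v)\<in>root_pairs f D. C1 * N / D + C2) = real (card (root_pairs f D)) * (C1 * N / D + C2)"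
        by (simp add: case_prod_unfold)
      also have "\<dots> \<le> C4 * D powr (1 + \<epsilon>) * (C1 * N / D + C2)"
        using C4(2)[OF D(1)] C1(1) C2(1) N D by (intro mult_right_mono) auto
      also have "\<dots> = C4 * (D powr \<epsilon> * (C1 * N + C2 * D))"
        using D by (simp add: powr_add field_simps)
      also have "\<dots> \<le> C4 * (N powr (4 / 3 * \<epsilon>) * (C1 * N powr (4 / 3) + C2 * N powr (4 / 3)))"
      proof (intro mult_left_mono mult_mono add_mono powr_le_of_le_powr D)
        show "N \<le> N powr (4 / 3)" using powr_mono[of 1 "4 / 3" N] N by simp
      qed (use C1(1) C2(1) C4(1) N D \<epsilon> in auto)
      also have "\<dots> = C4 * (C1 + C2) * N powr (4 / 3 * \<epsilon> + 4 / 3)"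
        by (simp add: powr_add algebra_simps)
      also have "\<dots> \<le> C4 * (C1 + C2) * N powr (3 / 2 + 4 * \<epsilon>)"
        using C1(1) C2(1) C4(1) N \<epsilon> by (intro mult_left_mono powr_mono) auto
      finally show "(\<Sum>(d, v)\<in>root_pairs f D. C1 * N / D + C2) \<le> C4 * (C1 + C2) * N powr (3 / 2 + 4 * \<epsilon>)" .
      show "(\<Sum>(d, v)\<in>root_pairs f D. norm (low_part W N \<alpha> H d v) / real d) \<le> C3 * X"
        unfolding X_def using C3(2) N D(1) HD \<alpha> by blast
      have "\<forall>m. norm (cnj (\<alpha> m)) \<le> 1" using \<alpha> by simp
      then show "(\<Sum>(d, v)\<in>root_pairs f D. norm (low_part W N (\<lambda>m. cnj (\<alpha> m)) H d v) / real d) \<le> C3 * X"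
        unfolding X_def using C3(2)[rule_format, of N D H "\<lambda>m. cnj (\<alpha> m)"] N D(1) HD by blast
    qed
    also have "\<dots> \<le> C * (N powr (3 / 2 + 4 * \<epsilon>) + X)"
    proof -
      have "0 \<le> C4 * (C1 + C2) * X" using X0 C1(1) C2(1) C4(1) by simp
      moreover have "0 \<le> 2 * C3 * N powr (3 / 2 + 4 * \<epsilon>)" using C3(1) by simp
      ultimately show ?thesis unfolding C_def by (simp add: algebra_simps)
    qed
    finally show "(\<Sum>d\<in>dyadic D. norm (root_model f W d N \<alpha> - M_sum f W d N \<alpha>)) \<le>
      C * (N powr (3 / 2 + 4 * \<epsilon>) + N powr (1 + \<epsilon>) / D * (D * N powr \<epsilon>) powr (7 / 4 + \<epsilon>))"
      unfolding X_def .
  qed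
qed

lemma bumpI:
  assumes "smooth W" "closure {t. W t \<noteq> 0} \<subseteq> {0..1}"
  shows "bump W"
  unfolding bump_def
proof (intro conjI allI impI)
  show "smooth W" by (rule assms(1))
  fix t :: real assume "t < 0 \<or> 1 < t"
  then have "t \<notin> closure {t. W t \<noteq> 0}" using assms(2) by auto
  then show "W t = 0" using closure_subset[of "{t. W t \<noteq> 0}"] by blast
qed

theorem theorem3:
  fixes \<delta>\<^sub>1 :: real
  assumes "\<delta>\<^sub>1 > 0"
  shows "\<exists>\<delta>\<^sub>2 > 0. \<forall>(f :: int poly poly) (k :: nat) (W :: real \<Rightarrow> real).
           binary_form k f \<and> k \<ge> 2 \<and> irreducible f \<and>
           smooth W \<and> (\<forall>t. W t \<ge> 0) \<and> closure {t. W t \<noteq> 0} \<subseteq> {0..1} \<longrightarrow>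
           (\<exists>C :: real. \<forall>(N :: real) (D :: real) (\<alpha> :: nat \<Rightarrow> complex).
              N \<ge> 1 \<and> 1 \<le> D \<and> D \<le> N powr (4 / 3 - \<delta>\<^sub>1) \<and>
              (\<forall>m. cmod (\<alpha> m) \<le> 1) \<and> (\<forall>m. \<alpha> m \<noteq> 0 \<longrightarrow> prime m) \<longrightarrow>
              (\<Sum>d | D \<le> real d \<and> real d < 2 * D. cmod (A_sum f W d N \<alpha> - M_sum f W d N \<alpha>))
                \<le> C * N powr (2 - \<delta>\<^sub>2))"
proof -
  \<comment> \<open>The cap at 1 keeps 3/2 + 4 \<eta> below 2 - \<delta> / 4. The main term saves 3
    \<delta> / 4 in the exponent and loses at most 13 \<eta> / 3; with \<eta> = \<delta> / 20 more
    than \<delta> / 4 remains.\<close>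
  define \<delta> where "\<delta> = min \<delta>\<^sub>1 1"
  define \<eta> where "\<eta> = \<delta> / 20"
  have \<delta>: "0 < \<delta>" "\<delta> \<le> 1" "\<delta> \<le> \<delta>\<^sub>1" using assms by (auto simp: \<delta>_def)
  have \<eta>: "0 < \<eta>" "\<eta> \<le> 1" "\<eta> \<le> 1 / 4" using \<delta> by (auto simp: \<eta>_def)
  show ?thesis
  proof (rule exI[of _ "\<delta> / 4"], intro conjI allI impI)
    show "0 < \<delta> / 4" using \<delta> by simp
    fix f :: "int poly poly" and k :: nat and W :: "real \<Rightarrow> real"
    assume "binary_form k f \<and> k \<ge> 2 \<and> irreducible f \<and>
           smooth W \<and> (\<forall>t. W t \<ge> 0) \<and> closure {t. W t \<noteq> 0} \<subseteq> {0..1}"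
    then have f: "binary_form k f" "k \<ge> 2" "irreducible f" and W: "bump W" by (auto intro: bumpI)
    obtain C1 where C1: "C1 \<ge> 0" "\<forall>N D (\<alpha> :: nat \<Rightarrow> complex). N \<ge> 1 \<and> 1 \<le> D \<and> D \<le> N powr (4 / 3) \<and>
        (\<forall>m. norm (\<alpha> m) \<le> 1) \<and> (\<forall>m. \<alpha> m \<noteq> 0 \<longrightarrow> prime m) \<longrightarrow>
      (\<Sum>d\<in>dyadic D. norm (A_sum f W d N \<alpha> - root_model f W d N \<alpha>)) \<le> C1 * N powr (3 / 2 + 4 * \<eta>)"
      using sum_A_sum_root_model_diff_le[OF f W \<eta>(1)] by blast
    obtain C2 where C2: "C2 \<ge> 0" "\<forall>N D (\<alpha> :: nat \<Rightarrow> complex). N \<ge> 1 \<and> 1 \<le> D \<and> D \<le> N powr (4 / 3) \<and>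
        (\<forall>m. norm (\<alpha> m) \<le> 1) \<longrightarrow>
      (\<Sum>d\<in>dyadic D. norm (root_model f W d N \<alpha> - M_sum f W d N \<alpha>)) \<le>
        C2 * (N powr (3 / 2 + 4 * \<eta>) + N powr (1 + \<eta>) / D * (D * N powr \<eta>) powr (7 / 4 + \<eta>))"
      using sum_root_model_M_sum_diff_le[OF f W \<eta>(1,2)] by blast
    show "\<exists>C :: real. \<forall>(N :: real) (D :: real) (\<alpha> :: nat \<Rightarrow> complex).
              N \<ge> 1 \<and> 1 \<le> D \<and> D \<le> N powr (4 / 3 - \<delta>\<^sub>1) \<and>
              (\<forall>m. cmod (\<alpha> m) \<le> 1) \<and> (\<forall>m. \<alpha> m \<noteq> 0 \<longrightarrow> prime m) \<longrightarrow>
              (\<Sum>d | D \<le> real d \<and> real d < 2 * D. cmod (A_sum f W d N \<alpha> - M_sum f W d N \<alpha>))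
                \<le> C * N powr (2 - \<delta> / 4)"
    proof (intro exI[of _ "C1 + C2 * 2"] allI impI)
      fix N D :: real and \<alpha> :: "nat \<Rightarrow> complex"
      assume *: "N \<ge> 1 \<and> 1 \<le> D \<and> D \<le> N powr (4 / 3 - \<delta>\<^sub>1) \<and>
              (\<forall>m. cmod (\<alpha> m) \<le> 1) \<and> (\<forall>m. \<alpha> m \<noteq> 0 \<longrightarrow> prime m)"
      then have N: "N \<ge> 1" and D: "1 \<le> D" "D \<le> N powr (4 / 3 - \<delta>\<^sub>1)" by auto
      have D': "D \<le> N powr (4 / 3)"
        using D(2) powr_mono[of "4 / 3 - \<delta>\<^sub>1" "4 / 3" N] N assms by linarith
      have low: "N powr (3 / 2 + 4 * \<eta>) \<le> N powr (2 - \<delta> / 4)"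
        using N \<delta> by (intro powr_mono) (auto simp: \<eta>_def)
      have main: "N powr (1 + \<eta>) / D * (D * N powr \<eta>) powr (7 / 4 + \<eta>) \<le> N powr (2 - \<delta> / 4)"
      proof -
        \<comment> \<open>One factor D cancels the denominator, so D carries the positive exponent
          3/4 + \<eta> when its upper bound is inserted.\<close>
        have "(D * N powr \<eta>) powr (7 / 4 + \<eta>) = D powr (1 + (3 / 4 + \<eta>)) * N powr (\<eta> * (7 / 4 + \<eta>))"
          using D N by (simp add: powr_mult powr_powr)
        also have "D powr (1 + (3 / 4 + \<eta>)) = D * D powr (3 / 4 + \<eta>)"
          using D by (subst powr_add) simp
        finally have "N powr (1 + \<eta>) / D * (D * N powr \<eta>) powr (7 / 4 + \<eta>) =
            D powr (3 / 4 + \<eta>) * (N powr (1 + \<eta>) * N powr (\<eta> * (7 / 4 + \<eta>)))"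
          using D by simp
        also have "\<dots> \<le> N powr ((4 / 3 - \<delta>\<^sub>1) * (3 / 4 + \<eta>)) * (N powr (1 + \<eta>) * N powr (\<eta> * (7 / 4 + \<eta>)))"
          using powr_le_of_le_powr[OF D, of "3 / 4 + \<eta>"] \<eta> by (intro mult_right_mono) auto
        also have "\<dots> = N powr ((4 / 3 - \<delta>\<^sub>1) * (3 / 4 + \<eta>) + ((1 + \<eta>) + \<eta> * (7 / 4 + \<eta>)))"
          by (simp only: powr_add)
        also have "\<dots> \<le> N powr (2 - \<delta> / 4)"
        proof (rule powr_mono)
          have "(4 / 3 - \<delta>\<^sub>1) * (3 / 4 + \<eta>) \<le> (4 / 3 - \<delta>) * (3 / 4 + \<eta>)"
            using \<delta> \<eta> by (intro mult_right_mono) auto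
          also have "\<dots> = 1 - 3 / 4 * \<delta> + 4 / 3 * \<eta> - \<delta> * \<eta>" by (simp add: algebra_simps)
          finally have 1: "(4 / 3 - \<delta>\<^sub>1) * (3 / 4 + \<eta>) \<le> 1 - 3 / 4 * \<delta> + 4 / 3 * \<eta>"
            using \<delta> \<eta> mult_nonneg_nonneg[of \<delta> \<eta>] by linarith
          have "\<eta> * (7 / 4 + \<eta>) \<le> \<eta> * 2" using \<eta> by (intro mult_left_mono) auto
          with 1 show "(4 / 3 - \<delta>\<^sub>1) * (3 / 4 + \<eta>) + ((1 + \<eta>) + \<eta> * (7 / 4 + \<eta>)) \<le> 2 - \<delta> / 4"
            unfolding \<eta>_def using \<delta> by linarith
        qed (use N in auto)
        finally show ?thesis .
      qed
      have "(\<Sum>d | D \<le> real d \<and> real d < 2 * D. cmod (A_sum f W d N \<alpha> - M_sum f W d N \<alpha>)) \<le>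
          (\<Sum>d\<in>dyadic D. norm (A_sum f W d N \<alpha> - root_model f W d N \<alpha>) +
             norm (root_model f W d N \<alpha> - M_sum f W d N \<alpha>))"
        unfolding dyadic_def[symmetric]
        by (intro sum_mono) (metis diff_add_cancel add_diff_eq norm_triangle_ineq)
      also have "\<dots> = (\<Sum>d\<in>dyadic D. norm (A_sum f W d N \<alpha> - root_model f W d N \<alpha>)) +
          (\<Sum>d\<in>dyadic D. norm (root_model f W d N \<alpha> - M_sum f W d N \<alpha>))"
        by (rule sum.distrib)
      also have "\<dots> \<le> C1 * N powr (3 / 2 + 4 * \<eta>) +
          C2 * (N powr (3 / 2 + 4 * \<eta>) + N powr (1 + \<eta>) / D * (D * N powr \<eta>) powr (7 / 4 + \<eta>))"
        using C1(2) C2(2) * D' by (intro add_mono) blast+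
      also have "\<dots> \<le> C1 * N powr (2 - \<delta> / 4) + C2 * (N powr (2 - \<delta> / 4) + N powr (2 - \<delta> / 4))"
        using low main C1(1) C2(1) by (intro add_mono mult_left_mono) auto
      also have "\<dots> = (C1 + C2 * 2) * N powr (2 - \<delta> / 4)" by (simp add: algebra_simps)
      finally show "(\<Sum>d | D \<le> real d \<and> real d < 2 * D. cmod (A_sum f W d N \<alpha> - M_sum f W d N \<alpha>))
          \<le> (C1 + C2 * 2) * N powr (2 - \<delta> / 4)" .
    qed
  qed
qed

end
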